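(* Let $\Gamma$ be a discrete group, and let $X$ be either the reduced group $C^*$-algebra $C^*_r(\Gamma)$, or the non-commutative $L^p$-space $L^p(\mathrm{VN}(\Gamma),\tau)$ associated to the group von Neumann algebra $\mathrm{VN}(\Gamma)$, for some $p\in[1,\infty]$. Let $\Gamma$ act by left translations on $X$ in the natural way, and let $\imath:\mathbb{C}\Gamma\to\mathcal{B}(X)$ be the induced algebra homomorphism. Then $(\imath(\mathbb{C}\Gamma),X)$ is a surjunctive pair.
   Context: For a Banach space $X$, $\mathcal{B}(X)$ denotes the algebra of bounded linear operators on $X$. The residual spectrum $\sigma_r(T)$ of $T\in\mathcal{B}(X)$ is the set of all $\lambda\in\sigma(T)$ such that $T-\lambda I$ is injective with closed range. For a subalgebra $A\subseteq\mathcal{B}(X)$ (not necessarily norm-closed or unital), $(A,X)$ is a surjunctive pair if every $T\in A$ has empty residual spectrum. $\mathrm{VN}(\Gamma)\subseteq\mathcal{B}(\ell^2(\Gamma))$ is the von Neumann algebra generated by the left regular representation $\lambda$ of $\Gamma$ on $\ell^2(\Gamma)$, and $C^*_r(\Gamma)$ is the norm-closed subalgebra generated by $\lambda(\Gamma)$. $\mathrm{VN}(\Gamma)$ carries the canonical faithful normal tracial state $\tau(T)=\langle T\delta_e,\delta_e\rangle$. For $x\in\mathrm{VN}(\Gamma)$ put $\|x\|_{(p)}=\tau((x^*x)^{p/2})^{1/p}$ for $1\le p<\infty$ and $\|x\|_{(\infty)}=\|x\|$; these are norms, and $L^p(\mathrm{VN}(\Gamma),\tau)$ is the completion of $\mathrm{VN}(\Gamma)$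 with respect to $\|\cdot\|_{(p)}$ (so $L^\infty(\mathrm{VN}(\Gamma),\tau)=\mathrm{VN}(\Gamma)$). One has $\|ax\|_{(p)}\le\|a\|\,\|x\|_{(p)}$ for $a,x\in\mathrm{VN}(\Gamma)$, so left multiplication by elements of $\mathrm{VN}(\Gamma)$ extends to $L^p(\mathrm{VN}(\Gamma),\tau)$. The natural action of $g\in\Gamma$ on $X$ by left translation is left multiplication by $\lambda(g)$ (extended continuously in the $L^p$ case), and $\imath$ is its linear extension to the group algebra $\mathbb{C}\Gamma$. *)

theory Defs
  imports "HOL-Analysis.Analysis" "HOL-Library.Poly_Mapping" "HOL-Computational_Algebra.Polynomial"
begin

section \<open>Complex Banach spaces\<close>

class complex_normed_vector = real_normed_vector +
  fixes scaleC :: "complex \<Rightarrow> 'a \<Rightarrow> 'a" (infixr \<open>*\<^sub>C\<close> 75)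
  assumes scaleC_add_right: "c *\<^sub>C (x + y) = c *\<^sub>C x + c *\<^sub>C y"
    and scaleC_add_left: "(c + d) *\<^sub>C x = c *\<^sub>C x + d *\<^sub>C x"
    and scaleC_scaleC: "c *\<^sub>C d *\<^sub>C x = (c * d) *\<^sub>C x"
    and scaleC_of_real: "complex_of_real r *\<^sub>C x = r *\<^sub>R x"
    and norm_scaleC: "norm (c *\<^sub>C x) = cmod c * norm x"

class complex_banach = complex_normed_vector + banach

lemma bounded_linear_scaleC: "bounded_linear (\<lambda>x::'a::complex_normed_vector. c *\<^sub>C x)"
proof (rule bounded_linear_intro)
  show "c *\<^sub>C (x + y) = c *\<^sub>C x + c *\<^sub>C y" for x y :: 'a
    by (rule scaleC_add_right)
  show "c *\<^sub>C (r *\<^sub>R x) = r *\<^sub>R (c *\<^sub>C x)" for r and x :: 'a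
    by (simp add: scaleC_of_real[symmetric] scaleC_scaleC mult.commute)
  show "norm (c *\<^sub>C x) \<le> norm x * cmod c" for x :: 'a
    by (simp add: norm_scaleC)
qed

definition closed_csubspace :: "'a::complex_normed_vector set \<Rightarrow> bool" where
  "closed_csubspace X \<longleftrightarrow> closed X \<and> 0 \<in> X \<and> (\<forall>x\<in>X. \<forall>y\<in>X. x + y \<in> X)
     \<and> (\<forall>c. \<forall>x\<in>X. c *\<^sub>C x \<in> X)"


section \<open>Residual spectrum and surjunctive pairs\<close>

text \<open>A Banach space is presented as a closed complex subspace \<open>X\<close> of a complex Banach space,
  possibly the whole type. Bounded operators on \<open>X\<close> are functions with the value
  \<^const>\<open>undefined\<close> outside \<open>X\<close>, so that equality of operators is equality on \<open>X\<close>.\<close>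

definition bounded_ops :: "'a::complex_normed_vector set \<Rightarrow> ('a \<Rightarrow> 'a) set" where
  "bounded_ops X = {T \<in> X \<rightarrow>\<^sub>E X.
     (\<forall>x\<in>X. \<forall>y\<in>X. T (x + y) = T x + T y) \<and>
     (\<forall>c. \<forall>x\<in>X. T (c *\<^sub>C x) = c *\<^sub>C T x) \<and>
     (\<exists>K. \<forall>x\<in>X. norm (T x) \<le> K * norm x)}"

definition op_subalgebra :: "('a \<Rightarrow> 'a) set \<Rightarrow> 'a::complex_normed_vector set \<Rightarrow> bool" where
  "op_subalgebra A X \<longleftrightarrow> A \<subseteq> bounded_ops X \<and> (\<lambda>x\<in>X. 0) \<in> A \<and>
     (\<forall>S\<in>A. \<forall>T\<in>A. (\<lambda>x\<in>X. S x + T x) \<in> A) \<and>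
     (\<forall>c. \<forall>T\<in>A. (\<lambda>x\<in>X. c *\<^sub>C T x) \<in> A) \<and>
     (\<forall>S\<in>A. \<forall>T\<in>A. (\<lambda>x\<in>X. S (T x)) \<in> A)"

definition spectrum :: "'a::complex_normed_vector set \<Rightarrow> ('a \<Rightarrow> 'a) \<Rightarrow> complex set" where
  "spectrum X T = {c. \<not> (\<exists>S\<in>bounded_ops X. \<forall>x\<in>X.
     S (T x - c *\<^sub>C x) = x \<and> T (S x) - c *\<^sub>C S x = x)}"

definition residual_spectrum :: "'a::complex_normed_vector set \<Rightarrow> ('a \<Rightarrow> 'a) \<Rightarrow> complex set" where
  "residual_spectrum X T = {c \<in> spectrum X T. inj_on (\<lambda>x. T x - c *\<^sub>C x) X \<and>
     closedin (top_of_set X) ((\<lambda>x. T x - c *\<^sub>C x) ` X)}"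

definition surjunctive_pair :: "('a \<Rightarrow> 'a) set \<Rightarrow> 'a::complex_banach set \<Rightarrow> bool" where
  "surjunctive_pair A X \<longleftrightarrow> closed_csubspace X \<and> op_subalgebra A X \<and>
     (\<forall>T\<in>A. residual_spectrum X T = {})"


section \<open>The Hilbert space of square-summable functions\<close>

typedef 'g ell2 = "{f :: 'g \<Rightarrow> complex. (\<lambda>g. (cmod (f g))\<^sup>2) summable_on UNIV}"
  by (rule exI[of _ "\<lambda>_. 0"]) simp

setup_lifting type_definition_ell2

lemma sq_summableI:
  fixes f :: "'g \<Rightarrow> complex"
  assumes "\<And>F. finite F \<Longrightarrow> L2_set (\<lambda>g. cmod (f g)) F \<le> C"
  shows "(\<lambda>g. (cmod (f g))\<^sup>2) summable_on UNIV"
    and "sqrt (\<Sum>\<^sub>\<infinity>g. (cmod (f g))\<^sup>2) \<le> C"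
proof -
  have C: "0 \<le> C" using assms[of "{}"] by simp
  have b: "(\<Sum>g\<in>F. (cmod (f g))\<^sup>2) \<le> C\<^sup>2" if "finite F" for F
    using assms[OF that] C by (simp add: L2_set_def real_sqrt_le_iff' sum_nonneg real_le_rsqrt sqrt_le_D)
  show s: "(\<lambda>g. (cmod (f g))\<^sup>2) summable_on UNIV"
    by (rule nonneg_bdd_above_summable_on) (auto intro!: bdd_aboveI2[where M = "C\<^sup>2"] b)
  have "(\<Sum>\<^sub>\<infinity>g. (cmod (f g))\<^sup>2) \<le> C\<^sup>2"
    by (rule infsum_le_finite_sums[OF s b])
  then show "sqrt (\<Sum>\<^sub>\<infinity>g. (cmod (f g))\<^sup>2) \<le> C"
    using C by (simp add: real_le_lsqrt)
qed

lemma L2_set_le_ell2: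
  fixes f :: "'g \<Rightarrow> complex"
  assumes "(\<lambda>g. (cmod (f g))\<^sup>2) summable_on UNIV" "finite F"
  shows "L2_set (\<lambda>g. cmod (f g)) F \<le> sqrt (\<Sum>\<^sub>\<infinity>g. (cmod (f g))\<^sup>2)"
  unfolding L2_set_def using finite_sum_le_infsum[OF assms] by simp

lemma L2_set_cmod_add_le:
  fixes f h :: "'g \<Rightarrow> complex"
  assumes "(\<lambda>g. (cmod (f g))\<^sup>2) summable_on UNIV" "(\<lambda>g. (cmod (h g))\<^sup>2) summable_on UNIV" "finite F"
  shows "L2_set (\<lambda>g. cmod (f g + h g)) F
    \<le> sqrt (\<Sum>\<^sub>\<infinity>g. (cmod (f g))\<^sup>2) + sqrt (\<Sum>\<^sub>\<infinity>g. (cmod (h g))\<^sup>2)"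
proof -
  have "L2_set (\<lambda>g. cmod (f g + h g)) F \<le> L2_set (\<lambda>g. cmod (f g) + cmod (h g)) F"
    by (rule L2_set_mono) (auto simp: norm_triangle_ineq)
  also have "\<dots> \<le> L2_set (\<lambda>g. cmod (f g)) F + L2_set (\<lambda>g. cmod (h g)) F"
    by (rule L2_set_triangle_ineq)
  finally show ?thesis
    using L2_set_le_ell2[OF assms(1,3)] L2_set_le_ell2[OF assms(2,3)] by linarith
qed

instantiation ell2 :: (type) complex_normed_vector
begin

lift_definition zero_ell2 :: "'a ell2" is "\<lambda>_. 0" by simp
lift_definition uminus_ell2 :: "'a ell2 \<Rightarrow> 'a ell2" is "\<lambda>f g. - f g" by simp
lift_definition plus_ell2 :: "'a ell2 \<Rightarrow> 'a ell2 \<Rightarrow> 'a ell2" is "\<lambda>f h g. f g + h g"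
  by (rule sq_summableI(1)[OF L2_set_cmod_add_le])
lift_definition minus_ell2 :: "'a ell2 \<Rightarrow> 'a ell2 \<Rightarrow> 'a ell2" is "\<lambda>f h g. f g - h g"
  subgoal for f h
    using sq_summableI(1)[OF L2_set_cmod_add_le[of f "\<lambda>g. - h g"]] by simp
  done
lift_definition scaleC_ell2 :: "complex \<Rightarrow> 'a ell2 \<Rightarrow> 'a ell2" is "\<lambda>c f g. c * f g"
  by (simp add: norm_mult power_mult_distrib summable_on_cmult_right)
definition scaleR_ell2 :: "real \<Rightarrow> 'a ell2 \<Rightarrow> 'a ell2" where
  "scaleR_ell2 r f = complex_of_real r *\<^sub>C f"
lift_definition norm_ell2 :: "'a ell2 \<Rightarrow> real" is "\<lambda>f. sqrt (\<Sum>\<^sub>\<infinity>g. (cmod (f g))\<^sup>2)" .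
definition dist_ell2 :: "'a ell2 \<Rightarrow> 'a ell2 \<Rightarrow> real" where "dist_ell2 f h = norm (f - h)"
definition sgn_ell2 :: "'a ell2 \<Rightarrow> 'a ell2" where "sgn_ell2 f = inverse (norm f) *\<^sub>R f"
definition uniformity_ell2 :: "('a ell2 \<times> 'a ell2) filter" where
  "uniformity_ell2 = (INF e\<in>{0<..}. principal {(f, h). dist f h < e})"
definition open_ell2 :: "'a ell2 set \<Rightarrow> bool" where
  "open_ell2 U \<longleftrightarrow> (\<forall>f\<in>U. \<forall>\<^sub>F (f', h) in uniformity. f' = f \<longrightarrow> h \<in> U)"

instance
proof
  fix f h k :: "'a ell2" and c d :: complex and r s :: real
  show "f + h + k = f + (h + k)" by transfer (simp add: add.assoc)
  show "f + h = h + f" by transfer (simp add: add.commute)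
  show "0 + f = f" by transfer simp
  show "- f + f = 0" by transfer simp
  show "f - h = f + - h" by transfer simp
  have add_right: "c *\<^sub>C (f + h) = c *\<^sub>C f + c *\<^sub>C h" for c and f h :: "'a ell2"
    by transfer (simp add: distrib_left)
  have add_left: "(c + d) *\<^sub>C f = c *\<^sub>C f + d *\<^sub>C f" for c d and f :: "'a ell2"
    by transfer (simp add: distrib_right)
  have assoc: "c *\<^sub>C d *\<^sub>C f = (c * d) *\<^sub>C f" for c d and f :: "'a ell2"
    by transfer (simp add: mult.assoc)
  have nc: "norm (c *\<^sub>C f) = cmod c * norm f" for c and f :: "'a ell2"
  proof transfer
    fix c :: complex and f :: "'a \<Rightarrow> complex"
    have "(\<Sum>\<^sub>\<infinity>g. (cmod (c * f g))\<^sup>2) = (\<Sum>\<^sub>\<infinity>g. (cmod c)\<^sup>2 * (cmod (f g))\<^sup>2)"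
      by (simp only: norm_mult power_mult_distrib)
    also have "\<dots> = (cmod c)\<^sup>2 * (\<Sum>\<^sub>\<infinity>g. (cmod (f g))\<^sup>2)"
      by (rule infsum_cmult_right')
    finally show "sqrt (\<Sum>\<^sub>\<infinity>g. (cmod (c * f g))\<^sup>2) = cmod c * sqrt (\<Sum>\<^sub>\<infinity>g. (cmod (f g))\<^sup>2)"
      by (simp add: real_sqrt_mult)
  qed
  show "c *\<^sub>C (f + h) = c *\<^sub>C f + c *\<^sub>C h" by (rule add_right)
  show "(c + d) *\<^sub>C f = c *\<^sub>C f + d *\<^sub>C f" by (rule add_left)
  show "c *\<^sub>C d *\<^sub>C f = (c * d) *\<^sub>C f" by (rule assoc)
  show "complex_of_real r *\<^sub>C f = r *\<^sub>R f" by (rule scaleR_ell2_def[symmetric])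
  show "norm (c *\<^sub>C f) = cmod c * norm f" by (rule nc)
  show "r *\<^sub>R (f + h) = r *\<^sub>R f + r *\<^sub>R h"
    unfolding scaleR_ell2_def by (rule add_right)
  show "(r + s) *\<^sub>R f = r *\<^sub>R f + s *\<^sub>R f"
    unfolding scaleR_ell2_def of_real_add by (rule add_left)
  show "r *\<^sub>R s *\<^sub>R f = (r * s) *\<^sub>R f"
    unfolding scaleR_ell2_def of_real_mult by (rule assoc)
  show "1 *\<^sub>R f = f"
    unfolding scaleR_ell2_def of_real_1 by transfer simp
  show "norm (r *\<^sub>R f) = \<bar>r\<bar> * norm f"
    unfolding scaleR_ell2_def nc norm_of_real by (rule refl)
  show "norm (f + h) \<le> norm f + norm h"
    by transfer (rule sq_summableI(2)[OF L2_set_cmod_add_le])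
  show "norm f = 0 \<longleftrightarrow> f = 0"
  proof transfer
    fix f :: "'a \<Rightarrow> complex" assume s: "(\<lambda>g. (cmod (f g))\<^sup>2) summable_on UNIV"
    show "(sqrt (\<Sum>\<^sub>\<infinity>g. (cmod (f g))\<^sup>2) = 0) = (f = (\<lambda>_. 0))"
    proof
      assume 0: "sqrt (\<Sum>\<^sub>\<infinity>g. (cmod (f g))\<^sup>2) = 0"
      have "cmod (f g) \<le> 0" for g
        using L2_set_le_ell2[OF s, of "{g}"] unfolding 0 by simp
      then show "f = (\<lambda>_. 0)" by (simp add: fun_eq_iff)
    next
      assume "f = (\<lambda>_. 0)"
      then show "sqrt (\<Sum>\<^sub>\<infinity>g. (cmod (f g))\<^sup>2) = 0" by simp
    qed
  qed
  show "dist f h = norm (f - h)" by (rule dist_ell2_def)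
  show "sgn f = inverse (norm f) *\<^sub>R f" by (rule sgn_ell2_def)
  show "uniformity = (INF e\<in>{0<..}. principal {(f, h :: 'a ell2). dist f h < e})"
    by (rule uniformity_ell2_def)
  show "open U \<longleftrightarrow> (\<forall>f\<in>U. \<forall>\<^sub>F (f', h) in uniformity. f' = f \<longrightarrow> h \<in> U)" for U :: "'a ell2 set"
    by (rule open_ell2_def)
qed

end

lemma norm_ell2_le:
  assumes "\<And>F. finite F \<Longrightarrow> L2_set (\<lambda>g. cmod (Rep_ell2 f g)) F \<le> C"
  shows "norm f \<le> C"
  using assms by transfer (rule sq_summableI(2))

lemma L2_set_le_norm_ell2:
  assumes "finite F"
  shows "L2_set (\<lambda>g. cmod (Rep_ell2 f g)) F \<le> norm f"
  using assms by transfer (rule L2_set_le_ell2)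

instance ell2 :: (type) complex_banach
proof
  fix X :: "nat \<Rightarrow> 'a ell2"
  assume X: "Cauchy X"
  have pt: "cmod (Rep_ell2 f g) \<le> norm f" for f :: "'a ell2" and g
    using L2_set_le_norm_ell2[of "{g}" f] by simp
  have "Cauchy (\<lambda>n. Rep_ell2 (X n) g)" for g
  proof (rule metric_CauchyI)
    fix e :: real assume "0 < e"
    then obtain M where M: "\<And>m n. m \<ge> M \<Longrightarrow> n \<ge> M \<Longrightarrow> dist (X m) (X n) < e"
      using metric_CauchyD[OF X] by blast
    show "\<exists>M. \<forall>m\<ge>M. \<forall>n\<ge>M. dist (Rep_ell2 (X m) g) (Rep_ell2 (X n) g) < e"
    proof (intro exI allI impI)
      fix m n assume "M \<le> m" "M \<le> n"
      have "dist (Rep_ell2 (X m) g) (Rep_ell2 (X n) g) = cmod (Rep_ell2 (X m - X n) g)"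
        unfolding dist_norm minus_ell2.rep_eq by (rule refl)
      also have "\<dots> \<le> dist (X m) (X n)" unfolding dist_norm by (rule pt)
      also have "\<dots> < e" using M \<open>M \<le> m\<close> \<open>M \<le> n\<close> by blast
      finally show "dist (Rep_ell2 (X m) g) (Rep_ell2 (X n) g) < e" .
    qed
  qed
  then obtain l where l: "\<And>g. (\<lambda>n. Rep_ell2 (X n) g) \<longlonglongrightarrow> l g"
    unfolding Cauchy_convergent_iff convergent_def by metis
  have tail: "\<exists>M. \<forall>n\<ge>M. \<forall>F. finite F \<longrightarrow> L2_set (\<lambda>g. cmod (l g - Rep_ell2 (X n) g)) F \<le> e"
    if "0 < e" for e
  proof -
    obtain M where M: "\<And>m n. m \<ge> M \<Longrightarrow> n \<ge> M \<Longrightarrow> dist (X m) (X n) < e"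
      using metric_CauchyD[OF X \<open>0 < e\<close>] by blast
    have "L2_set (\<lambda>g. cmod (l g - Rep_ell2 (X n) g)) F \<le> e" if "n \<ge> M" "finite F" for n F
    proof (rule LIMSEQ_le_const2)
      show "(\<lambda>m. L2_set (\<lambda>g. cmod (Rep_ell2 (X m) g - Rep_ell2 (X n) g)) F)
          \<longlonglongrightarrow> L2_set (\<lambda>g. cmod (l g - Rep_ell2 (X n) g)) F"
        unfolding L2_set_def by (intro tendsto_intros l)
      show "\<exists>N. \<forall>m\<ge>N. L2_set (\<lambda>g. cmod (Rep_ell2 (X m) g - Rep_ell2 (X n) g)) F \<le> e"
      proof (intro exI allI impI)
        fix m assume "M \<le> m"
        have "L2_set (\<lambda>g. cmod (Rep_ell2 (X m) g - Rep_ell2 (X n) g)) F \<le> norm (X m - X n)"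
          using L2_set_le_norm_ell2[OF \<open>finite F\<close>, of "X m - X n"] unfolding minus_ell2.rep_eq .
        also have "\<dots> \<le> e" using M[OF \<open>M \<le> m\<close> \<open>M \<le> n\<close>] unfolding dist_norm by linarith
        finally show "L2_set (\<lambda>g. cmod (Rep_ell2 (X m) g - Rep_ell2 (X n) g)) F \<le> e" .
      qed
    qed
    then show ?thesis by blast
  qed
  obtain M where M: "\<And>F. finite F \<Longrightarrow> L2_set (\<lambda>g. cmod (l g - Rep_ell2 (X M) g)) F \<le> 1"
    using tail[OF zero_less_one] by blast
  define d where "d = Abs_ell2 (\<lambda>g. l g - Rep_ell2 (X M) g)"
  have d: "Rep_ell2 d = (\<lambda>g. l g - Rep_ell2 (X M) g)"
    unfolding d_def using sq_summableI(1)[OF M] by (simp add: Abs_ell2_inverse)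
  define L where "L = d + X M"
  have L: "Rep_ell2 L = l" by (auto simp: L_def plus_ell2.rep_eq d)
  have "X \<longlonglongrightarrow> L"
  proof (rule metric_LIMSEQ_I)
    fix e :: real assume "0 < e"
    then obtain M where M: "\<And>n F. n \<ge> M \<Longrightarrow> finite F \<Longrightarrow>
        L2_set (\<lambda>g. cmod (l g - Rep_ell2 (X n) g)) F \<le> e / 2"
      using tail[OF half_gt_zero[OF \<open>0 < e\<close>]] by blast
    show "\<exists>no. \<forall>n\<ge>no. dist (X n) L < e"
    proof (intro exI allI impI)
      fix n assume "M \<le> n"
      have "norm (L - X n) \<le> e / 2"
        by (rule norm_ell2_le) (unfold minus_ell2.rep_eq L, rule M[OF \<open>M \<le> n\<close>])
      then have "dist L (X n) < e" unfolding dist_norm using \<open>0 < e\<close> by linarith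
      then show "dist (X n) L < e" by (simp only: dist_commute)
    qed
  qed
  then show "convergent X" by (auto simp: convergent_def)
qed

definition cinner :: "'g ell2 \<Rightarrow> 'g ell2 \<Rightarrow> complex" where
  "cinner f h = (\<Sum>\<^sub>\<infinity>g. Rep_ell2 f g * cnj (Rep_ell2 h g))"

lift_definition delta :: "'g \<Rightarrow> 'g ell2" is "\<lambda>g h. if h = g then 1 else 0"
  by (rule finite_nonzero_values_imp_summable_on) simp


section \<open>Operators on the Hilbert space\<close>

instantiation blinfun :: (real_normed_vector, complex_normed_vector) complex_normed_vector
begin

lift_definition scaleC_blinfun :: "complex \<Rightarrow> 'a \<Rightarrow>\<^sub>L 'b \<Rightarrow> 'a \<Rightarrow>\<^sub>L 'b" is "\<lambda>c T x. c *\<^sub>C T x"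
  by (rule bounded_linear_compose[OF bounded_linear_scaleC])

instance
proof
  fix S T :: "'a \<Rightarrow>\<^sub>L 'b" and c d :: complex and r :: real
  show "c *\<^sub>C (S + T) = c *\<^sub>C S + c *\<^sub>C T"
    by (rule blinfun_eqI) (simp add: scaleC_blinfun.rep_eq plus_blinfun.rep_eq scaleC_add_right)
  show "(c + d) *\<^sub>C T = c *\<^sub>C T + d *\<^sub>C T"
    by (rule blinfun_eqI) (simp add: scaleC_blinfun.rep_eq plus_blinfun.rep_eq scaleC_add_left)
  show "c *\<^sub>C d *\<^sub>C T = (c * d) *\<^sub>C T"
    by (rule blinfun_eqI) (simp add: scaleC_blinfun.rep_eq scaleC_scaleC)
  show "complex_of_real r *\<^sub>C T = r *\<^sub>R T"
    by (rule blinfun_eqI) (simp add: scaleC_blinfun.rep_eq scaleR_blinfun.rep_eq scaleC_of_real)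
  have le: "norm (c *\<^sub>C T) \<le> cmod c * norm T" for c and T :: "'a \<Rightarrow>\<^sub>L 'b"
    by (rule norm_blinfun_bound)
      (auto simp: scaleC_blinfun.rep_eq norm_scaleC mult.assoc intro!: mult_left_mono norm_blinfun)
  show "norm (c *\<^sub>C T) = cmod c * norm T"
  proof (cases "c = 0")
    case True
    then show ?thesis using le[of 0 T] by simp
  next
    case False
    have "inverse c *\<^sub>C c *\<^sub>C T = T"
      using False scaleC_of_real[of 1]
      by (intro blinfun_eqI) (simp add: scaleC_blinfun.rep_eq scaleC_scaleC)
    then have "norm T \<le> inverse (cmod c) * norm (c *\<^sub>C T)"
      using le[of "inverse c" "c *\<^sub>C T"] by (simp add: norm_inverse)
    then have "cmod c * norm T \<le> norm (c *\<^sub>C T)"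
      using False by (simp add: field_simps)
    then show ?thesis using le[of c T] by linarith
  qed
qed

end

instance blinfun :: (real_normed_vector, complex_banach) complex_banach ..

type_synonym 'g oper = "'g ell2 \<Rightarrow>\<^sub>L 'g ell2"

text \<open>The type \<^typ>\<open>'g oper\<close> consists of the real-linear bounded operators; the algebra of bounded
  complex-linear operators is the following subset.\<close>

definition clinear_opers :: "'g oper set" where
  "clinear_opers = {T. \<forall>c f. blinfun_apply T (c *\<^sub>C f) = c *\<^sub>C blinfun_apply T f}"

definition adj :: "'g oper \<Rightarrow> 'g oper" where
  "adj T = (THE S :: 'g oper. \<forall>f h. cinner (T f) h = cinner f (S h))"

definition commutant :: "'g oper set \<Rightarrow> 'g oper set" where
  "commutant M = {T \<in> clinear_opers. \<forall>S\<in>M. T o\<^sub>L S = S o\<^sub>L T}"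

lemma blinfun_eq_iff: "S = T \<longleftrightarrow> (\<forall>f. blinfun_apply S f = blinfun_apply T f)"
  by (auto intro: blinfun_eqI)

lemma scaleC_zero_right: "c *\<^sub>C (0 :: 'a::complex_normed_vector) = 0"
  using norm_scaleC[of c "0 :: 'a"] by simp

lemma closed_csubspace_Inter: "(\<And>M. M \<in> \<M> \<Longrightarrow> closed_csubspace M) \<Longrightarrow> closed_csubspace (\<Inter>\<M>)"
  by (auto simp: closed_csubspace_def)

lemma closed_csubspace_commutant:
  fixes M :: "'a oper set"
  assumes "M \<subseteq> clinear_opers"
  shows "closed_csubspace (commutant M)"
proof -
  have "closed (commutant M)"
  proof -
    have "closed {T :: 'a oper. blinfun_apply T (c *\<^sub>C f) = c *\<^sub>C blinfun_apply T f}" for c f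
      by (rule closed_Collect_eq)
        (intro bounded_linear.continuous_on[OF bounded_linear_scaleC] continuous_intros)+
    moreover have "closed {T. T o\<^sub>L S = S o\<^sub>L T}" for S :: "'a oper"
      by (rule closed_Collect_eq)
        (intro bounded_bilinear.continuous_on[OF bounded_bilinear_blinfun_compose] continuous_intros)+
    moreover have "commutant M =
        (\<Inter>c. \<Inter>f. {T. blinfun_apply T (c *\<^sub>C f) = c *\<^sub>C blinfun_apply T f})
        \<inter> (\<Inter>S\<in>M. {T. T o\<^sub>L S = S o\<^sub>L T})"
      by (auto simp: commutant_def clinear_opers_def)
    ultimately show ?thesis by (simp add: closed_INT closed_Int)
  qed
  moreover have "c *\<^sub>C T \<in> commutant M" if "T \<in> commutant M" for c T
  proof -
    have "T (S f) = S (T f)" if "S \<in> M" for S f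
      using \<open>T \<in> commutant M\<close> that by (metis (mono_tags, lifting) commutant_def
          mem_Collect_eq blinfun_apply_blinfun_compose)
    moreover have "S (c *\<^sub>C f) = c *\<^sub>C S f" if "S \<in> M" for S f
      using that assms by (auto simp: clinear_opers_def)
    ultimately show ?thesis
      using \<open>T \<in> commutant M\<close> unfolding commutant_def clinear_opers_def
      by (simp add: blinfun_eq_iff scaleC_blinfun.rep_eq) (simp add: scaleC_scaleC mult.commute)
  qed
  moreover have "S + T \<in> commutant M" if "S \<in> commutant M" "T \<in> commutant M" for S T
    using that unfolding commutant_def clinear_opers_def
    by (simp add: blinfun_eq_iff plus_blinfun.rep_eq scaleC_add_right blinfun.add_right)
  moreover have "0 \<in> commutant M"
    unfolding commutant_def clinear_opers_def
    by (simp add: blinfun_eq_iff scaleC_zero_right blinfun.zero_right)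
  ultimately show ?thesis by (auto simp: closed_csubspace_def)
qed

definition von_neumann_algebra :: "'g oper set \<Rightarrow> bool" where
  "von_neumann_algebra M \<longleftrightarrow> M \<subseteq> clinear_opers \<and> (\<forall>T\<in>M. adj T \<in> M)
     \<and> commutant (commutant M) = M"

definition closed_subalgebra :: "'g oper set \<Rightarrow> bool" where
  "closed_subalgebra M \<longleftrightarrow> M \<subseteq> clinear_opers \<and> closed_csubspace M
     \<and> (\<forall>S\<in>M. \<forall>T\<in>M. S o\<^sub>L T \<in> M)"

definition oper_poly :: "real poly \<Rightarrow> 'g oper \<Rightarrow> 'g oper" where
  "oper_poly q A = (\<Sum>i\<le>degree q. coeff q i *\<^sub>R ((\<lambda>B. A o\<^sub>L B) ^^ i) id_blinfun)"

text \<open>Continuous functional calculus \<open>u(A)\<close> of a positive operator \<open>A\<close>, for \<open>u\<close> continuous on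
  \<open>[0, \<parallel>A\<parallel>]\<close>, an interval containing the spectrum of \<open>A\<close>: the norm limit of \<open>q\<^sub>n(A)\<close> for
  polynomials \<open>q\<^sub>n\<close> converging to \<open>u\<close> uniformly on this interval.\<close>

definition fun_calc :: "(real \<Rightarrow> real) \<Rightarrow> 'g oper \<Rightarrow> 'g oper" where
  "fun_calc u A = (THE B. \<forall>q. uniform_limit {0..norm A} (\<lambda>n t. poly (q n) t) u sequentially
     \<longrightarrow> (\<lambda>n. oper_poly (q n) A) \<longlonglongrightarrow> B)"


section \<open>Group algebras and noncommutative \<open>L\<^sup>p\<close>-spaces\<close>

text \<open>The group is a type of class \<^class>\<open>group_add\<close>: it is written additively but need not be
  abelian, with neutral element \<open>0\<close>. The translate of \<open>f\<close> by \<open>g\<close> is thus \<open>h \<mapsto> f (g\<^sup>-\<^sup>1 h)\<close>.\<close>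

lemma summable_on_translate:
  fixes g :: "'g::group_add" and f :: "'g \<Rightarrow> real"
  shows "(\<lambda>h. f (- g + h)) summable_on UNIV \<longleftrightarrow> f summable_on UNIV"
    and "(\<Sum>\<^sub>\<infinity>h. f (- g + h)) = (\<Sum>\<^sub>\<infinity>h. f h)"
proof -
  have b: "bij_betw (\<lambda>h. - g + h) UNIV UNIV"
    by (rule bij_betwI[where g = "\<lambda>h. g + h"]) (auto simp: add.assoc[symmetric])
  show "(\<lambda>h. f (- g + h)) summable_on UNIV \<longleftrightarrow> f summable_on UNIV"
    by (rule summable_on_reindex_bij_betw[OF b])
  show "(\<Sum>\<^sub>\<infinity>h. f (- g + h)) = (\<Sum>\<^sub>\<infinity>h. f h)"
    by (rule infsum_reindex_bij_betw[OF b])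
qed

lift_definition shift :: "'g::group_add \<Rightarrow> 'g ell2 \<Rightarrow> 'g ell2" is "\<lambda>g f h. f (- g + h)"
  subgoal for g f
    using summable_on_translate(1)[where g = g and f = "\<lambda>h. (cmod (f h))\<^sup>2"] by blast
  done

lift_definition left_reg :: "'g::group_add \<Rightarrow> 'g oper" is shift
proof (rule bounded_linear_intro)
  fix g :: 'g and f h :: "'g ell2" and r :: real
  show "shift g (f + h) = shift g f + shift g h" by transfer simp
  show "shift g (r *\<^sub>R f) = r *\<^sub>R shift g f"
    unfolding scaleR_ell2_def by transfer simp
  show "norm (shift g f) \<le> norm f * 1"
  proof transfer
    fix g :: 'g and f :: "'g \<Rightarrow> complex"
    show "sqrt (\<Sum>\<^sub>\<infinity>h. (cmod (f (- g + h)))\<^sup>2) \<le> sqrt (\<Sum>\<^sub>\<infinity>h. (cmod (f h))\<^sup>2) * 1"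
      using summable_on_translate(2)[where g = g and f = "\<lambda>h. (cmod (f h))\<^sup>2"] by simp
  qed
qed

definition Cstar_red :: "'g::group_add oper set" where
  "Cstar_red = closed_subalgebra hull (range left_reg)"

definition VN :: "'g::group_add oper set" where
  "VN = von_neumann_algebra hull (range left_reg)"

definition vn_trace :: "'g::group_add oper \<Rightarrow> complex" where
  "vn_trace T = cinner (T (delta 0)) (delta 0)"

definition Lp_norm :: "ennreal \<Rightarrow> 'g::group_add oper \<Rightarrow> real" where
  "Lp_norm p x = (if p = \<infinity> then norm x
     else Re (vn_trace (fun_calc (\<lambda>t. t powr (enn2real p / 2)) (adj x o\<^sub>L x)))
       powr (1 / enn2real p))"

text \<open>\<open>X\<close>, together with the canonical map \<open>j\<close> from \<^const>\<open>VN\<close>, is a completion of \<^const>\<open>VN\<close> for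
  the norm \<^term>\<open>Lp_norm p\<close>: it is a Banach space in which \<open>j\<close> is a linear isometry with dense range.
  This determines \<open>(X, j)\<close> up to a unique isometric isomorphism. The values of \<open>j\<close> outside
  \<^const>\<open>VN\<close> are irrelevant.\<close>

definition is_Lp_space ::
  "ennreal \<Rightarrow> 'x::complex_banach set \<Rightarrow> ('g::group_add oper \<Rightarrow> 'x) \<Rightarrow> bool" where
  "is_Lp_space p X j \<longleftrightarrow> closed_csubspace X \<and>
     (\<forall>x\<in>VN. \<forall>y\<in>VN. j (x + y) = j x + j y) \<and>
     (\<forall>c. \<forall>x\<in>VN. j (c *\<^sub>C x) = c *\<^sub>C j x) \<and>
     (\<forall>x\<in>VN. norm (j x) = Lp_norm p x) \<and>
     closure (j ` VN) = X"

text \<open>For \<open>p = \<infinity>\<close> one may take \<open>X\<close> to be the von Neumann algebra itself.\<close>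

lemma is_Lp_space_infinity: "is_Lp_space \<infinity> VN (\<lambda>x. x)"
proof -
  have "closed_csubspace (VN :: 'a::group_add oper set)"
    unfolding VN_def hull_def
  proof (rule closed_csubspace_Inter)
    fix M :: "'a oper set"
    assume "M \<in> {M. von_neumann_algebra M \<and> range left_reg \<subseteq> M}"
    then have "commutant (commutant M) = M" by (simp add: von_neumann_algebra_def)
    moreover have "commutant M \<subseteq> clinear_opers" by (auto simp: commutant_def)
    ultimately show "closed_csubspace M" using closed_csubspace_commutant by metis
  qed
  then show ?thesis by (simp add: is_Lp_space_def Lp_norm_def closed_csubspace_def)
qed

definition Cstar_translation :: "'g::group_add \<Rightarrow> 'g oper \<Rightarrow> 'g oper" where
  "Cstar_translation g = (\<lambda>x\<in>Cstar_red. left_reg g o\<^sub>L x)"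

definition Lp_translation ::
  "'x::complex_banach set \<Rightarrow> ('g::group_add oper \<Rightarrow> 'x) \<Rightarrow> 'g \<Rightarrow> 'x \<Rightarrow> 'x" where
  "Lp_translation X j g = (THE T. T \<in> bounded_ops X \<and> (\<forall>x\<in>VN. T (j x) = j (left_reg g o\<^sub>L x)))"

text \<open>The type \<^typ>\<open>'g \<Rightarrow>\<^sub>0 complex\<close> of finitely supported functions, with its convolution product,
  is the complex group algebra.\<close>

definition group_algebra_rep ::
  "'x::complex_banach set \<Rightarrow> ('g \<Rightarrow> 'x \<Rightarrow> 'x) \<Rightarrow> ('g::group_add \<Rightarrow>\<^sub>0 complex) \<Rightarrow> 'x \<Rightarrow> 'x" where
  "group_algebra_rep X \<pi> a = (\<lambda>\<xi>\<in>X. \<Sum>g\<in>Poly_Mapping.keys a. Poly_Mapping.lookup a g *\<^sub>C \<pi> g \<xi>)"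

end

theory Submission
  imports Defs
begin

text \<open>Let \<open>a\<close> be an element of the group algebra that acts on \<open>X\<close> injectively with closed range, so
  \<open>\<parallel>a x\<parallel> \<ge> \<epsilon> \<parallel>x\<parallel>\<close>. Put \<open>C = 1 - a\<^sup>*a / K\<close> with \<open>K > \<parallel>a\<^sup>*a\<parallel>\<close>, so \<open>0 \<le> C \<le> 1\<close>, and test the inequality on the
  powers \<open>x = C\<^sup>n\<close>. For \<open>p = \<infinity>\<close> the left-hand side is \<open>O(n\<^bsup>-1/2\<^esup>)\<close>, hence \<open>\<parallel>C\<^sup>n\<parallel>\<close> is eventually below \<open>1\<close>.
  For \<open>p < \<infinity>\<close> it says \<open>\<epsilon>\<^sup>p \<tau>(W\<^sup>n) \<le> K\<^bsup>p/2\<^esup> \<tau>((1 - C)\<^bsup>p/2\<^esup> W\<^sup>n)\<close> with \<open>W = C\<^sup>p\<close>; bounding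
  \<open>(K (1 - t))\<^bsup>p/2\<^esup>\<close> by \<open>\<epsilon>\<^sup>p/2 + L (1 - t\<^sup>p)\<close> on \<open>[0, 1]\<close> gives \<open>\<tau>(W\<^bsup>n+1\<^esup>) \<le> \<theta> \<tau>(W\<^sup>n)\<close> with \<open>\<theta> < 1\<close>.
  As \<open>C\<close> commutes with right translations, \<open>\<parallel>C\<^sup>n \<xi>\<parallel>\<close> then decays geometrically for all finitely supported
  \<open>\<xi>\<close>, at a rate independent of \<open>\<xi>\<close>, and log-convexity of \<open>n \<mapsto> \<parallel>C\<^sup>n \<xi>\<parallel>\<close> yields \<open>\<parallel>C\<parallel> < 1\<close>.
  In either case \<open>a\<^sup>*a\<close> is inverted by a Neumann series, so \<open>a\<close> has a left inverse \<open>d\<close>. Since \<open>1 - a d\<close>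
  is a projection of trace \<open>0\<close>, also \<open>a d = 1\<close>. Thus the range of \<open>a\<close> on \<open>X\<close>
  contains a dense subspace, and being closed it is \<open>X\<close>.\<close>

section \<open>Operators with closed range\<close>

lemma closed_csubspace_scaleR:
  "closed_csubspace X \<Longrightarrow> x \<in> X \<Longrightarrow> r *\<^sub>R x \<in> X"
  unfolding closed_csubspace_def scaleC_of_real[symmetric] by blast

lemma closed_csubspace_diff:
  assumes "closed_csubspace X" "x \<in> X" "y \<in> X"
  shows "x - y \<in> X"
proof -
  have "x + (- 1) *\<^sub>R y \<in> X"
    using assms closed_csubspace_scaleR by (metis closed_csubspace_def)
  then show ?thesis by simp
qed

lemma closed_csubspace_sum:
  assumes "closed_csubspace X" "\<And>i. i \<in> I \<Longrightarrow> f i \<in> X"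
  shows "(\<Sum>i\<in>I. f i) \<in> X"
  using assms by (induction I rule: infinite_finite_induct) (auto simp: closed_csubspace_def)

context
  fixes X :: "'a::complex_banach set" and T :: "'a \<Rightarrow> 'a"
  assumes X: "closed_csubspace X" and T: "T \<in> bounded_ops X"
begin

lemma bounded_op_in: "x \<in> X \<Longrightarrow> T x \<in> X"
  using T by (auto simp: bounded_ops_def)

lemma bounded_op_add: "x \<in> X \<Longrightarrow> y \<in> X \<Longrightarrow> T (x + y) = T x + T y"
  using T by (auto simp: bounded_ops_def)

lemma bounded_op_scaleR: "x \<in> X \<Longrightarrow> T (r *\<^sub>R x) = r *\<^sub>R T x"
  using T unfolding bounded_ops_def scaleC_of_real[symmetric] by blast

lemma bounded_op_diff: "x \<in> X \<Longrightarrow> y \<in> X \<Longrightarrow> T (x - y) = T x - T y"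
  using bounded_op_add[of x "(- 1) *\<^sub>R y"] bounded_op_scaleR[of y "- 1"] closed_csubspace_scaleR[OF X, of y "- 1"]
  by simp

lemma bounded_op_bound: obtains K where "0 < K" "\<And>x. x \<in> X \<Longrightarrow> norm (T x) \<le> K * norm x"
proof -
  obtain K where K: "\<And>x. x \<in> X \<Longrightarrow> norm (T x) \<le> K * norm x"
    using T unfolding bounded_ops_def by blast
  show ?thesis
  proof (rule that[of "\<bar>K\<bar> + 1"])
    show "norm (T x) \<le> (\<bar>K\<bar> + 1) * norm x" if "x \<in> X" for x
      using K[OF that] by (smt (verit) mult_right_mono norm_ge_zero)
  qed simp
qed

lemma bounded_op_continuous: "continuous_on X T"
proof -
  obtain K where K: "0 < K" "\<And>x. x \<in> X \<Longrightarrow> norm (T x) \<le> K * norm x"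
    using bounded_op_bound by blast
  have "K-lipschitz_on X T"
    using K by (intro lipschitz_onI)
      (auto simp: dist_norm bounded_op_diff[symmetric] closed_csubspace_diff[OF X])
  then show ?thesis by (rule lipschitz_on_continuous_on)
qed

text \<open>The open mapping theorem for an injective operator, from Baire's theorem in the closed range.\<close>

lemma bounded_below_of_closed_range:
  assumes inj: "inj_on T X" and cl: "closed (T ` X)"
  obtains \<epsilon> where "0 < \<epsilon>" "\<And>x. x \<in> X \<Longrightarrow> \<epsilon> * norm x \<le> norm (T x)"
proof -
  define Y where "Y = T ` X"
  define C where "C n = closure (T ` (X \<inter> cball 0 (real n)))" for n
  have "closed Y" using cl by (simp add: Y_def)
  have zero: "0 \<in> X" using X by (simp add: closed_csubspace_def)
  have T0: "T 0 = 0" using bounded_op_scaleR[OF zero, of 0] by simp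
  have CY: "C n \<subseteq> Y" for n
    unfolding C_def Y_def by (rule closure_minimal[OF _ cl]) auto
  have Y_scale: "r *\<^sub>R y \<in> Y" if "y \<in> Y" for r y
    using that bounded_op_scaleR closed_csubspace_scaleR[OF X] unfolding Y_def by (metis (no_types, lifting) image_iff)
  have Y_add: "y + z \<in> Y" if "y \<in> Y" "z \<in> Y" for y z
    using that bounded_op_add X unfolding Y_def closed_csubspace_def by (smt (verit) image_iff)
  have Y_diff: "y - z \<in> Y" if "y \<in> Y" "z \<in> Y" for y z
    using that bounded_op_diff closed_csubspace_diff[OF X] unfolding Y_def by (smt (verit) image_iff)
  \<comment> \<open>\<open>Y\<close> is complete and is the union of the countably many closed sets
    \<open>C n\<close>, so Baire forbids all of them to have empty interior relative to
    \<open>Y\<close>.\<close>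
  have "\<exists>n. top_of_set Y interior_of C n \<noteq> {}"
  proof (rule ccontr)
    assume "\<not> ?thesis"
    then have "top_of_set Y interior_of \<Union> (range C) = {}"
      using CY \<open>closed Y\<close>
      by (intro Baire_category_alt disjI1)
        (auto simp: C_def closedin_closed_eq
          intro!: completely_metrizable_space_closedin[OF completely_metrizable_space_euclidean])
    moreover have "\<Union> (range C) = Y"
    proof
      show "Y \<subseteq> \<Union> (range C)"
      proof
        fix y assume "y \<in> Y"
        then obtain x where "x \<in> X" "y = T x" by (auto simp: Y_def)
        moreover obtain n where "norm x \<le> real n" using real_arch_simple by blast
        ultimately have "y \<in> C n" unfolding C_def by (intro closure_subset[THEN subsetD]) auto
        then show "y \<in> \<Union> (range C)" by blast
      qed
    qed (use CY in blast)
    moreover have "0 \<in> Y" using zero T0 by (force simp: Y_def)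
    ultimately show False
      by (metis empty_iff interior_of_topspace topspace_euclidean_subtopology)
  qed
  then obtain n y0 where "y0 \<in> top_of_set Y interior_of C n" by blast
  then obtain U where U: "openin (top_of_set Y) U" "y0 \<in> U" "U \<subseteq> C n"
    unfolding interior_of_def by blast
  then have "y0 \<in> Y" using openin_imp_subset by blast
  obtain r where r: "0 < r" "ball y0 r \<inter> Y \<subseteq> C n"
    using U openin_contains_ball[of Y U] by (metis subset_trans)
  \<comment> \<open>Both \<open>y0\<close> and \<open>y0 + y\<close> are limits of images of vectors
    of norm at most \<open>n\<close>; subtracting two such approximations moves the ball around
    \<open>y0\<close> to the origin and doubles the bound to \<open>2 n\<close>.\<close>
  have small: "\<exists>x\<in>X. norm x \<le> 2 * real n \<and> norm (y - T x) < e" if "y \<in> Y" "norm y < r" "0 < e" for y e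
  proof -
    have "y0 + y \<in> C n" "y0 \<in> C n"
      using r \<open>y0 \<in> Y\<close> that Y_add by (auto simp: dist_norm intro!: r(2)[THEN subsetD])
    then obtain x1 x2 where x: "x1 \<in> X" "norm x1 \<le> real n" "norm (T x1 - (y0 + y)) < e / 2"
        "x2 \<in> X" "norm x2 \<le> real n" "norm (T x2 - y0) < e / 2"
      unfolding C_def closure_approachable using \<open>0 < e\<close>
      by (auto simp: dist_norm Bex_def dest!: spec[of _ "e / 2"])
    have "y - T (x1 - x2) = (T x2 - y0) - (T x1 - (y0 + y))" using x by (simp add: bounded_op_diff)
    then have "norm (y - T (x1 - x2)) \<le> norm (T x2 - y0) + norm (T x1 - (y0 + y))"
      by (metis norm_triangle_ineq4)
    then have "norm (y - T (x1 - x2)) < e" using x(3,6) by linarith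
    moreover have "norm (x1 - x2) \<le> 2 * real n" using x norm_triangle_ineq4[of x1 x2] by linarith
    ultimately show ?thesis using x closed_csubspace_diff[OF X] by blast
  qed
  \<comment> \<open>Rescaling \<open>y\<close> to norm \<open>r / 2\<close> turns the bound
    \<open>2 n\<close> into \<open>4 n / r\<close> times the norm of \<open>y\<close>. The added 1
    keeps \<open>L\<close> positive when \<open>n = 0\<close>.\<close>
  define L where "L = 4 * real n / r + 1"
  have L: "1 \<le> L" using r by (simp add: L_def)
  have half: "\<exists>x\<in>X. norm x \<le> L * norm y \<and> norm (y - T x) \<le> norm y / 2" if yY: "y \<in> Y" for y
  proof (cases "y = 0")
    case True
    then show ?thesis using zero T0 by (intro bexI[of _ 0]) auto
  next
    case False
    define s where "s = r / (2 * norm y)"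
    have "0 < s" using False r by (simp add: s_def)
    have "norm (s *\<^sub>R y) < r" using False r by (simp add: s_def)
    then obtain x where x: "x \<in> X" "norm x \<le> 2 * real n" "norm (s *\<^sub>R y - T x) < s * (norm y / 2)"
      using small[of "s *\<^sub>R y" "s * (norm y / 2)"] Y_scale[OF yY] \<open>0 < s\<close> False by auto
    have "s *\<^sub>R y - T x = s *\<^sub>R (y - T (inverse s *\<^sub>R x))"
      using x \<open>0 < s\<close> by (simp add: bounded_op_scaleR scaleR_diff_right)
    then have "norm (y - T (inverse s *\<^sub>R x)) \<le> norm y / 2"
      using x(3) \<open>0 < s\<close> by (simp del: times_divide_eq_right)
    moreover have "norm (inverse s *\<^sub>R x) \<le> inverse s * (2 * real n)"
      using x \<open>0 < s\<close> by simp
    moreover have "inverse s * (2 * real n) = (L - 1) * norm y"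
      using False r by (simp add: s_def L_def field_simps)
    moreover have "\<dots> \<le> L * norm y" by (simp add: mult_right_mono)
    ultimately show ?thesis using closed_csubspace_scaleR[OF X x(1)]
      by (intro bexI[of _ "inverse s *\<^sub>R x"]) auto
  qed
  then obtain g where g: "\<And>y. y \<in> Y \<Longrightarrow> g y \<in> X" "\<And>y. y \<in> Y \<Longrightarrow> norm (g y) \<le> L * norm y"
      "\<And>y. y \<in> Y \<Longrightarrow> norm (y - T (g y)) \<le> norm y / 2"
    by metis
  have lower: "norm x \<le> 2 * L * norm (T x)" if "x \<in> X" for x
  proof -
    \<comment> \<open>\<open>z k\<close> is the residual after \<open>k\<close> approximate
      preimages have been subtracted. Residuals halve at each step, so the corrections
      \<open>g (z k)\<close> sum to some \<open>w\<close> in \<open>X\<close> with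
      \<open>T w = T x\<close>; injectivity gives \<open>w = x\<close>, and the geometric series
      bounds its norm.\<close>
    define z where "z k = ((\<lambda>y. y - T (g y)) ^^ k) (T x)" for k
    have z0: "z 0 = T x" and zS: "z (Suc k) = z k - T (g (z k))" for k
      by (auto simp: z_def)
    have zY: "z k \<in> Y" for k
    proof (induction k)
      case 0 then show ?case using that by (simp add: z0 Y_def)
    next
      case (Suc k)
      then show ?case unfolding zS using g(1) by (intro Y_diff) (auto simp: Y_def)
    qed
    have zn: "norm (z k) \<le> (1/2) ^ k * norm (T x)" for k
    proof (induction k)
      case (Suc k)
      then show ?case using g(3)[OF zY[of k]] unfolding zS by simp
    qed (simp add: z0)
    have gn: "norm (g (z k)) \<le> (1/2) ^ k * (L * norm (T x))" for k
    proof -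
      have "norm (g (z k)) \<le> L * norm (z k)" by (rule g(2)[OF zY])
      also have "\<dots> \<le> L * ((1/2) ^ k * norm (T x))" using L zn by (intro mult_left_mono) auto
      finally show ?thesis by (simp add: mult_ac)
    qed
    have geo: "(\<lambda>k. (1/2) ^ k * (L * norm (T x))) sums (2 * (L * norm (T x)))"
      using sums_mult2[OF geometric_sums[of "1/2 :: real"], of "L * norm (T x)"] by simp
    have sm: "summable (\<lambda>k. norm (g (z k)))"
      using gn by (intro summable_comparison_test'[OF sums_summable[OF geo], of 0]) auto
    then have sg: "summable (\<lambda>k. g (z k))" by (rule summable_norm_cancel)
    define w where "w = suminf (\<lambda>k. g (z k))"
    have part: "(\<Sum>k<m. g (z k)) \<in> X" for m
      using g(1)[OF zY] by (intro closed_csubspace_sum[OF X])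
    have lim: "(\<lambda>m. \<Sum>k<m. g (z k)) \<longlonglongrightarrow> w" unfolding w_def by (rule summable_LIMSEQ[OF sg])
    have "closed X" using X by (simp add: closed_csubspace_def)
    then have wX: "w \<in> X" using part lim by (rule closed_sequentially)
    have "T (\<Sum>k<m. g (z k)) = T x - z m" for m
    proof (induction m)
      case (Suc m)
      then show ?case using part g(1)[OF zY] by (simp add: bounded_op_add zS)
    qed (simp add: z0 T0)
    moreover have "(\<lambda>m. T x - z m) \<longlonglongrightarrow> T x - 0"
    proof (intro tendsto_intros)
      have "(\<lambda>k. (1/2) ^ k * norm (T x)) \<longlonglongrightarrow> 0"
        by (intro tendsto_mult_left_zero LIMSEQ_realpow_zero) auto
      then show "z \<longlonglongrightarrow> 0" by (rule Lim_null_comparison[rotated]) (use zn in auto)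
    qed
    moreover have "(\<lambda>m. T (\<Sum>k<m. g (z k))) \<longlonglongrightarrow> T w"
      by (rule continuous_on_tendsto_compose[OF bounded_op_continuous lim wX]) (simp add: part)
    ultimately have "T w = T x" using LIMSEQ_unique by fastforce
    then have "x = w" using inj wX that by (auto dest: inj_onD)
    then have "norm x \<le> suminf (\<lambda>k. norm (g (z k)))" unfolding w_def using summable_norm[OF sm] by simp
    also have "\<dots> \<le> 2 * (L * norm (T x))"
      using suminf_le[OF gn sm sums_summable[OF geo]] sums_unique[OF geo] by simp
    finally show ?thesis by simp
  qed
  show ?thesis
  proof (rule that[of "1 / (2 * L)"])
    show "1 / (2 * L) * norm x \<le> norm (T x)" if "x \<in> X" for x
      using lower[OF that] L by (simp add: field_simps)
  qed (use L in simp)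
qed

end

section \<open>Real polynomials on the unit interval\<close>

text \<open>The quotient is the product of the factors \<open>(k - i) / (n - i)\<close> for
  \<open>i < j\<close>. Each lies in [0, 1] and is within \<open>i / (n - i)\<close> of
  \<open>k / n\<close>, uniformly in \<open>k\<close>, so the errors merely add up.\<close>

lemma binomial_quotient_approx:
  fixes j :: nat and e :: real
  assumes "0 < e"
  shows "\<forall>\<^sub>F n in sequentially. \<forall>k\<le>n.
    \<bar>real (k choose j) / real (n choose j) - (real k / real n) ^ j\<bar> \<le> e"
  using assms
proof (induction j arbitrary: e)
  case 0
  then show ?case by simp
next
  case (Suc j)
  have "(\<lambda>n. real j / real n) \<longlonglongrightarrow> 0"
    by (rule lim_const_over_n)
  then have "(\<lambda>n. real j / real (n + j - j)) \<longlonglongrightarrow> 0"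
    by simp
  then have "(\<lambda>n. real j / real (n - j)) \<longlonglongrightarrow> 0"
    by (rule LIMSEQ_offset)
  then have "\<forall>\<^sub>F n in sequentially. real j / real (n - j) < e / 2"
    using Suc.prems by (intro order_tendstoD(2)) auto
  moreover have "\<forall>\<^sub>F n in sequentially. \<forall>k\<le>n.
    \<bar>real (k choose j) / real (n choose j) - (real k / real n) ^ j\<bar> \<le> e / 2"
    by (rule Suc.IH) (use Suc.prems in simp)
  moreover have "\<forall>\<^sub>F n in sequentially. Suc j < n"
    by (rule eventually_gt_at_top)
  ultimately show ?case
  proof eventually_elim
    case (elim n)
    show ?case
    proof (intro allI impI)
      fix k assume "k \<le> n"
      define r where "r = real (k choose j) / real (n choose j)"
      define s where "s = real (k - j) / real (n - j)"
      have step: "real (m choose Suc j) = real (m choose j) * real (m - j) / real (Suc j)" for m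
      proof -
        have "Suc j * (m choose Suc j) = (m - j) * (m choose j)"
          by (simp only: binomial_absorption binomial_absorb_comp)
        then have "real (Suc j) * real (m choose Suc j) = real (m - j) * real (m choose j)"
          by (metis of_nat_mult)
        then show ?thesis by (simp add: field_simps)
      qed
      have q: "real (k choose Suc j) / real (n choose Suc j) = r * s"
        unfolding step r_def s_def by (simp del: of_nat_Suc)
      have s01: "0 \<le> s" "s \<le> 1"
        using \<open>k \<le> n\<close> elim by (auto simp: s_def field_simps)
      have k01: "0 \<le> real k / real n" "real k / real n \<le> 1"
        using \<open>k \<le> n\<close> elim by auto
      have "\<bar>s - real k / real n\<bar> \<le> real j / real (n - j)"
      proof (cases "j \<le> k")
        case True
        have "real k / real n - s = real j * (real n - real k) / (real n * (real n - real j))"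
          using True \<open>k \<le> n\<close> elim by (simp add: s_def of_nat_diff field_simps)
        moreover have "0 \<le> \<dots>" using \<open>k \<le> n\<close> elim by simp
        moreover have "\<dots> \<le> real j * real n / (real n * (real n - real j))"
          using \<open>k \<le> n\<close> elim by (intro divide_right_mono mult_left_mono) auto
        moreover have "real j * real n / (real n * (real n - real j)) = real j / real (n - j)"
          using elim by (simp add: of_nat_diff)
        ultimately show ?thesis by (metis abs_minus_commute abs_of_nonneg)
      next
        case False
        \<comment> \<open>For \<open>k < j\<close> the truncated subtraction gives
          \<open>s = 0\<close>, and \<open>k / n\<close> itself is small.\<close>
        have "real k / real n \<le> real j / real (n - j)"
          using False elim by (intro frac_le) auto
        then show ?thesis using False by (simp add: s_def)
      qed
      then have 1: "\<bar>s - real k / real n\<bar> \<le> e / 2" using elim by linarith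
      have 2: "\<bar>r - (real k / real n) ^ j\<bar> \<le> e / 2" using elim \<open>k \<le> n\<close> by (simp add: r_def)
      have "r * s - (real k / real n) ^ Suc j
          = (r - (real k / real n) ^ j) * s + (real k / real n) ^ j * (s - real k / real n)"
        by (simp add: algebra_simps)
      then have "\<bar>r * s - (real k / real n) ^ Suc j\<bar>
          \<le> \<bar>r - (real k / real n) ^ j\<bar> * s + (real k / real n) ^ j * \<bar>s - real k / real n\<bar>"
        using s01 k01 by (metis abs_mult abs_of_nonneg abs_triangle_ineq zero_le_power)
      also have "\<dots> \<le> e / 2 * 1 + 1 * (e / 2)"
        using s01 k01 1 2 Suc.prems by (intro add_mono mult_mono) (auto simp: power_le_one)
      finally show "\<bar>real (k choose Suc j) / real (n choose Suc j) - (real k / real n) ^ Suc j\<bar> \<le> e"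
        unfolding q by simp
    qed
  qed
qed

text \<open>The idea of Hausdorff's moment theorem: the numbers \<open>\<beta> n k\<close> below are nonnegative weights
  of total mass \<open>\<phi> 1\<close>, and the integral of the polynomial against the measure with mass \<open>\<beta> n k\<close>
  at \<open>k/n\<close> tends to the value of \<open>\<phi>\<close>.\<close>

lemma poly_functional_nonneg:
  fixes \<phi> :: "real poly \<Rightarrow> real"
  assumes add: "\<And>p q. \<phi> (p + q) = \<phi> p + \<phi> q"
    and smult: "\<And>c p. \<phi> (smult c p) = c * \<phi> p"
    and nonneg: "\<And>k l. 0 \<le> \<phi> ([:0, 1:] ^ k * [:1, - 1:] ^ l)"
    and q: "\<And>t. 0 \<le> t \<Longrightarrow> t \<le> 1 \<Longrightarrow> 0 \<le> poly q t"
  shows "0 \<le> \<phi> q"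
proof -
  let ?x = "[:0, 1:] :: real poly" and ?y = "[:1, - 1:] :: real poly"
  define \<beta> where "\<beta> n k = real (n choose k) * \<phi> (?x ^ k * ?y ^ (n - k))" for n k
  have \<beta>: "0 \<le> \<beta> n k" for n k by (simp add: \<beta>_def nonneg)
  have zero: "\<phi> 0 = 0" using smult[of 0 0] by simp
  have sum: "\<phi> (\<Sum>i\<in>I. f i) = (\<Sum>i\<in>I. \<phi> (f i))" for f :: "nat \<Rightarrow> real poly" and I
    by (induction I rule: infinite_finite_induct) (auto simp: zero add)
  have xy: "?x + ?y = 1" by (simp add: one_pCons)
  \<comment> \<open>Multiply \<open>x^j\<close> by \<open>(x + (1 - x))^(n - j) = 1\<close> and
    expand; after an index shift by \<open>j\<close>, \<open>choose_mult\<close> turns the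
    coefficients into binomial quotients times the weights.\<close>
  have moment: "\<phi> (?x ^ j) = (\<Sum>k\<le>n. real (k choose j) / real (n choose j) * \<beta> n k)" if "j \<le> n" for n j
  proof -
    have "?x ^ j = ?x ^ j * (?x + ?y) ^ (n - j)" by (simp only: xy power_one mult_1_right)
    also have "\<dots> = (\<Sum>k\<le>n - j. smult (real ((n - j) choose k)) (?x ^ (k + j) * ?y ^ (n - j - k)))"
      unfolding binomial_ring sum_distrib_left
      by (intro sum.cong refl) (simp add: power_add of_nat_poly algebra_simps)
    also have "\<dots> = (\<Sum>k\<in>{j..n}. smult (real ((n - j) choose (k - j))) (?x ^ k * ?y ^ (n - k)))"
      by (rule sum.reindex_bij_witness[of _ "\<lambda>k. k - j" "\<lambda>k. k + j"]) (use that in \<open>auto simp: add.commute\<close>)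
    finally have "\<phi> (?x ^ j) = (\<Sum>k\<in>{j..n}. real ((n - j) choose (k - j)) * \<phi> (?x ^ k * ?y ^ (n - k)))"
      by (simp add: sum smult)
    also have "\<dots> = (\<Sum>k\<in>{j..n}. real (k choose j) / real (n choose j) * \<beta> n k)"
    proof (rule sum.cong)
      fix k assume "k \<in> {j..n}"
      then have "(n choose k) * (k choose j) = (n choose j) * ((n - j) choose (k - j))"
        by (intro choose_mult) auto
      then have "real (n choose k) * real (k choose j) = real (n choose j) * real ((n - j) choose (k - j))"
        by (metis of_nat_mult)
      moreover have "real (n choose j) \<noteq> 0" using that by simp
      ultimately have "real ((n - j) choose (k - j)) = real (k choose j) / real (n choose j) * real (n choose k)"
        by (simp add: field_simps)
      then show "real ((n - j) choose (k - j)) * \<phi> (?x ^ k * ?y ^ (n - k))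
          = real (k choose j) / real (n choose j) * \<beta> n k"
        by (simp add: \<beta>_def)
    qed simp
    also have "\<dots> = (\<Sum>k\<le>n. real (k choose j) / real (n choose j) * \<beta> n k)"
      by (rule sum.mono_neutral_left) (auto simp: binomial_eq_0)
    finally show ?thesis .
  qed
  \<comment> \<open>\<open>e * a\<close> bounds the error of replacing the binomial quotients by
    powers of \<open>k / n\<close>, a point where \<open>q\<close> is nonnegative. The weights add
    up to \<open>\<phi> 1\<close>, the moment of order 0.\<close>
  define a where "a = (\<Sum>j\<le>degree q. \<bar>coeff q j\<bar>)"
  have "- (e * a * \<phi> 1) \<le> \<phi> q" if "0 < e" for e
  proof -
    have "\<forall>\<^sub>F n in sequentially. \<forall>j\<in>{..degree q}. \<forall>k\<le>n.
        \<bar>real (k choose j) / real (n choose j) - (real k / real n) ^ j\<bar> \<le> e"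
      using binomial_quotient_approx[OF that] by (intro eventually_ball_finite) auto
    moreover have "\<forall>\<^sub>F n in sequentially. degree q < n" by (rule eventually_gt_at_top)
    ultimately have "\<forall>\<^sub>F n in sequentially. degree q < n \<and> (\<forall>j\<in>{..degree q}. \<forall>k\<le>n.
        \<bar>real (k choose j) / real (n choose j) - (real k / real n) ^ j\<bar> \<le> e)"
      by eventually_elim auto
    then obtain n where n: "degree q < n"
      and close: "\<And>j k. j \<le> degree q \<Longrightarrow> k \<le> n \<Longrightarrow>
        \<bar>real (k choose j) / real (n choose j) - (real k / real n) ^ j\<bar> \<le> e"
      unfolding eventually_sequentially by (meson atMost_iff order_refl)
    have "\<phi> q = \<phi> (\<Sum>j\<le>degree q. smult (coeff q j) (?x ^ j))"
      by (subst poly_as_sum_of_monoms[of q, symmetric]) (simp add: monom_altdef)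
    also have "\<dots> = (\<Sum>j\<le>degree q. coeff q j * (\<Sum>k\<le>n. real (k choose j) / real (n choose j) * \<beta> n k))"
      unfolding sum smult using n by (intro sum.cong refl arg_cong2[where f = "(*)"] moment) auto
    also have "\<dots> = (\<Sum>k\<le>n. \<beta> n k * (\<Sum>j\<le>degree q. coeff q j * (real (k choose j) / real (n choose j))))"
      unfolding sum_distrib_left by (subst sum.swap) (simp add: mult_ac)
    also have "\<dots> \<ge> (\<Sum>k\<le>n. \<beta> n k * - (e * a))"
    proof (intro sum_mono mult_left_mono \<beta>)
      fix k assume "k \<in> {..n}"
      have "0 \<le> poly q (real k / real n)" using n \<open>k \<in> {..n}\<close> by (intro q) auto
      also have "\<dots> = (\<Sum>j\<le>degree q. coeff q j * (real k / real n) ^ j)" by (simp add: poly_altdef)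
      finally have 1: "0 \<le> (\<Sum>j\<le>degree q. coeff q j * (real k / real n) ^ j)" .
      have "(\<Sum>j\<le>degree q. coeff q j * (real k / real n) ^ j)
          - (\<Sum>j\<le>degree q. coeff q j * (real (k choose j) / real (n choose j)))
        = (\<Sum>j\<le>degree q. coeff q j * ((real k / real n) ^ j - real (k choose j) / real (n choose j)))"
        by (simp add: sum_subtractf right_diff_distrib)
      also have "\<dots> \<le> (\<Sum>j\<le>degree q. \<bar>coeff q j\<bar> * e)"
      proof (rule sum_mono)
        fix j assume "j \<in> {..degree q}"
        have "coeff q j * ((real k / real n) ^ j - real (k choose j) / real (n choose j))
          \<le> \<bar>coeff q j\<bar> * \<bar>real (k choose j) / real (n choose j) - (real k / real n) ^ j\<bar>"
          by (metis abs_ge_self abs_minus_commute abs_mult)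
        also have "\<dots> \<le> \<bar>coeff q j\<bar> * e"
          using close \<open>j \<in> _\<close> \<open>k \<in> _\<close> by (intro mult_left_mono) auto
        finally show "coeff q j * ((real k / real n) ^ j - real (k choose j) / real (n choose j))
          \<le> \<bar>coeff q j\<bar> * e" .
      qed
      also have "\<dots> = e * a" by (simp add: a_def sum_distrib_left mult.commute)
      finally show "- (e * a) \<le> (\<Sum>j\<le>degree q. coeff q j * (real (k choose j) / real (n choose j)))"
        using 1 by linarith
    qed
    also have "(\<Sum>k\<le>n. \<beta> n k * - (e * a)) = - (e * a * \<phi> 1)"
      using moment[of 0 n] by (simp add: sum_distrib_left sum_negf mult_ac)
    finally show ?thesis .
  qed
  note lower = this
  have "- \<phi> q \<le> e" if "0 < e" for e
  proof -
    have "0 \<le> a * \<phi> 1" using nonneg[of 0 0] by (simp add: a_def sum_nonneg)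
    then have "e / (a * \<phi> 1 + 1) * (a * \<phi> 1) \<le> e"
      using that by (simp add: field_simps)
    moreover have "0 < e / (a * \<phi> 1 + 1)" using \<open>0 \<le> a * \<phi> 1\<close> that by simp
    ultimately show ?thesis using lower[of "e / (a * \<phi> 1 + 1)"] by (simp add: mult.assoc)
  qed
  then show ?thesis by (metis field_le_epsilon add_0 neg_le_0_iff_le)
qed

text \<open>Stone-Weierstrass supplies polynomial functions, while \<open>fun_calc\<close> speaks of
  sequences of formal polynomials; the coefficients provide the conversion.\<close>

lemma weierstrass_poly:
  fixes u :: "real \<Rightarrow> real"
  assumes "continuous_on {a..b} u"
  obtains q where "uniform_limit {a..b} (\<lambda>n t. poly (q n) t) u sequentially"
proof -
  have "\<exists>r. \<forall>t\<in>{a..b}. \<bar>u t - poly r t\<bar> < 1 / real (Suc n)" for n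
  proof -
    obtain g where g: "real_polynomial_function g" "\<And>t. t \<in> {a..b} \<Longrightarrow> \<bar>u t - g t\<bar> < 1 / real (Suc n)"
      using Stone_Weierstrass_real_polynomial_function[OF compact_Icc assms, of "1 / real (Suc n)"] by auto
    then obtain c m where "g = (\<lambda>x. \<Sum>i\<le>(m::nat). c i * x ^ i)"
      using real_polynomial_function_imp_sum by blast
    then have "poly (\<Sum>i\<le>m. monom (c i) i) t = g t" for t
      by (simp add: poly_sum poly_monom)
    then show ?thesis using g by metis
  qed
  then obtain q where q: "\<And>n t. t \<in> {a..b} \<Longrightarrow> \<bar>u t - poly (q n) t\<bar> < 1 / real (Suc n)"
    by metis
  have "uniform_limit {a..b} (\<lambda>n t. poly (q n) t) u sequentially"
    unfolding uniform_limit_iff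
  proof (intro allI impI)
    fix e :: real assume "0 < e"
    then have "\<forall>\<^sub>F n in sequentially. 1 / real (Suc n) < e"
      using order_tendstoD(2)[OF LIMSEQ_Suc[OF lim_const_over_n[of "1::real"]]] by simp
    then show "\<forall>\<^sub>F n in sequentially. \<forall>t\<in>{a..b}. dist (poly (q n) t) (u t) < e"
    proof eventually_elim
      case (elim n)
      then show ?case using q[of _ n] by (force simp: dist_real_def abs_minus_commute)
    qed
  qed
  then show ?thesis by (rule that)
qed

section \<open>The inner product of square-summable functions\<close>

lemma ell2_summable: "(\<lambda>g. (cmod (Rep_ell2 f g))\<^sup>2) summable_on UNIV"
  using Rep_ell2[of f] by simp

lemma ell2_eqI: "(\<And>g. Rep_ell2 f g = Rep_ell2 h g) \<Longrightarrow> f = h"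
  by (metis Rep_ell2_inject ext)

lemma norm_ell2_power2: "(norm f)\<^sup>2 = (\<Sum>\<^sub>\<infinity>g. (cmod (Rep_ell2 f g))\<^sup>2)"
  by (simp add: norm_ell2.rep_eq infsum_nonneg)

lemma cinner_abs_summable:
  "(\<lambda>g. norm (Rep_ell2 f g * cnj (Rep_ell2 h g))) summable_on UNIV"
proof (rule summable_on_comparison_test)
  show "(\<lambda>g. (cmod (Rep_ell2 f g))\<^sup>2 + (cmod (Rep_ell2 h g))\<^sup>2) summable_on UNIV"
    by (intro summable_on_add ell2_summable)
  show "norm (Rep_ell2 f g * cnj (Rep_ell2 h g)) \<le> (cmod (Rep_ell2 f g))\<^sup>2 + (cmod (Rep_ell2 h g))\<^sup>2" for g
  proof -
    have "2 * (cmod (Rep_ell2 f g) * cmod (Rep_ell2 h g)) \<le> (cmod (Rep_ell2 f g))\<^sup>2 + (cmod (Rep_ell2 h g))\<^sup>2"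
      using sum_squares_bound[of "cmod (Rep_ell2 f g)" "cmod (Rep_ell2 h g)"] by simp
    moreover have "0 \<le> cmod (Rep_ell2 f g) * cmod (Rep_ell2 h g)" by simp
    ultimately show ?thesis unfolding norm_mult complex_mod_cnj by linarith
  qed
qed auto

lemma cinner_summable: "(\<lambda>g. Rep_ell2 f g * cnj (Rep_ell2 h g)) summable_on UNIV"
  by (rule abs_summable_summable[OF cinner_abs_summable])

lemma cinner_commute: "cinner f h = cnj (cinner h f)"
  unfolding cinner_def infsum_cnj[symmetric] by (simp add: mult.commute)

lemma cinner_add_left: "cinner (f + f') h = cinner f h + cinner f' h"
  unfolding cinner_def plus_ell2.rep_eq distrib_right
  by (rule infsum_add[OF cinner_summable cinner_summable])

lemma cinner_scaleC_left: "cinner (c *\<^sub>C f) h = c * cinner f h"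
  unfolding cinner_def scaleC_ell2.rep_eq mult.assoc by (rule infsum_cmult_right')

lemma cinner_add_right: "cinner f (h + h') = cinner f h + cinner f h'"
  by (subst (1 2 3) cinner_commute) (simp add: cinner_add_left)

lemma cinner_scaleC_right: "cinner f (c *\<^sub>C h) = cnj c * cinner f h"
  by (subst (1 2) cinner_commute) (simp add: cinner_scaleC_left)

lemma cinner_self: "cinner f f = complex_of_real ((norm f)\<^sup>2)"
proof -
  have "cinner f f = (\<Sum>\<^sub>\<infinity>g. complex_of_real ((cmod (Rep_ell2 f g))\<^sup>2))"
    unfolding cinner_def by (simp only: complex_norm_square)
  moreover have "((\<lambda>g. complex_of_real ((cmod (Rep_ell2 f g))\<^sup>2)) has_sum complex_of_real ((norm f)\<^sup>2)) UNIV"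
    unfolding has_sum_of_real_iff norm_ell2_power2 by (rule has_sum_infsum[OF ell2_summable])
  ultimately show ?thesis by (simp only: infsumI)
qed

lemma norm_cinner_le: "cmod (cinner f h) \<le> norm f * norm h"
proof -
  have "cmod (cinner f h) \<le> (\<Sum>\<^sub>\<infinity>g. norm (Rep_ell2 f g * cnj (Rep_ell2 h g)))"
    unfolding cinner_def by (rule norm_infsum_bound[OF cinner_abs_summable])
  also have "\<dots> \<le> norm f * norm h"
  proof (rule infsum_le_finite_sums[OF cinner_abs_summable])
    fix F :: "'a set" assume "finite F"
    have "(\<Sum>g\<in>F. norm (Rep_ell2 f g * cnj (Rep_ell2 h g)))
        = (\<Sum>g\<in>F. \<bar>cmod (Rep_ell2 f g)\<bar> * \<bar>cmod (Rep_ell2 h g)\<bar>)"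
      by (simp add: norm_mult)
    also have "\<dots> \<le> L2_set (\<lambda>g. cmod (Rep_ell2 f g)) F * L2_set (\<lambda>g. cmod (Rep_ell2 h g)) F"
      by (rule L2_set_mult_ineq)
    also have "\<dots> \<le> norm f * norm h"
      using \<open>finite F\<close> by (intro mult_mono L2_set_le_norm_ell2) auto
    finally show "(\<Sum>g\<in>F. norm (Rep_ell2 f g * cnj (Rep_ell2 h g))) \<le> norm f * norm h" .
  qed
  finally show ?thesis .
qed

lemma bounded_bilinear_cinner: "bounded_bilinear cinner"
proof
  show "\<exists>K. \<forall>f h. norm (cinner f h) \<le> norm f * norm h * K"
    by (rule exI[of _ 1]) (simp add: norm_cinner_le)
qed (auto simp: cinner_add_left cinner_add_right scaleR_ell2_def cinner_scaleC_left
    cinner_scaleC_right scaleR_conv_of_real)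

interpretation cinner: bounded_bilinear cinner
  by (rule bounded_bilinear_cinner)

lemma cinner_delta_right: "cinner f (delta g) = Rep_ell2 f g"
proof -
  have "cinner f (delta g) = (\<Sum>\<^sub>\<infinity>h\<in>{g}. Rep_ell2 f h * cnj (Rep_ell2 (delta g) h))"
    unfolding cinner_def by (rule infsum_cong_neutral) (auto simp: delta.rep_eq)
  then show ?thesis by (simp add: delta.rep_eq)
qed

lemma cinner_delta_left: "cinner (delta g) f = cnj (Rep_ell2 f g)"
  by (subst cinner_commute) (simp add: cinner_delta_right)

lemma cinner_eqI:
  assumes "\<And>f. cinner f h = cinner f h'"
  shows "h = h'"
  using assms[of "delta _"] by (intro ell2_eqI) (simp add: cinner_delta_left)

lemma Rep_ell2_sum: "Rep_ell2 (\<Sum>i\<in>I. f i) g = (\<Sum>i\<in>I. Rep_ell2 (f i) g)"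
  by (induction I rule: infinite_finite_induct) (auto simp: zero_ell2.rep_eq plus_ell2.rep_eq)

lemma Rep_ell2_delta_sum:
  "finite F \<Longrightarrow> Rep_ell2 (\<Sum>g\<in>F. c g *\<^sub>C delta g) h = (if h \<in> F then c h else 0)"
  by (simp add: Rep_ell2_sum scaleC_ell2.rep_eq delta.rep_eq if_distrib[where f = "(*) _"] cong: if_cong)

lemma delta_sums_approx:
  assumes "0 < e"
  obtains F where "finite F" "norm (f - (\<Sum>g\<in>F. Rep_ell2 f g *\<^sub>C delta g)) < e"
proof -
  have "(\<lambda>g. (cmod (Rep_ell2 f g))\<^sup>2) summable_on UNIV" by (rule ell2_summable)
  then have "((\<lambda>g. (cmod (Rep_ell2 f g))\<^sup>2) has_sum (norm f)\<^sup>2) UNIV"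
    by (simp add: norm_ell2_power2)
  then have "((\<lambda>F. \<Sum>g\<in>F. (cmod (Rep_ell2 f g))\<^sup>2) \<longlongrightarrow> (norm f)\<^sup>2) (finite_subsets_at_top UNIV)"
    by (simp add: has_sum_def)
  then have "\<forall>\<^sub>F F in finite_subsets_at_top UNIV. (norm f)\<^sup>2 - e\<^sup>2 / 4 < (\<Sum>g\<in>F. (cmod (Rep_ell2 f g))\<^sup>2)"
    using assms by (intro order_tendstoD(1)) auto
  then obtain F where F: "finite F" "(norm f)\<^sup>2 - e\<^sup>2 / 4 < (\<Sum>g\<in>F. (cmod (Rep_ell2 f g))\<^sup>2)"
    unfolding eventually_finite_subsets_at_top by blast
  have "norm (f - (\<Sum>g\<in>F. Rep_ell2 f g *\<^sub>C delta g)) \<le> e / 2"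
  proof (rule norm_ell2_le)
    fix G :: "'a set" assume "finite G"
    have "L2_set (\<lambda>g. cmod (Rep_ell2 (f - (\<Sum>g\<in>F. Rep_ell2 f g *\<^sub>C delta g)) g)) G
        = sqrt (\<Sum>g\<in>G - F. (cmod (Rep_ell2 f g))\<^sup>2)"
      unfolding L2_set_def minus_ell2.rep_eq Rep_ell2_delta_sum[OF F(1)]
      by (intro arg_cong[where f = sqrt] sum.mono_neutral_cong_right) (use \<open>finite G\<close> in auto)
    also have "\<dots> \<le> sqrt (e\<^sup>2 / 4)"
    proof -
      have "(\<Sum>g\<in>G - F. (cmod (Rep_ell2 f g))\<^sup>2) + (\<Sum>g\<in>F. (cmod (Rep_ell2 f g))\<^sup>2)
          = (\<Sum>g\<in>(G - F) \<union> F. (cmod (Rep_ell2 f g))\<^sup>2)"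
        using \<open>finite G\<close> F(1) by (intro sum.union_disjoint[symmetric]) auto
      also have "\<dots> \<le> (norm f)\<^sup>2"
        unfolding norm_ell2_power2 using \<open>finite G\<close> F(1)
        by (intro finite_sum_le_infsum ell2_summable) auto
      finally show ?thesis using F(2) by (intro real_sqrt_le_mono) linarith
    qed
    also have "\<dots> = e / 2" using assms by (simp add: real_sqrt_divide)
    finally show "L2_set (\<lambda>g. cmod (Rep_ell2 (f - (\<Sum>g\<in>F. Rep_ell2 f g *\<^sub>C delta g)) g)) G \<le> e / 2" .
  qed
  then show ?thesis using assms F(1) by (intro that[of F]) auto
qed

text \<open>Density of the finitely supported functions, arranged as a proof rule for closed
  conditions.\<close>

lemma closed_delta_sums_UNIV:
  assumes "closed S" "\<And>F c. finite F \<Longrightarrow> (\<Sum>g\<in>F. c g *\<^sub>C delta g) \<in> S"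
  shows "f \<in> S"
proof -
  have "f \<in> closure S"
    unfolding closure_approachable
  proof (intro allI impI)
    fix e :: real assume "0 < e"
    then obtain F where "finite F" "norm (f - (\<Sum>g\<in>F. Rep_ell2 f g *\<^sub>C delta g)) < e"
      by (rule delta_sums_approx)
    then show "\<exists>y\<in>S. dist y f < e" using assms(2) by (metis dist_commute dist_norm)
  qed
  then show ?thesis using assms(1) by simp
qed

text \<open>\<open>bounded_linear\<close> means linearity over the reals, hence the test on all
  complex multiples of the basis vectors.\<close>

lemma bounded_linear_ell2_eqI:
  assumes "bounded_linear \<phi>" "bounded_linear \<psi>"
    and "\<And>c g. \<phi> (c *\<^sub>C delta g) = \<psi> (c *\<^sub>C delta g)"
  shows "\<phi> f = \<psi> f"
proof -
  have "f \<in> {f. \<phi> f = \<psi> f}"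
  proof (rule closed_delta_sums_UNIV)
    show "closed {f. \<phi> f = \<psi> f}"
      by (intro closed_Collect_eq bounded_linear.continuous_on[OF assms(1)]
          bounded_linear.continuous_on[OF assms(2)] continuous_on_id)
  qed (simp add: linear_sum[OF bounded_linear.linear[OF assms(1)]]
      linear_sum[OF bounded_linear.linear[OF assms(2)]] assms(3))
  then show ?thesis by simp
qed

section \<open>Adjoints\<close>

lemma clinear_opersD: "T \<in> clinear_opers \<Longrightarrow> blinfun_apply T (c *\<^sub>C f) = c *\<^sub>C blinfun_apply T f"
  by (simp add: clinear_opers_def)

lemma clinear_opers_eqI:
  assumes "S \<in> clinear_opers" "T \<in> clinear_opers"
    and "\<And>g. blinfun_apply S (delta g) = blinfun_apply T (delta g)"
  shows "S = T"
  by (rule blinfun_eqI, rule bounded_linear_ell2_eqI)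
    (auto simp: blinfun.bounded_linear_right clinear_opersD[OF assms(1)] clinear_opersD[OF assms(2)] assms(3))

text \<open>\<open>adj\<close> is a definite description and says nothing before existence is known.
  The relation passes through sums, products and polynomials by exhibiting the adjoint.\<close>

definition is_adj :: "'g oper \<Rightarrow> 'g oper \<Rightarrow> bool" where
  "is_adj T S \<longleftrightarrow> (\<forall>f h. cinner (T f) h = cinner f (S h))"

lemma is_adjD: "is_adj T S \<Longrightarrow> cinner (T f) h = cinner f (S h)"
  by (simp add: is_adj_def)

lemma is_adj_sym: "is_adj T S \<Longrightarrow> is_adj S T"
  unfolding is_adj_def by (metis cinner_commute)

lemma is_adj_unique:
  assumes "is_adj T S" "is_adj T S'"
  shows "S = S'"
  by (rule blinfun_eqI, rule cinner_eqI) (metis assms is_adjD)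

lemma adj_eqI: "is_adj T S \<Longrightarrow> adj T = S"
  unfolding adj_def is_adj_def[symmetric] by (blast intro: is_adj_unique)

lemma is_adj_compose: "is_adj T S \<Longrightarrow> is_adj T' S' \<Longrightarrow> is_adj (T o\<^sub>L T') (S' o\<^sub>L S)"
  by (simp add: is_adj_def)

lemma is_adj_add: "is_adj T S \<Longrightarrow> is_adj T' S' \<Longrightarrow> is_adj (T + T') (S + S')"
  by (simp add: is_adj_def blinfun.add_left cinner_add_left cinner_add_right)

lemma is_adj_scaleC: "is_adj T S \<Longrightarrow> is_adj (c *\<^sub>C T) (cnj c *\<^sub>C S)"
  by (simp add: is_adj_def scaleC_blinfun.rep_eq cinner_scaleC_left cinner_scaleC_right)

lemma is_adj_scaleR: "is_adj T S \<Longrightarrow> is_adj (r *\<^sub>R T) (r *\<^sub>R S)"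
  using is_adj_scaleC[of T S "of_real r"] by (simp add: scaleC_of_real)

lemma is_adj_zero: "is_adj 0 0"
  by (simp add: is_adj_def cinner.zero_left cinner.zero_right)

lemma is_adj_id: "is_adj id_blinfun id_blinfun"
  by (simp add: is_adj_def)

lemma is_adj_diff: "is_adj T S \<Longrightarrow> is_adj T' S' \<Longrightarrow> is_adj (T - T') (S - S')"
  by (simp add: is_adj_def blinfun.diff_left cinner.diff_left cinner.diff_right)

lemma is_adj_sum: "(\<And>i. i \<in> I \<Longrightarrow> is_adj (T i) (S i)) \<Longrightarrow> is_adj (\<Sum>i\<in>I. T i) (\<Sum>i\<in>I. S i)"
  by (induction I rule: infinite_finite_induct) (auto simp: is_adj_zero is_adj_add)

text \<open>The coordinates of \<open>S h\<close> are forced to be \<open>s h\<close>. Their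
  square-summability comes from testing \<open>T\<close> on \<open>v\<close>, the restriction of
  \<open>s h\<close> to a finite set: if \<open>l\<close> is its length, then
  \<open>l^2 = cinner (T v) h \<le> norm T * l * norm h\<close>.\<close>

lemma is_adj_exists:
  assumes T: "T \<in> clinear_opers"
  obtains S where "is_adj T S"
proof -
  define s where "s h g = cnj (cinner (T (delta g)) h)" for h g
  have bound: "L2_set (\<lambda>g. cmod (s h g)) F \<le> norm h * norm T" if "finite F" for h F
  proof -
    define l where "l = L2_set (\<lambda>g. cmod (s h g)) F"
    define v where "v = (\<Sum>g\<in>F. s h g *\<^sub>C delta g)"
    have "norm v \<le> l"
    proof (rule norm_ell2_le)
      fix G :: "'a set" assume "finite G"
      have "L2_set (\<lambda>g. cmod (Rep_ell2 v g)) G = sqrt (\<Sum>g\<in>G \<inter> F. (cmod (s h g))\<^sup>2)"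
        unfolding L2_set_def v_def Rep_ell2_delta_sum[OF that]
        by (intro arg_cong[where f = sqrt] sum.mono_neutral_cong_right) (use \<open>finite G\<close> in auto)
      also have "\<dots> \<le> l"
        unfolding l_def L2_set_def by (intro real_sqrt_le_mono sum_mono2) (use that in auto)
      finally show "L2_set (\<lambda>g. cmod (Rep_ell2 v g)) G \<le> l" .
    qed
    have "cinner (T v) h = (\<Sum>g\<in>F. s h g * cnj (s h g))"
      unfolding v_def
      by (simp add: blinfun.sum_right cinner.sum_left clinear_opersD[OF T] cinner_scaleC_left s_def)
    also have "\<dots> = complex_of_real (l\<^sup>2)"
      unfolding l_def L2_set_def
      by (simp add: sum_nonneg complex_norm_square[symmetric] del: of_real_power)
    finally have "l\<^sup>2 \<le> norm (T v) * norm h"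
      using norm_cinner_le[of "T v" h] by (simp add: norm_power)
    also have "\<dots> \<le> (norm T * l) * norm h"
      using norm_blinfun[of T v] mult_left_mono[OF \<open>norm v \<le> l\<close> norm_ge_zero[of T]]
      by (intro mult_right_mono) auto
    finally have *: "l * l \<le> l * (norm h * norm T)" by (simp add: power2_eq_square mult_ac)
    have "0 \<le> l" by (simp add: l_def L2_set_nonneg)
    then have "l \<le> norm h * norm T"
      using * by (cases "l = 0") (auto simp: mult_le_cancel_left)
    then show ?thesis by (simp add: l_def)
  qed
  define S where "S h = Abs_ell2 (s h)" for h
  have RS: "Rep_ell2 (S h) = s h" for h
    unfolding S_def using sq_summableI(1)[OF bound] by (simp add: Abs_ell2_inverse)
  have lin: "bounded_linear S"
  proof (rule bounded_linear_intro)
    show "S (f + h) = S f + S h" for f h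
      by (rule ell2_eqI) (simp add: RS plus_ell2.rep_eq s_def cinner_add_right)
    show "S (r *\<^sub>R f) = r *\<^sub>R S f" for r f
      by (rule ell2_eqI) (simp add: RS scaleR_ell2_def scaleC_ell2.rep_eq s_def cinner_scaleC_right)
    show "norm (S f) \<le> norm f * norm T" for f
      by (rule norm_ell2_le) (simp add: RS bound)
  qed
  have "cinner (T f) h = cinner f (S h)" for f h
  proof (rule bounded_linear_ell2_eqI[where \<phi> = "\<lambda>f. cinner (T f) h"])
    show "bounded_linear (\<lambda>f. cinner (T f) h)"
      by (rule bounded_linear_compose[OF cinner.bounded_linear_left blinfun.bounded_linear_right])
    show "bounded_linear (\<lambda>f. cinner f (S h))" by (rule cinner.bounded_linear_left)
    show "cinner (T (c *\<^sub>C delta g)) h = cinner (c *\<^sub>C delta g) (S h)" for c g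
      by (simp add: clinear_opersD[OF T] cinner_scaleC_left cinner_delta_left RS s_def)
  qed
  then have "is_adj T (Blinfun S)"
    by (simp add: is_adj_def bounded_linear_Blinfun_apply[OF lin])
  then show ?thesis by (rule that)
qed

lemma is_adj_clinear: "is_adj T S \<Longrightarrow> S \<in> clinear_opers"
  unfolding clinear_opers_def by (auto intro!: cinner_eqI simp: is_adjD[symmetric] cinner_scaleC_right)

lemma is_adj_adj: "T \<in> clinear_opers \<Longrightarrow> is_adj T (adj T)"
  using is_adj_exists adj_eqI by metis

section \<open>Polynomials in an operator\<close>

lemma blinfun_compose_assoc: "(R o\<^sub>L S) o\<^sub>L T = R o\<^sub>L (S o\<^sub>L T)"
  by (rule blinfun_eqI) simp

lemma blinfun_compose_id [simp]: "id_blinfun o\<^sub>L T = T" "T o\<^sub>L id_blinfun = T"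
  by (auto intro: blinfun_eqI)

interpretation comp: bounded_bilinear "(o\<^sub>L) :: 'b::real_normed_vector \<Rightarrow>\<^sub>L 'c::real_normed_vector \<Rightarrow> 'a::real_normed_vector \<Rightarrow>\<^sub>L 'b \<Rightarrow> 'a \<Rightarrow>\<^sub>L 'c"
  by (rule bounded_bilinear_blinfun_compose)

lemma oper_poly_eq_sum:
  assumes "degree q \<le> n"
  shows "oper_poly q A = (\<Sum>i\<le>n. coeff q i *\<^sub>R ((\<lambda>B. A o\<^sub>L B) ^^ i) id_blinfun)"
  unfolding oper_poly_def using assms
  by (intro sum.mono_neutral_left) (auto simp: coeff_eq_0)

lemma oper_poly_0 [simp]: "oper_poly 0 A = 0"
  by (simp add: oper_poly_def)

lemma oper_poly_add: "oper_poly (p + q) A = oper_poly p A + oper_poly q A"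
proof -
  let ?n = "max (degree p) (degree q)"
  have "degree (p + q) \<le> ?n" by (rule degree_add_le_max)
  then show ?thesis
    by (simp add: oper_poly_eq_sum[of _ ?n] scaleR_add_left sum.distrib)
qed

lemma oper_poly_smult: "oper_poly (smult c q) A = c *\<^sub>R oper_poly q A"
  by (simp add: oper_poly_eq_sum[of "smult c q" "degree q"] oper_poly_eq_sum[of q "degree q"]
      degree_smult_le scaleR_sum_right)

lemma oper_poly_diff: "oper_poly (p - q) A = oper_poly p A - oper_poly q A"
  using oper_poly_add[of "p - q" q A] by simp

lemma oper_poly_pCons: "oper_poly (pCons a q) A = a *\<^sub>R id_blinfun + (A o\<^sub>L oper_poly q A)"
proof -
  have "oper_poly (pCons a q) A
      = (\<Sum>i\<le>Suc (degree q). coeff (pCons a q) i *\<^sub>R ((\<lambda>B. A o\<^sub>L B) ^^ i) id_blinfun)"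
    by (rule oper_poly_eq_sum[OF degree_pCons_le])
  also have "\<dots> = a *\<^sub>R id_blinfun + (A o\<^sub>L oper_poly q A)"
    by (simp add: sum.atMost_Suc_shift oper_poly_def comp.sum_right comp.scaleR_right del: sum.atMost_Suc)
  finally show ?thesis .
qed

lemma oper_poly_1 [simp]: "oper_poly 1 A = id_blinfun"
  by (simp add: one_pCons oper_poly_pCons comp.zero_right)

lemma oper_poly_X [simp]: "oper_poly [:0, 1:] A = A"
  by (simp add: oper_poly_pCons comp.zero_right)

lemma oper_poly_mult: "oper_poly (p * q) A = oper_poly p A o\<^sub>L oper_poly q A"
proof (induction p)
  case 0
  then show ?case by (simp add: comp.zero_left)
next
  case (pCons a p)
  then show ?case
    by (simp add: oper_poly_pCons oper_poly_add oper_poly_smult comp.add_left comp.scaleR_left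
        blinfun_compose_assoc)
qed

lemma oper_poly_pcompose: "oper_poly (pcompose q h) A = oper_poly q (oper_poly h A)"
proof (induction q)
  case 0
  then show ?case by simp
next
  case (pCons a q)
  then show ?case
    by (simp add: pcompose_pCons oper_poly_pCons oper_poly_add oper_poly_mult comp.zero_right)
qed

lemma oper_poly_commute:
  assumes "S o\<^sub>L A = A o\<^sub>L S"
  shows "S o\<^sub>L oper_poly q A = oper_poly q A o\<^sub>L S"
proof (induction q)
  case 0
  then show ?case by (simp add: comp.zero_left comp.zero_right)
next
  case (pCons a q)
  have "S o\<^sub>L (A o\<^sub>L oper_poly q A) = (A o\<^sub>L oper_poly q A) o\<^sub>L S"
    by (metis assms blinfun_compose_assoc pCons.IH)
  then show ?case
    by (simp add: oper_poly_pCons comp.add_left comp.add_right comp.scaleR_left comp.scaleR_right)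
qed

lemma is_adj_oper_poly:
  assumes "is_adj A A"
  shows "is_adj (oper_poly q A) (oper_poly q A)"
proof (induction q)
  case 0
  then show ?case by (simp add: is_adj_zero)
next
  case (pCons a q)
  have "is_adj (A o\<^sub>L oper_poly q A) (oper_poly q A o\<^sub>L A)"
    by (rule is_adj_compose[OF assms pCons.IH])
  then have "is_adj (A o\<^sub>L oper_poly q A) (A o\<^sub>L oper_poly q A)"
    using oper_poly_commute[of A A q] by simp
  then show ?case
    unfolding oper_poly_pCons by (intro is_adj_add is_adj_scaleR is_adj_id)
qed

lemma oper_poly_in_subalgebra:
  assumes "closed_subalgebra M" "id_blinfun \<in> M" "A \<in> M"
  shows "oper_poly q A \<in> M"
proof (induction q)
  case 0
  then show ?case using assms by (simp add: closed_subalgebra_def closed_csubspace_def)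
next
  case (pCons a q)
  then show ?case
    using assms closed_csubspace_scaleR[of M id_blinfun a]
    unfolding oper_poly_pCons closed_subalgebra_def by (auto simp: closed_csubspace_def)
qed

lemma norm_oper_poly_power_le: "norm (oper_poly ([:0, 1:] ^ n) A) \<le> norm A ^ n"
proof (induction n)
  case 0
  then show ?case by (simp add: norm_blinfun_bound)
next
  case (Suc n)
  have "norm (oper_poly ([:0, 1:] ^ Suc n) A) \<le> norm A * norm (oper_poly ([:0, 1:] ^ n) A)"
    unfolding power_Suc oper_poly_mult oper_poly_X by (rule norm_blinfun_compose)
  also have "\<dots> \<le> norm A * norm A ^ n" by (intro mult_left_mono Suc.IH) auto
  finally show ?case by simp
qed

text \<open>The partial sums of the Neumann series are polynomials in \<open>C\<close>, so the
  inverse stays in the given closed subalgebra, be it \<open>Cstar_red\<close> or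
  \<open>VN\<close>.\<close>

lemma neumann_inverse:
  fixes C :: "'g oper"
  assumes M: "closed_subalgebra M" "id_blinfun \<in> M" "C \<in> M" and C: "norm C < 1"
  obtains E where "E \<in> M" "(id_blinfun - C) o\<^sub>L E = id_blinfun" "E o\<^sub>L (id_blinfun - C) = id_blinfun"
proof -
  let ?x = "[:0, 1:] :: real poly"
  define P where "P n = oper_poly (?x ^ n) C" for n
  have "summable (\<lambda>n. norm (P n))"
    using C norm_oper_poly_power_le by (intro summable_comparison_test'[OF summable_geometric[of "norm C"], of 0])
      (auto simp: P_def)
  then have "summable P" by (rule summable_norm_cancel)
  define E where "E = suminf P"
  have S: "(\<lambda>n. \<Sum>i<n. P i) \<longlonglongrightarrow> E"
    unfolding E_def using \<open>summable P\<close> by (rule summable_LIMSEQ)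
  have sum: "(\<Sum>i<n. P i) = oper_poly (\<Sum>i<n. ?x ^ i) C" for n
    by (induction n) (auto simp: P_def oper_poly_add)
  have one: "oper_poly (1 - ?x) C = id_blinfun - C" by (simp only: oper_poly_diff oper_poly_1 oper_poly_X)
  have tel: "oper_poly (1 - ?x ^ n) C = id_blinfun - P n" for n
    by (simp only: oper_poly_diff oper_poly_1 P_def)
  have lim: "(\<lambda>n. id_blinfun - P n) \<longlonglongrightarrow> id_blinfun"
    using tendsto_diff[OF tendsto_const summable_LIMSEQ_zero[OF \<open>summable P\<close>], of id_blinfun] by simp
  have "(id_blinfun - C) o\<^sub>L (\<Sum>i<n. P i) = id_blinfun - P n" for n
    unfolding sum one[symmetric] oper_poly_mult[symmetric] tel[symmetric]
    by (simp only: one_diff_power_eq[symmetric])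
  then have 1: "(id_blinfun - C) o\<^sub>L E = id_blinfun"
    using LIMSEQ_unique[OF comp.tendsto[OF tendsto_const S, of "id_blinfun - C"]] lim by simp
  have "(\<Sum>i<n. P i) o\<^sub>L (id_blinfun - C) = id_blinfun - P n" for n
    unfolding sum one[symmetric] oper_poly_mult[symmetric] tel[symmetric]
    by (simp only: one_diff_power_eq[symmetric] mult.commute)
  then have 2: "E o\<^sub>L (id_blinfun - C) = id_blinfun"
    using LIMSEQ_unique[OF comp.tendsto[OF S tendsto_const, of "id_blinfun - C"]] lim by simp
  have "closed M" using M by (simp add: closed_subalgebra_def closed_csubspace_def)
  moreover have "(\<Sum>i<n. P i) \<in> M" for n unfolding sum by (rule oper_poly_in_subalgebra[OF M])
  ultimately have "E \<in> M" using S by (rule closed_sequentially)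
  then show ?thesis using 1 2 by (rule that)
qed

text \<open>Self-adjointness and Cauchy-Schwarz make the norms of the iterates log-convex, so the
  ratios of consecutive norms never fall below the first one.\<close>

lemma self_adjoint_power_norm:
  assumes A: "is_adj A A"
  shows "norm (A f) ^ Suc m \<le> norm (oper_poly ([:0, 1:] ^ Suc m) A f) * norm f ^ m"
proof -
  define n where "n j = norm (oper_poly ([:0, 1:] ^ j) A f)" for j
  have shift: "oper_poly ([:0, 1:] ^ Suc j) A f = A (oper_poly ([:0, 1:] ^ j) A f)" for j
    unfolding power_Suc oper_poly_mult by simp
  have n0: "n 0 = norm f" and n1: "n 1 = norm (A f)"
    using shift[of 0] by (auto simp: n_def)
  have convex: "(n (Suc j))\<^sup>2 \<le> n j * n (Suc (Suc j))" for j
  proof -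
    let ?y = "oper_poly ([:0, 1:] ^ j) A f"
    have "complex_of_real ((n (Suc j))\<^sup>2) = cinner ?y (A (A ?y))"
      unfolding n_def cinner_self[symmetric] shift by (rule is_adjD[OF A])
    then have "(n (Suc j))\<^sup>2 = cmod (cinner ?y (A (A ?y)))"
      by (metis abs_of_nonneg norm_of_real zero_le_power2)
    also have "\<dots> \<le> n j * n (Suc (Suc j))"
      unfolding n_def shift by (rule norm_cinner_le)
    finally show ?thesis .
  qed
  have nn: "0 \<le> n j" for j by (simp add: n_def)
  \<comment> \<open>The ratio at \<open>j\<close> against the ratio at 0, cross-multiplied because
    iterates may vanish.\<close>
  have ratio: "n 1 * n j \<le> n 0 * n (Suc j)" for j
  proof (induction j)
    case (Suc j)
    show ?case
    proof (cases "n (Suc j) = 0")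
      case False
      then have "0 < n (Suc j)" using nn[of "Suc j"] by linarith
      have "(n 1 * n (Suc j)) * n (Suc j) \<le> n 1 * (n j * n (Suc (Suc j)))"
        using mult_left_mono[OF convex[of j] nn[of 1]] by (simp add: power2_eq_square mult_ac)
      also have "\<dots> \<le> (n 0 * n (Suc (Suc j))) * n (Suc j)"
        using mult_right_mono[OF Suc.IH nn[of "Suc (Suc j)"]] by (simp add: mult_ac)
      finally show ?thesis using \<open>0 < n (Suc j)\<close> by simp
    qed (simp add: nn)
  qed simp
  have "n 1 ^ Suc m \<le> n (Suc m) * n 0 ^ m"
  proof (induction m)
    case (Suc m)
    have "n 1 ^ Suc (Suc m) \<le> n 1 * (n (Suc m) * n 0 ^ m)"
      using mult_left_mono[OF Suc.IH nn[of 1]] by simp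
    also have "\<dots> \<le> (n 0 * n (Suc (Suc m))) * n 0 ^ m"
      using mult_right_mono[OF ratio[of "Suc m"] zero_le_power[OF nn[of 0]], of m] by (simp add: mult_ac)
    finally show ?case by (simp add: mult_ac)
  qed simp
  then show ?thesis unfolding n0 n1 unfolding n_def .
qed

section \<open>Positive operators and the functional calculus\<close>

text \<open>For operators that are a priori only real-linear, \<open>is_adj B B\<close> also
  supplies complex linearity.\<close>

definition positive :: "'g oper \<Rightarrow> bool" where
  "positive B \<longleftrightarrow> is_adj B B \<and> (\<forall>f. 0 \<le> Re (cinner (B f) f))"

text \<open>One factor \<open>s\<close> moves to the other side of the inner product, so
  nonnegativity of the form of \<open>m\<close> passes to \<open>s * s * m\<close>.\<close>

lemma oper_poly_square_sandwich:
  assumes "is_adj C C"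
  shows "cinner (oper_poly (s * s * m) C f) f = cinner (oper_poly m C (oper_poly s C f)) (oper_poly s C f)"
proof -
  have "oper_poly (s * s * m) C = oper_poly s C o\<^sub>L (oper_poly m C o\<^sub>L oper_poly s C)"
    by (simp only: oper_poly_mult[symmetric] mult_ac)
  then show ?thesis
    by (simp add: is_adjD[OF is_adj_oper_poly[OF assms]])
qed

text \<open>This takes the place of the spectral theorem. By \<open>poly_functional_nonneg\<close>
  it suffices to test products of powers of \<open>x\<close> and \<open>1 - x\<close>; removing
  squares leaves \<open>1\<close>, \<open>x\<close>, \<open>1 - x\<close> and
  \<open>x (1 - x)\<close>, and the last equals \<open>x^2 (1 - x) + (1 - x)^2 x\<close>.\<close>

lemma positive_contraction_poly_nonneg:
  assumes C: "positive C" "positive (id_blinfun - C)"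
    and q: "\<And>t. 0 \<le> t \<Longrightarrow> t \<le> 1 \<Longrightarrow> 0 \<le> poly q t"
  shows "0 \<le> Re (cinner (oper_poly q C f) f)"
proof (rule poly_functional_nonneg[where \<phi> = "\<lambda>q. Re (cinner (oper_poly q C f) f)"])
  let ?x = "[:0, 1:] :: real poly" and ?y = "[:1, - 1:] :: real poly"
  have adj: "is_adj C C" using C by (simp add: positive_def)
  note sandwich = oper_poly_square_sandwich[OF adj]
  have y: "oper_poly ?y C = id_blinfun - C"
    by (simp add: oper_poly_pCons comp.minus_right comp.zero_right comp.scaleR_right)
  have px: "0 \<le> Re (cinner (oper_poly ?x C f) f)" for f
    using C by (simp add: positive_def)
  have py: "0 \<le> Re (cinner (oper_poly ?y C f) f)" for f
    using C unfolding y by (simp add: positive_def)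
  have pxy: "0 \<le> Re (cinner (oper_poly (?x * ?y) C f) f)" for f
  proof -
    have "?x * ?y = ?x * ?x * ?y + ?y * ?y * ?x" by simp
    then have "cinner (oper_poly (?x * ?y) C f) f
        = cinner (oper_poly (?x * ?x * ?y) C f) f + cinner (oper_poly (?y * ?y * ?x) C f) f"
      by (metis oper_poly_add blinfun.add_left cinner_add_left)
    then show ?thesis unfolding sandwich using px py by simp
  qed
  fix k l
  define s m where "s = ?x ^ (k div 2) * ?y ^ (l div 2)" and "m = ?x ^ (k mod 2) * ?y ^ (l mod 2)"
  have "m = 1 \<or> m = ?x \<or> m = ?y \<or> m = ?x * ?y"
    unfolding m_def by (cases "even k"; cases "even l") (simp_all add: even_iff_mod_2_eq_zero odd_iff_mod_2_eq_one)
  then have "0 \<le> Re (cinner (oper_poly m C f) f)" for f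
    using px py pxy by (auto simp: cinner_self)
  moreover have "?x ^ k * ?y ^ l = s * s * m"
  proof -
    have "z ^ k = z ^ (k div 2) * z ^ (k div 2) * z ^ (k mod 2)" for z :: "real poly" and k
      by (metis div_mult_mod_eq mult_2_right power_add)
    from this[of ?x k] this[of ?y l] have "?x ^ k * ?y ^ l
        = (?x ^ (k div 2) * ?x ^ (k div 2) * ?x ^ (k mod 2)) * (?y ^ (l div 2) * ?y ^ (l div 2) * ?y ^ (l mod 2))"
      by (rule arg_cong2)
    then show ?thesis unfolding s_def m_def by (simp only: mult_ac)
  qed
  ultimately show "0 \<le> Re (cinner (oper_poly (?x ^ k * ?y ^ l) C f) f)"
    by (simp only: sandwich)
qed (auto simp: oper_poly_add oper_poly_smult blinfun.add_left blinfun.scaleR_left cinner.add_left cinner.scaleR_left q)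

text \<open>\<open>K^2 - q^2\<close> is nonnegative on [0, 1], and its quadratic form at
  \<open>f\<close> compares \<open>K * norm f\<close> with the norm of
  \<open>q(C) f\<close>.\<close>

lemma positive_contraction_norm_poly_le:
  assumes C: "positive C" "positive (id_blinfun - C)"
    and q: "\<And>t. 0 \<le> t \<Longrightarrow> t \<le> 1 \<Longrightarrow> \<bar>poly q t\<bar> \<le> K"
  shows "norm (oper_poly q C) \<le> K"
proof (rule norm_blinfun_bound)
  show "0 \<le> K" using q[of 0] by linarith
  fix f
  have adj: "is_adj C C" using C by (simp add: positive_def)
  have "0 \<le> Re (cinner (oper_poly ([:K\<^sup>2:] - q * q) C f) f)"
  proof (rule positive_contraction_poly_nonneg[OF C])
    fix t :: real assume "0 \<le> t" "t \<le> 1"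
    then have "\<bar>poly q t\<bar>\<^sup>2 \<le> K\<^sup>2" using q by (intro power_mono) auto
    then show "0 \<le> poly ([:K\<^sup>2:] - q * q) t" by (simp add: power2_eq_square)
  qed
  also have "oper_poly ([:K\<^sup>2:] - q * q) C = K\<^sup>2 *\<^sub>R id_blinfun - oper_poly (q * q * 1) C"
    by (simp add: oper_poly_diff oper_poly_pCons comp.zero_right)
  also have "Re (cinner (\<dots> f) f) = K\<^sup>2 * (norm f)\<^sup>2 - (norm (oper_poly q C f))\<^sup>2"
    by (simp add: blinfun.diff_left blinfun.scaleR_left cinner.diff_left cinner.scaleR_left
        oper_poly_square_sandwich[OF adj] cinner_self del: mult_1_right)
  finally have "(norm (oper_poly q C f))\<^sup>2 \<le> (K * norm f)\<^sup>2" by (simp add: power_mult_distrib)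
  then show "norm (oper_poly q C f) \<le> K * norm f"
    by (rule power2_le_imp_le) (simp add: \<open>0 \<le> K\<close>)
qed

lemma positive_scaleR: "positive B \<Longrightarrow> 0 \<le> r \<Longrightarrow> positive (r *\<^sub>R B)"
  by (simp add: positive_def is_adj_scaleR blinfun.scaleR_left cinner.scaleR_left)

lemma positive_id_minus:
  assumes "positive B" "norm B \<le> 1"
  shows "positive (id_blinfun - B)"
proof -
  have "Re (cinner (B f) f) \<le> norm f * norm f" for f
  proof -
    have "Re (cinner (B f) f) \<le> norm (B f) * norm f"
      using norm_cinner_le[of "B f" f] complex_Re_le_cmod[of "cinner (B f) f"] by linarith
    also have "\<dots> \<le> norm f * norm f"
      using norm_blinfun[of B f] mult_right_mono[OF assms(2) norm_ge_zero[of f]]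
      by (intro mult_right_mono) auto
    finally show ?thesis .
  qed
  then show ?thesis
    using assms by (simp add: positive_def is_adj_diff is_adj_id blinfun.diff_left cinner.diff_left
        cinner_self power2_eq_square)
qed

lemma positive_norm_poly_le:
  assumes B: "positive B" "norm B \<le> R"
    and q: "\<And>t. 0 \<le> t \<Longrightarrow> t \<le> R \<Longrightarrow> \<bar>poly q t\<bar> \<le> K"
  shows "norm (oper_poly q B) \<le> K"
proof (cases "R = 0")
  case True
  then have "B = 0" using B by simp
  \<comment> \<open>Composition with the zero polynomial exhibits \<open>q(0)\<close> as a scalar
    operator.\<close>
  then have "oper_poly q B = oper_poly (pcompose q 0) B" by (simp add: oper_poly_pcompose)
  also have "\<dots> = poly q 0 *\<^sub>R id_blinfun"
    by (simp add: pcompose_0' oper_poly_pCons comp.zero_right poly_0_coeff_0)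
  also have "norm \<dots> \<le> K"
    using q[of 0] True by (intro norm_blinfun_bound) (auto simp: blinfun.scaleR_left intro!: mult_right_mono)
  finally show ?thesis .
next
  case False
  then have R: "0 < R" using B(2) norm_ge_zero[of B] by linarith
  define C where "C = inverse R *\<^sub>R B"
  have "positive C" unfolding C_def using R by (intro positive_scaleR B) simp
  moreover have "norm C \<le> 1" using B(2) R by (simp add: C_def field_simps)
  ultimately have C: "positive C" "positive (id_blinfun - C)" by (auto intro: positive_id_minus)
  have "oper_poly q B = oper_poly (pcompose q [:0, R:]) C"
    using R by (simp add: oper_poly_pcompose oper_poly_pCons comp.scaleR_right comp.zero_right C_def)
  also have "norm \<dots> \<le> K"
  proof (rule positive_contraction_norm_poly_le[OF C])
    fix t :: real assume "0 \<le> t" "t \<le> 1"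
    then show "\<bar>poly (pcompose q [:0, R:]) t\<bar> \<le> K"
      using R by (simp add: poly_pcompose q mult.commute mult_left_le_one_le)
  qed
  finally show ?thesis .
qed

text \<open>With \<open>p = q\<close> this is the Cauchy property; with different sequences it shows
  that the limit is independent of the approximation.\<close>

lemma oper_poly_uniform_limits_close:
  assumes B: "positive B" "norm B \<le> R"
    and p: "uniform_limit {0..R} (\<lambda>n t. poly (p n) t) u sequentially"
    and q: "uniform_limit {0..R} (\<lambda>n t. poly (q n) t) u sequentially"
    and e: "0 < e"
  shows "\<exists>N. \<forall>m\<ge>N. \<forall>n\<ge>N. norm (oper_poly (p m) B - oper_poly (q n) B) < e"
proof -
  have "\<forall>\<^sub>F n in sequentially. \<forall>t\<in>{0..R}. dist (poly (p n) t) (u t) < e / 4"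
    using uniform_limitD[OF p, of "e / 4"] e by simp
  moreover have "\<forall>\<^sub>F n in sequentially. \<forall>t\<in>{0..R}. dist (poly (q n) t) (u t) < e / 4"
    using uniform_limitD[OF q, of "e / 4"] e by simp
  ultimately obtain N where N: "\<And>n t. N \<le> n \<Longrightarrow> t \<in> {0..R} \<Longrightarrow> \<bar>poly (p n) t - u t\<bar> < e / 4"
      "\<And>n t. N \<le> n \<Longrightarrow> t \<in> {0..R} \<Longrightarrow> \<bar>poly (q n) t - u t\<bar> < e / 4"
    unfolding eventually_sequentially dist_real_def by (metis le_trans nle_le)
  have close: "\<bar>x - z\<bar> < e / 4 \<Longrightarrow> \<bar>y - z\<bar> < e / 4 \<Longrightarrow> \<bar>x - y\<bar> \<le> e / 2" for x y z :: real
    by argo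
  have "norm (oper_poly (p m - q n) B) \<le> e / 2" if "N \<le> m" "N \<le> n" for m n
  proof (rule positive_norm_poly_le[OF B])
    fix t assume "0 \<le> t" "t \<le> R"
    then have "t \<in> {0..R}" by simp
    then show "\<bar>poly (p m - q n) t\<bar> \<le> e / 2"
      using close[OF N(1)[OF that(1)] N(2)[OF that(2)]] by simp
  qed
  then show ?thesis
    using e unfolding oper_poly_diff by (intro exI[of _ N] allI impI) (smt (verit) field_sum_of_halves)
qed

text \<open>Any interval \<open>[0, R]\<close> with \<open>norm B \<le> R\<close> may replace the
  one in the definition, so a single interval [0, 1] serves all contractions.\<close>

lemma fun_calc_tendsto:
  assumes B: "positive B" "norm B \<le> R" and u: "continuous_on {0..R} u"
    and q: "uniform_limit {0..R} (\<lambda>n t. poly (q n) t) u sequentially"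
  shows "(\<lambda>n. oper_poly (q n) B) \<longlonglongrightarrow> fun_calc u B"
proof -
  have "continuous_on {0..norm B} u" using u B(2) by (auto intro: continuous_on_subset)
  then obtain r where r: "uniform_limit {0..norm B} (\<lambda>n t. poly (r n) t) u sequentially"
    by (rule weierstrass_poly)
  note close = oper_poly_uniform_limits_close[OF B(1) order_refl]
  have "Cauchy (\<lambda>n. oper_poly (r n) B)"
    using close[OF r r] by (intro metric_CauchyI) (simp add: dist_norm)
  then obtain L where L: "(\<lambda>n. oper_poly (r n) B) \<longlonglongrightarrow> L"
    using Cauchy_convergent_iff convergent_def by blast
  have lim: "(\<lambda>n. oper_poly (p n) B) \<longlonglongrightarrow> L"
    if "uniform_limit {0..norm B} (\<lambda>n t. poly (p n) t) u sequentially" for p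
  proof -
    have "(\<lambda>n. oper_poly (p n) B - oper_poly (r n) B) \<longlonglongrightarrow> 0"
    proof (rule LIMSEQ_I)
      fix e :: real assume "0 < e"
      then show "\<exists>no. \<forall>n\<ge>no. norm (oper_poly (p n) B - oper_poly (r n) B - 0) < e"
        using close[OF that r] by (metis diff_zero)
    qed
    from tendsto_add[OF this L] show ?thesis by simp
  qed
  have "fun_calc u B = L"
    unfolding fun_calc_def
  proof (rule the_equality)
    fix L' assume "\<forall>q. uniform_limit {0..norm B} (\<lambda>n t. poly (q n) t) u sequentially
        \<longrightarrow> (\<lambda>n. oper_poly (q n) B) \<longlonglongrightarrow> L'"
    \<comment> \<open>\<open>r\<close> is an actual approximating sequence, so the universal
      condition on \<open>L'\<close> is not vacuous.\<close>
    then show "L' = L" using r L LIMSEQ_unique by blast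
  qed (use lim in blast)
  moreover have "uniform_limit {0..norm B} (\<lambda>n t. poly (q n) t) u sequentially"
    using q B(2) by (auto intro: uniform_limit_on_subset)
  ultimately show ?thesis using lim by simp
qed

section \<open>Functional calculus of a positive contraction\<close>

context
  fixes C :: "'g oper"
  assumes C: "positive C" "positive (id_blinfun - C)"
begin

lemma positive_contraction_norm_le: "norm C \<le> 1"
  using positive_contraction_norm_poly_le[OF C, of "[:0, 1:]" 1] by simp

lemma fun_calc_tendsto_contraction:
  assumes "continuous_on {0..1} u" "uniform_limit {0..1} (\<lambda>n t. poly (q n) t) u sequentially"
  shows "(\<lambda>n. oper_poly (q n) C) \<longlonglongrightarrow> fun_calc u C"
  by (rule fun_calc_tendsto[OF C(1) positive_contraction_norm_le assms])

lemma fun_calc_poly: "fun_calc (poly q) C = oper_poly q C"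
proof (rule LIMSEQ_unique)
  show "(\<lambda>_. oper_poly q C) \<longlonglongrightarrow> fun_calc (poly q) C"
    by (rule fun_calc_tendsto_contraction)
      (auto simp: uniform_limit_iff intro: continuous_on_poly[OF continuous_on_id, unfolded id_def])
qed simp

text \<open>For \<open>x* x = h(C)\<close> this expresses powers of \<open>x* x\<close> in the
  calculus of the single operator \<open>C\<close>.\<close>

lemma fun_calc_pcompose:
  assumes h: "\<And>t. 0 \<le> t \<Longrightarrow> t \<le> 1 \<Longrightarrow> 0 \<le> poly h t \<and> poly h t \<le> R"
    and u: "continuous_on {0..R} u"
  shows "fun_calc u (oper_poly h C) = fun_calc (\<lambda>t. u (poly h t)) C"
proof -
  obtain q where q: "uniform_limit {0..R} (\<lambda>n t. poly (q n) t) u sequentially"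
    using weierstrass_poly[OF u] .
  have "positive (oper_poly h C)"
    using C h by (simp add: positive_def is_adj_oper_poly positive_contraction_poly_nonneg)
  moreover have "norm (oper_poly h C) \<le> R"
    using h by (intro positive_contraction_norm_poly_le[OF C]) auto
  ultimately have 1: "(\<lambda>n. oper_poly (q n) (oper_poly h C)) \<longlonglongrightarrow> fun_calc u (oper_poly h C)"
    using u q by (rule fun_calc_tendsto)
  have "(\<lambda>n. oper_poly (pcompose (q n) h) C) \<longlonglongrightarrow> fun_calc (\<lambda>t. u (poly h t)) C"
  proof (rule fun_calc_tendsto_contraction)
    show "continuous_on {0..1} (\<lambda>t. u (poly h t))"
      by (rule continuous_on_compose2[OF u]) (use h in \<open>auto intro: continuous_intros\<close>)
    show "uniform_limit {0..1} (\<lambda>n t. poly (pcompose (q n) h) t) (\<lambda>t. u (poly h t)) sequentially"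
      unfolding poly_pcompose by (rule uniform_limit_compose'[OF q]) (use h in auto)
  qed
  then show ?thesis using 1 LIMSEQ_unique unfolding oper_poly_pcompose by blast
qed

lemma fun_calc_linear:
  assumes u: "continuous_on {0..1} u" and v: "continuous_on {0..1} v"
  shows "fun_calc (\<lambda>t. a * u t + b * v t) C = a *\<^sub>R fun_calc u C + b *\<^sub>R fun_calc v C"
proof -
  obtain p where p: "uniform_limit {0..1} (\<lambda>n t. poly (p n) t) u sequentially"
    using weierstrass_poly[OF u] .
  obtain q where q: "uniform_limit {0..1} (\<lambda>n t. poly (q n) t) v sequentially"
    using weierstrass_poly[OF v] .
  have "(\<lambda>n. oper_poly (smult a (p n) + smult b (q n)) C) \<longlonglongrightarrow> fun_calc (\<lambda>t. a * u t + b * v t) C"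
  proof (rule fun_calc_tendsto_contraction)
    show "continuous_on {0..1} (\<lambda>t. a * u t + b * v t)" by (intro continuous_intros u v)
    show "uniform_limit {0..1} (\<lambda>n t. poly (smult a (p n) + smult b (q n)) t) (\<lambda>t. a * u t + b * v t) sequentially"
      unfolding poly_add poly_smult
      by (intro uniform_limit_add bounded_linear.uniform_limit[OF bounded_linear_mult_right] p q)
  qed
  moreover have "(\<lambda>n. oper_poly (smult a (p n) + smult b (q n)) C) \<longlonglongrightarrow> a *\<^sub>R fun_calc u C + b *\<^sub>R fun_calc v C"
    unfolding oper_poly_add oper_poly_smult
    by (intro tendsto_intros fun_calc_tendsto_contraction u v p q)
  ultimately show ?thesis by (rule LIMSEQ_unique)
qed

lemma fun_calc_nonneg:
  assumes u: "continuous_on {0..1} u" and nonneg: "\<And>t. 0 \<le> t \<Longrightarrow> t \<le> 1 \<Longrightarrow> 0 \<le> u t"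
  shows "0 \<le> Re (cinner (fun_calc u C f) f)"
proof -
  obtain q where q: "uniform_limit {0..1} (\<lambda>n t. poly (q n) t) u sequentially"
    using weierstrass_poly[OF u] .
  have lim: "(\<lambda>n. Re (cinner (oper_poly (q n) C f) f)) \<longlonglongrightarrow> Re (cinner (fun_calc u C f) f)"
    by (intro tendsto_Re cinner.tendsto blinfun.tendsto fun_calc_tendsto_contraction u q tendsto_const)
  have "- e * (norm f)\<^sup>2 \<le> Re (cinner (fun_calc u C f) f)" if "0 < e" for e
  proof (rule tendsto_lowerbound[OF lim])
    show "\<forall>\<^sub>F n in sequentially. - e * (norm f)\<^sup>2 \<le> Re (cinner (oper_poly (q n) C f) f)"
      using uniform_limitD[OF q that]
    proof eventually_elim
      case (elim n)
      \<comment> \<open>The approximating polynomials may be negative, but by less than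
        \<open>e\<close>; adding \<open>e\<close> repairs this, and \<open>e\<close> is sent to 0
        afterwards.\<close>
      have "0 \<le> Re (cinner (oper_poly (q n + [:e:]) C f) f)"
      proof (rule positive_contraction_poly_nonneg[OF C])
        fix t :: real assume "0 \<le> t" "t \<le> 1"
        then have "dist (poly (q n) t) (u t) < e" "0 \<le> u t" using elim nonneg by auto
        then show "0 \<le> poly (q n + [:e:]) t" by (auto simp: dist_real_def)
      qed
      then show ?case
        by (simp add: oper_poly_add oper_poly_pCons comp.zero_right blinfun.add_left blinfun.scaleR_left
            cinner.add_left cinner.scaleR_left cinner_self)
    qed
  qed simp
  note lower = this
  have "- Re (cinner (fun_calc u C f) f) \<le> e" if "0 < e" for e
  proof -
    have "e / ((norm f)\<^sup>2 + 1) * (norm f)\<^sup>2 \<le> e"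
      using that by (simp add: field_simps add_pos_nonneg)
    moreover have "0 < e / ((norm f)\<^sup>2 + 1)" using that by (simp add: add_nonneg_pos)
    ultimately show ?thesis using lower by fastforce
  qed
  then show ?thesis by (metis field_le_epsilon add_0 neg_le_0_iff_le)
qed

lemma fun_calc_mono:
  assumes u: "continuous_on {0..1} u" and v: "continuous_on {0..1} v"
    and le: "\<And>t. 0 \<le> t \<Longrightarrow> t \<le> 1 \<Longrightarrow> u t \<le> v t"
  shows "Re (cinner (fun_calc u C f) f) \<le> Re (cinner (fun_calc v C f) f)"
proof -
  have "0 \<le> Re (cinner (fun_calc (\<lambda>t. 1 * v t + (- 1) * u t) C f) f)"
    using le by (intro fun_calc_nonneg continuous_intros u v) auto
  then show ?thesis
    unfolding fun_calc_linear[OF v u]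
    by (simp add: blinfun.diff_left cinner.diff_left)
qed

end

lemma oper_poly_clinear: "A \<in> clinear_opers \<Longrightarrow> is_adj A A \<Longrightarrow> oper_poly q A \<in> clinear_opers"
  using is_adj_clinear is_adj_oper_poly by blast

text \<open>Log-convexity of \<open>n \<mapsto> \<parallel>C\<^sup>n f\<parallel>\<close> turns geometric decay, with whatever
  constant, into a bound on the first step.\<close>

lemma norm_less_one_of_decay:
  fixes C :: "'g oper"
  assumes C: "C \<in> clinear_opers" "is_adj C C" and n: "0 < n" and \<theta>: "0 < \<theta>" "\<theta> < 1"
    and decay: "\<And>g. \<exists>c. \<forall>m. norm (oper_poly ([:0, 1:] ^ (n * m)) C (delta g)) \<le> c * \<theta> ^ m"
  shows "norm C < 1"
proof -
  let ?P = "\<lambda>k. oper_poly ([:0, 1:] ^ k) C"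
  \<comment> \<open>The root spreads the decay over \<open>n\<close> single steps; it will be the
    bound for \<open>norm C\<close>.\<close>
  define \<sigma> where "\<sigma> = root n \<theta>"
  have \<sigma>: "0 < \<sigma>" "\<sigma> < 1" "\<sigma> ^ n = \<theta>" using n \<theta> by (auto simp: \<sigma>_def)
  have step: "norm (C f) \<le> \<sigma> * norm f" if f: "f = (\<Sum>g\<in>F. a g *\<^sub>C delta g)" for f F a
  proof (rule ccontr)
    assume "\<not> ?thesis"
    then have less: "\<sigma> * norm f < norm (C f)" by simp
    then have "f \<noteq> 0" by (auto simp: blinfun.zero_right)
    define c where "c g = (SOME c. \<forall>m. norm (?P (n * m) (delta g)) \<le> c * \<theta> ^ m)" for g
    have c: "norm (?P (n * m) (delta g)) \<le> c g * \<theta> ^ m" for g m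
      unfolding c_def by (rule someI_ex[OF decay, THEN spec])
    define b where "b = (\<Sum>g\<in>F. cmod (a g) * c g)"
    have b: "norm (?P (n * m) f) \<le> b * \<theta> ^ m" for m
    proof -
      have "?P (n * m) f = (\<Sum>g\<in>F. a g *\<^sub>C ?P (n * m) (delta g))"
        unfolding f by (simp add: blinfun.sum_right clinear_opersD[OF oper_poly_clinear[OF C]])
      also have "norm \<dots> \<le> (\<Sum>g\<in>F. cmod (a g) * (c g * \<theta> ^ m))"
        by (intro sum_norm_le) (simp add: norm_scaleC mult_left_mono c)
      finally show ?thesis by (simp add: b_def sum_distrib_right mult.assoc)
    qed
    \<comment> \<open>\<open>x > 1\<close> measures the assumed violation. Convexity keeps the norm
      of \<open>C^(n m) f\<close> above \<open>(x \<sigma>)^(n m) * norm f\<close>; against the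
      decay this leaves \<open>x^m * norm f \<le> b\<close> for all \<open>m > 0\<close>, which is
      absurd. Here \<open>b\<close> may depend on \<open>f\<close>, but the rate may not.\<close>
    define x where "x = norm (C f) / (\<sigma> * norm f)"
    have "1 < x" using less \<sigma> \<open>f \<noteq> 0\<close> by (simp add: x_def)
    have x: "norm (C f) = x * \<sigma> * norm f" using \<sigma> \<open>f \<noteq> 0\<close> by (simp add: x_def)
    have bound: "x ^ m * norm f \<le> b" if m0: "0 < m" for m
    proof -
      obtain k where k: "n * m = Suc k" using n m0 by (cases "n * m") auto
      have "(x * \<sigma> * norm f) ^ Suc k * norm f \<le> (norm (?P (Suc k) f) * norm f ^ k) * norm f"
        unfolding x[symmetric] by (intro mult_right_mono self_adjoint_power_norm C) simp
      also have "\<dots> \<le> (b * \<theta> ^ m) * norm f ^ Suc k"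
        using mult_right_mono[OF b[of m] zero_le_power[OF norm_ge_zero[of f], of "Suc k"]]
        unfolding k by (simp only: power_Suc mult_ac)
      also have "\<theta> ^ m = \<sigma> ^ Suc k" unfolding \<sigma>(3)[symmetric] k[symmetric] by (rule power_mult[symmetric])
      finally have "x ^ Suc k * norm f * (\<sigma> * norm f) ^ Suc k \<le> b * (\<sigma> * norm f) ^ Suc k"
        unfolding power_mult_distrib by (simp only: mult_ac)
      moreover have "0 < (\<sigma> * norm f) ^ Suc k" using \<sigma> \<open>f \<noteq> 0\<close> by (intro zero_less_power) simp
      ultimately have "x ^ (n * m) * norm f \<le> b" unfolding k by (rule mult_right_le_imp_le)
      moreover have "x ^ m \<le> x ^ (n * m)" using \<open>1 < x\<close> n by (intro power_increasing) auto
      ultimately show ?thesis by (meson mult_right_mono norm_ge_zero order_trans)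
    qed
    obtain m where m: "b / norm f < x ^ m" using real_arch_pow[OF \<open>1 < x\<close>] by blast
    also have "x ^ m \<le> x ^ Suc m" using \<open>1 < x\<close> by (intro power_increasing) auto
    finally have "b < x ^ Suc m * norm f" using \<open>f \<noteq> 0\<close> by (simp add: divide_less_eq)
    then show False using bound[of "Suc m"] by simp
  qed
  have "f \<in> {f. norm (C f) \<le> \<sigma> * norm f}" for f
  proof (rule closed_delta_sums_UNIV)
    show "closed {f. norm (C f) \<le> \<sigma> * norm f}"
      by (intro closed_Collect_le continuous_intros)
  qed (use step in auto)
  then have "norm C \<le> \<sigma>" using \<sigma> by (intro norm_blinfun_bound) auto
  then show ?thesis using \<sigma> by simp
qed

section \<open>Translation operators\<close>

lemma bij_add_left: "bij_betw (\<lambda>h. g + h) UNIV (UNIV :: 'g::group_add set)"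
  by (rule bij_betwI[where g = "\<lambda>h. - g + h"]) (auto simp: add.assoc[symmetric])

lemma bij_add_right: "bij_betw (\<lambda>h. h + g) UNIV (UNIV :: 'g::group_add set)"
  by (rule bij_betwI[where g = "\<lambda>h. h - g"]) auto

text \<open>The substitution carries no inverse, so \<open>delta 0\<close> goes to
  \<open>delta (- g)\<close>; this accounts for the signs in the rules below.\<close>

lift_definition right_shift :: "'g::group_add \<Rightarrow> 'g ell2 \<Rightarrow> 'g ell2" is "\<lambda>g f h. f (h + g)"
  subgoal for g f
    using summable_on_reindex_bij_betw[OF bij_add_right[of g], of "\<lambda>h. (cmod (f h))\<^sup>2"] by simp
  done

lemma norm_right_shift: "norm (right_shift g f) = norm f"
proof transfer
  fix g and f :: "'a \<Rightarrow> complex"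
  show "sqrt (\<Sum>\<^sub>\<infinity>h. (cmod (f (h + g)))\<^sup>2) = sqrt (\<Sum>\<^sub>\<infinity>h. (cmod (f h))\<^sup>2)"
    using infsum_reindex_bij_betw[OF bij_add_right[of g], of "\<lambda>h. (cmod (f h))\<^sup>2"] by simp
qed

lift_definition right_reg :: "'g::group_add \<Rightarrow> 'g oper" is right_shift
proof (rule bounded_linear_intro)
  fix g :: 'g and f h :: "'g ell2" and r :: real
  show "right_shift g (f + h) = right_shift g f + right_shift g h" by transfer simp
  show "right_shift g (r *\<^sub>R f) = r *\<^sub>R right_shift g f"
    unfolding scaleR_ell2_def by transfer simp
  show "norm (right_shift g f) \<le> norm f * 1" by (simp add: norm_right_shift)
qed

lemma Rep_right_reg: "Rep_ell2 (right_reg g f) h = Rep_ell2 f (h + g)"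
  by (simp add: right_reg.rep_eq right_shift.rep_eq)

lemma Rep_left_reg: "Rep_ell2 (left_reg g f) h = Rep_ell2 f (- g + h)"
  by (simp add: left_reg.rep_eq shift.rep_eq)

lemma norm_right_reg: "norm (right_reg g f) = norm f"
  by (simp add: right_reg.rep_eq norm_right_shift)

lemma right_reg_delta: "right_reg (- g) (delta 0) = delta g"
  by (rule ell2_eqI) (simp add: Rep_right_reg delta.rep_eq)

lemma left_reg_delta: "left_reg g (delta 0) = delta g"
proof (rule ell2_eqI)
  show "Rep_ell2 (left_reg g (delta 0)) h = Rep_ell2 (delta g) h" for h
    using neg_eq_iff_add_eq_0[of "- g" h] by (auto simp: Rep_left_reg delta.rep_eq)
qed

lemma left_reg_add: "left_reg (g + h) = left_reg g o\<^sub>L left_reg h"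
  by (rule blinfun_eqI, rule ell2_eqI) (simp only: Rep_left_reg blinfun_apply_blinfun_compose minus_add add.assoc)

lemma left_reg_0: "left_reg 0 = id_blinfun"
  by (rule blinfun_eqI, rule ell2_eqI) (simp add: Rep_left_reg)

lemma left_reg_clinear: "left_reg g \<in> clinear_opers"
  by (auto simp: clinear_opers_def Rep_left_reg scaleC_ell2.rep_eq intro!: ell2_eqI)

lemma is_adj_left_reg: "is_adj (left_reg g) (left_reg (- g))"
  unfolding is_adj_def
proof (intro allI)
  fix f h
  have "cinner (left_reg g f) h = (\<Sum>\<^sub>\<infinity>k. Rep_ell2 f (- g + (g + k)) * cnj (Rep_ell2 h (g + k)))"
    unfolding cinner_def Rep_left_reg
    by (rule infsum_reindex_bij_betw[OF bij_add_left[of g], symmetric])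
  then show "cinner (left_reg g f) h = cinner f (left_reg (- g) h)"
    by (simp add: cinner_def Rep_left_reg add.assoc[symmetric])
qed

text \<open>The commutant of the right translations. It contains every left translation, and its
  elements are determined by the image of \<open>delta 0\<close>.\<close>

definition right_invariant :: "'g::group_add oper set" where
  "right_invariant = {T \<in> clinear_opers. \<forall>g f. T (right_reg g f) = right_reg g (T f)}"

lemma right_invariant_delta:
  "T \<in> right_invariant \<Longrightarrow> T (delta g) = right_reg (- g) (T (delta 0))"
  unfolding right_invariant_def by (simp add: right_reg_delta[of g, symmetric])

lemma right_reg_clinear: "right_reg g \<in> clinear_opers"
  by (auto simp: clinear_opers_def Rep_right_reg scaleC_ell2.rep_eq intro!: ell2_eqI)

lemma closed_subalgebra_right_invariant: "closed_subalgebra right_invariant"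
proof -
  have "right_invariant = commutant (range right_reg)"
    by (auto simp: right_invariant_def commutant_def blinfun_eq_iff)
  moreover have "closed_csubspace (commutant (range right_reg))"
    by (rule closed_csubspace_commutant) (auto simp: right_reg_clinear)
  ultimately show ?thesis
    unfolding closed_subalgebra_def by (auto simp: right_invariant_def clinear_opers_def)
qed

lemma left_reg_right_invariant: "left_reg g \<in> right_invariant"
  unfolding right_invariant_def
  by (auto simp: left_reg_clinear Rep_left_reg Rep_right_reg add.assoc intro!: ell2_eqI)

text \<open>\<open>delta 0\<close> is a separating vector: right translations commute with
  \<open>T\<close> and carry it to every basis vector.\<close>

lemma right_invariant_eq_0:
  assumes "T \<in> right_invariant" "T (delta 0) = 0"
  shows "T = 0"
proof (rule clinear_opers_eqI)
  show "T \<in> clinear_opers" using assms by (simp add: right_invariant_def)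
  show "0 \<in> clinear_opers" by (simp add: clinear_opers_def scaleC_zero_right)
  show "T (delta g) = blinfun_apply 0 (delta g)" for g
    using right_invariant_delta[OF assms(1)] assms(2) by (simp add: blinfun.zero_right)
qed

lemma vn_trace_eq: "vn_trace T = Rep_ell2 (T (delta 0)) 0"
  by (simp add: vn_trace_def cinner_delta_right)

text \<open>Both sides are the coefficient of \<open>T (delta 0)\<close> at
  \<open>- g\<close>.\<close>

lemma vn_trace_left_reg_commute:
  assumes "T \<in> right_invariant"
  shows "vn_trace (left_reg g o\<^sub>L T) = vn_trace (T o\<^sub>L left_reg g)"
  by (simp add: vn_trace_eq Rep_left_reg left_reg_delta right_invariant_delta[OF assms, of g] Rep_right_reg)

section \<open>The group algebra in the operators\<close>

definition convolution :: "('g::group_add \<Rightarrow>\<^sub>0 complex) \<Rightarrow> 'g oper" where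
  "convolution a = (\<Sum>g\<in>Poly_Mapping.keys a. Poly_Mapping.lookup a g *\<^sub>C left_reg g)"

text \<open>Written out by coefficients so that it visibly lies in every closed subalgebra
  containing the translations.\<close>

definition convolution_adj :: "('g::group_add \<Rightarrow>\<^sub>0 complex) \<Rightarrow> 'g oper" where
  "convolution_adj a = (\<Sum>g\<in>Poly_Mapping.keys a. cnj (Poly_Mapping.lookup a g) *\<^sub>C left_reg (- g))"

lemma is_adj_convolution: "is_adj (convolution a) (convolution_adj a)"
  unfolding convolution_def convolution_adj_def by (intro is_adj_sum is_adj_scaleC is_adj_left_reg)

context
  fixes M :: "'g::group_add oper set"
  assumes M: "closed_subalgebra M" "range left_reg \<subseteq> M"
begin

lemma left_reg_in: "left_reg g \<in> M"
  using M(2) by blast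

lemma subalgebra_scaleC: "T \<in> M \<Longrightarrow> c *\<^sub>C T \<in> M"
  using M(1) unfolding closed_subalgebra_def closed_csubspace_def by blast

lemma subalgebra_sum: "(\<And>i. i \<in> I \<Longrightarrow> T i \<in> M) \<Longrightarrow> (\<Sum>i\<in>I. T i) \<in> M"
  using M(1) by (intro closed_csubspace_sum) (simp_all add: closed_subalgebra_def)

lemma convolution_in: "convolution a \<in> M"
  unfolding convolution_def by (intro subalgebra_sum subalgebra_scaleC left_reg_in)

lemma convolution_adj_in: "convolution_adj a \<in> M"
  unfolding convolution_adj_def by (intro subalgebra_sum subalgebra_scaleC left_reg_in)

lemma id_in: "id_blinfun \<in> M"
  using M(2) left_reg_0 by (metis rangeI subsetD)

lemma compose_in: "S \<in> M \<Longrightarrow> T \<in> M \<Longrightarrow> S o\<^sub>L T \<in> M"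
  using M by (simp add: closed_subalgebra_def)

lemma subalgebra_scaleR: "T \<in> M \<Longrightarrow> r *\<^sub>R T \<in> M"
  using M by (intro closed_csubspace_scaleR) (simp_all add: closed_subalgebra_def)

lemma subalgebra_diff: "S \<in> M \<Longrightarrow> T \<in> M \<Longrightarrow> S - T \<in> M"
  using M by (intro closed_csubspace_diff) (simp_all add: closed_subalgebra_def)

end

lemmas right_invariant_subalgebra =
  closed_subalgebra_right_invariant image_subsetI[OF left_reg_right_invariant]

lemma vn_trace_convolution_commute:
  assumes "T \<in> right_invariant"
  shows "vn_trace (convolution a o\<^sub>L T) = vn_trace (T o\<^sub>L convolution a)"
proof -
  have T: "T \<in> clinear_opers" using assms by (simp add: right_invariant_def)
  have "Rep_ell2 (left_reg g (T (delta 0))) 0 = Rep_ell2 (T (left_reg g (delta 0))) 0" for g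
    using vn_trace_left_reg_commute[OF assms, of g] by (simp add: vn_trace_eq)
  then show ?thesis
    by (simp add: convolution_def vn_trace_eq blinfun.sum_left blinfun.sum_right scaleC_blinfun.rep_eq
        Rep_ell2_sum scaleC_ell2.rep_eq clinear_opersD[OF T])
qed

text \<open>Direct finiteness: \<open>1 - a d\<close> is then a projection of trace \<open>0\<close>.\<close>

lemma right_inverse_of_left_inverse:
  fixes a :: "'g::group_add \<Rightarrow>\<^sub>0 complex"
  assumes E: "E \<in> right_invariant" "is_adj E E"
    and inv: "(E o\<^sub>L convolution_adj a) o\<^sub>L convolution a = id_blinfun"
  shows "convolution a o\<^sub>L (E o\<^sub>L convolution_adj a) = id_blinfun"
proof -
  let ?a = "convolution a" and ?a' = "convolution_adj a"
  define d where "d = E o\<^sub>L ?a'"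
  define P where "P = id_blinfun - (?a o\<^sub>L d)"
  note R = right_invariant_subalgebra
  have d: "d \<in> right_invariant"
    unfolding d_def by (intro compose_in[OF R] E convolution_adj_in[OF R])
  have P: "P \<in> right_invariant"
    unfolding P_def by (intro subalgebra_diff[OF R] id_in[OF R] compose_in[OF R] convolution_in[OF R] d)
  have "is_adj (?a o\<^sub>L (E o\<^sub>L ?a')) ((?a o\<^sub>L E) o\<^sub>L ?a')"
    by (intro is_adj_compose is_adj_convolution E is_adj_sym[OF is_adj_convolution])
  then have adj: "is_adj P P"
    unfolding P_def d_def by (intro is_adj_diff is_adj_id) (simp add: blinfun_compose_assoc)
  have "(?a o\<^sub>L d) o\<^sub>L (?a o\<^sub>L d) = ?a o\<^sub>L ((d o\<^sub>L ?a) o\<^sub>L d)" by (simp only: blinfun_compose_assoc)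
  also have "\<dots> = ?a o\<^sub>L d" using inv by (simp add: d_def)
  finally have "P o\<^sub>L P = P" by (simp add: P_def comp.diff_left comp.diff_right)
  \<comment> \<open>Traciality replaces \<open>a d\<close> by \<open>d a = 1\<close>. For the
    projection \<open>P\<close> the trace is the squared norm of \<open>P (delta 0)\<close>, so
    \<open>P\<close> kills a separating vector.\<close>
  have "vn_trace (?a o\<^sub>L d) = vn_trace (id_blinfun :: 'g oper)"
    using vn_trace_convolution_commute[OF d, of a] inv by (simp add: d_def)
  then have "vn_trace P = 0"
    by (simp add: vn_trace_eq P_def blinfun.diff_left minus_ell2.rep_eq)
  moreover have "vn_trace P = complex_of_real ((norm (P (delta 0)))\<^sup>2)"
  proof -
    have "vn_trace (P o\<^sub>L P) = cinner (P (delta 0)) (P (delta 0))"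
      by (simp add: vn_trace_def is_adjD[OF adj])
    then show ?thesis using \<open>P o\<^sub>L P = P\<close> by (simp add: cinner_self)
  qed
  ultimately have "P (delta 0) = 0" by simp
  then have "P = 0" by (rule right_invariant_eq_0[OF P])
  then show ?thesis by (simp add: P_def d_def)
qed

section \<open>Scalar inequalities behind the two decay estimates\<close>

text \<open>\<open>y0\<close> is where \<open>(K y)^s\<close> reaches \<open>\<eta>\<close>: up to
  it the constant suffices, beyond it the slope \<open>K^s / y0\<close> does. The summand
  \<open>2 * \<eta>\<close> ensures \<open>\<eta> < L\<close>, which later keeps
  \<open>1 - \<eta> / L\<close> positive.\<close>

lemma powr_le_affine:
  fixes K s \<eta> :: real
  assumes "0 < K" "0 < s" "0 < \<eta>"
  obtains L where "\<eta> < L" "\<And>y. 0 \<le> y \<Longrightarrow> y \<le> 1 \<Longrightarrow> (K * y) powr s \<le> \<eta> + L * y"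
proof -
  define y0 where "y0 = \<eta> powr (1 / s) / K"
  have y0: "0 < y0" using assms by (simp add: y0_def)
  define L where "L = 2 * \<eta> + K powr s / y0"
  have L: "\<eta> < L" using assms y0 by (simp add: L_def add_pos_nonneg add_strict_increasing)
  have "(K * y) powr s \<le> \<eta> + L * y" if "0 \<le> y" "y \<le> 1" for y
  proof (cases "y \<le> y0")
    case True
    have "(K * y) powr s \<le> (K * y0) powr s" using True that assms by (intro powr_mono2) auto
    also have "\<dots> = \<eta>" using assms by (simp add: y0_def powr_powr)
    also have "\<dots> \<le> \<eta> + L * y" using L that assms by simp
    finally show ?thesis .
  next
    case False
    have "(K * y) powr s \<le> K powr s" using that assms by (intro powr_mono2) (auto simp: mult_left_le)
    also have "\<dots> \<le> K powr s / y0 * y" using False y0 by (simp add: field_simps mult_right_mono)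
    also have "\<dots> \<le> \<eta> + L * y" using assms that by (simp add: L_def algebra_simps)
    finally show ?thesis .
  qed
  then show ?thesis by (rule that[OF L])
qed

text \<open>The last of \<open>1, t, ..., t^m\<close> is the smallest, and the sum of the
  \<open>t^i (1 - t)\<close> telescopes to at most 1.\<close>

lemma power_mult_one_minus_le:
  fixes t :: real
  assumes "0 \<le> t" "t \<le> 1"
  shows "t ^ m * (1 - t) \<le> 1 / real (Suc m)"
proof -
  have "real (Suc m) * (t ^ m * (1 - t)) = (\<Sum>i<Suc m. t ^ m * (1 - t))" by simp
  also have "\<dots> \<le> (\<Sum>i<Suc m. t ^ i * (1 - t))"
    using assms by (intro sum_mono mult_right_mono power_decreasing) auto
  also have "\<dots> = 1 - t ^ Suc m"
    by (simp add: one_diff_power_eq sum_distrib_left mult.commute del: sum.lessThan_Suc power_Suc)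
  also have "\<dots> \<le> 1" using assms by simp
  finally show ?thesis by (simp add: field_simps)
qed

section \<open>The contraction \<open>1 - a* a / K\<close> and its powers\<close>

text \<open>Adding 1 to the norm keeps \<open>K\<close> positive for \<open>a = 0\<close> and still
  makes both \<open>C\<close> and \<open>1 - C\<close> positive.\<close>

locale convolution_square =
  fixes a :: "'g::group_add \<Rightarrow>\<^sub>0 complex" and K :: real and C :: "'g oper"
  assumes K_def: "K = norm (convolution_adj a o\<^sub>L convolution a) + 1"
    and C_def: "C = id_blinfun - (1 / K) *\<^sub>R (convolution_adj a o\<^sub>L convolution a)"
begin

abbreviation P :: "nat \<Rightarrow> 'g oper" where "P n \<equiv> oper_poly ([:0, 1:] ^ n) C"

lemma K_pos: "0 < K"
  by (simp add: K_def add_nonneg_pos)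

lemma square_eq: "convolution_adj a o\<^sub>L convolution a = K *\<^sub>R (id_blinfun - C)"
  using K_pos by (simp add: C_def)

lemma square_eq_poly: "convolution_adj a o\<^sub>L convolution a = oper_poly [:K, - K:] C"
  unfolding square_eq
  by (simp add: oper_poly_pCons comp.zero_right comp.minus_right comp.scaleR_right scaleR_diff_right)

lemma positive_complement: "positive (id_blinfun - C)"
proof -
  have "cinner ((convolution_adj a o\<^sub>L convolution a) f) f = cinner (convolution a f) (convolution a f)" for f
    using is_adjD[OF is_adj_sym[OF is_adj_convolution]] by simp
  then have "positive (convolution_adj a o\<^sub>L convolution a)"
    unfolding positive_def
    by (auto intro!: is_adj_compose is_adj_convolution is_adj_sym[OF is_adj_convolution] simp: cinner_self)
  then show ?thesis using K_pos by (simp add: C_def positive_scaleR)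
qed

lemma positive_C: "positive C"
proof -
  have "norm (id_blinfun - C) \<le> 1" using K_pos by (simp add: C_def) (simp add: K_def)
  then show ?thesis using positive_id_minus[OF positive_complement] by simp
qed

lemma is_adj_C: "is_adj C C"
  using positive_C by (simp add: positive_def)

lemma C_clinear: "C \<in> clinear_opers"
  using is_adj_clinear is_adj_C by blast

lemma C_in: "closed_subalgebra M \<Longrightarrow> range left_reg \<subseteq> M \<Longrightarrow> C \<in> M"
  unfolding C_def
  by (intro subalgebra_diff id_in subalgebra_scaleR compose_in convolution_in convolution_adj_in)

lemma P_in: "closed_subalgebra M \<Longrightarrow> range left_reg \<subseteq> M \<Longrightarrow> oper_poly q C \<in> M"
  by (intro oper_poly_in_subalgebra id_in C_in)

lemma adj_P: "adj (oper_poly q C) = oper_poly q C"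
  by (intro adj_eqI is_adj_oper_poly is_adj_C)

lemma adj_convolution_P: "adj (convolution a o\<^sub>L oper_poly q C) = oper_poly q C o\<^sub>L convolution_adj a"
  by (intro adj_eqI is_adj_compose is_adj_convolution is_adj_oper_poly is_adj_C)

text \<open>For \<open>x = a q(C)\<close> the product \<open>x* x\<close> is again a polynomial in
  \<open>C\<close>, so the norms of all test elements are computed in the calculus of
  \<open>C\<close>.\<close>

lemma square_P: "(oper_poly q C o\<^sub>L convolution_adj a) o\<^sub>L (convolution a o\<^sub>L oper_poly q C)
    = oper_poly (q * [:K, - K:] * q) C"
  by (metis blinfun_compose_assoc oper_poly_mult square_eq_poly)

lemma norm_P_less_one:
  assumes "0 < n" "norm (P n) < 1"
  shows "norm C < 1"
proof -
  \<comment> \<open>The mean with 1 is a rate in (0, 1) even when \<open>P n = 0\<close>.\<close>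
  define \<theta> where "\<theta> = (norm (P n) + 1) / 2"
  have \<theta>: "0 < \<theta>" "\<theta> < 1" "norm (P n) \<le> \<theta>"
    using assms(2) by (auto simp: \<theta>_def add_nonneg_pos)
  have le: "norm (P (n * m)) \<le> \<theta> ^ m" for m
  proof (induction m)
    case 0
    then show ?case by (simp add: norm_blinfun_bound)
  next
    case (Suc m)
    have "P (n * Suc m) = P n o\<^sub>L P (n * m)"
      by (simp only: oper_poly_mult[symmetric] power_add[symmetric] mult_Suc_right)
    also have "norm \<dots> \<le> norm (P n) * norm (P (n * m))" by (rule norm_blinfun_compose)
    also have "\<dots> \<le> \<theta> * \<theta> ^ m" using Suc \<theta> by (intro mult_mono) auto
    finally show ?case by simp
  qed
  have "norm (P (n * m) (delta g)) \<le> norm (delta g) * \<theta> ^ m" for m g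
    using norm_blinfun[of "P (n * m)" "delta g"] mult_right_mono[OF le[of m] norm_ge_zero[of "delta g"]]
    by (simp add: mult.commute)
  then show ?thesis
    by (intro norm_less_one_of_decay[OF C_clinear is_adj_C assms(1) \<theta>(1,2)]) blast
qed

lemma contraction_of_bounded_below_infinity:
  assumes "0 < \<epsilon>" and below: "\<And>n. \<epsilon> * norm (P n) \<le> norm (convolution a o\<^sub>L P n)"
  shows "norm C < 1"
proof -
  \<comment> \<open>The square of \<open>a C^n\<close> is the polynomial
    \<open>K t^(2n) (1 - t)\<close> at \<open>C\<close>, which on [0, 1] stays below
    \<open>K / (2n + 1)\<close>.\<close>
  have sq: "(norm (convolution a o\<^sub>L P n))\<^sup>2 \<le> K / real (Suc (2 * n))" for n
  proof -
    let ?q = "[:0, 1:] ^ n * [:K, - K:] * [:0, 1:] ^ n :: real poly"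
    have q: "norm (oper_poly ?q C) \<le> K / real (Suc (2 * n))"
    proof (rule positive_contraction_norm_poly_le[OF positive_C positive_complement])
      fix t :: real assume t: "0 \<le> t" "t \<le> 1"
      have "poly ?q t = K * (t ^ (2 * n) * (1 - t))"
        by (simp add: poly_power power_mult_distrib power2_eq_square power_mult algebra_simps)
      then show "\<bar>poly ?q t\<bar> \<le> K / real (Suc (2 * n))"
        using mult_left_mono[OF power_mult_one_minus_le[OF t, of "2 * n"], of K] t K_pos by (simp add: abs_mult)
    qed
    have "norm (convolution a o\<^sub>L P n) \<le> sqrt (K / real (Suc (2 * n)))"
    proof (rule norm_blinfun_bound)
      fix f
      let ?y = "(convolution a o\<^sub>L P n) f"
      have "is_adj (convolution a o\<^sub>L P n) (P n o\<^sub>L convolution_adj a)"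
        by (intro is_adj_compose is_adj_convolution is_adj_oper_poly is_adj_C)
      then have "cinner ?y ?y = cinner f (((P n o\<^sub>L convolution_adj a) o\<^sub>L (convolution a o\<^sub>L P n)) f)"
        by (simp add: is_adj_def)
      then have "complex_of_real ((norm ?y)\<^sup>2) = cinner f (oper_poly ?q C f)"
        by (simp only: square_P cinner_self)
      then have "(norm ?y)\<^sup>2 = cmod (cinner f (oper_poly ?q C f))"
        by (metis abs_of_nonneg norm_of_real zero_le_power2)
      also have "\<dots> \<le> norm f * norm (oper_poly ?q C f)" by (rule norm_cinner_le)
      also have "\<dots> \<le> norm f * (K / real (Suc (2 * n)) * norm f)"
        by (intro mult_left_mono order_trans[OF norm_blinfun mult_right_mono[OF q]]) auto
      also have "\<dots> = (sqrt (K / real (Suc (2 * n))) * norm f)\<^sup>2"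
        using K_pos by (simp add: power_mult_distrib power2_eq_square[of "norm f"])
      finally show "norm ?y \<le> sqrt (K / real (Suc (2 * n))) * norm f"
        by (rule power2_le_imp_le) (use K_pos in simp)
    qed (use K_pos in simp)
    then have "(norm (convolution a o\<^sub>L P n))\<^sup>2 \<le> (sqrt (K / real (Suc (2 * n))))\<^sup>2"
      by (intro power_mono) auto
    then show ?thesis using K_pos by simp
  qed
  \<comment> \<open>Large enough for \<open>K / (2n + 1)\<close> to drop below the square of
    \<open>\<epsilon>\<close>, which forces \<open>norm (P n) < 1\<close>.\<close>
  obtain n where n: "K / \<epsilon>\<^sup>2 < real n" using reals_Archimedean2 by blast
  have "0 < real n" using n K_pos \<open>0 < \<epsilon>\<close> by (smt (verit) divide_pos_pos zero_less_power)
  have "(\<epsilon> * norm (P n))\<^sup>2 \<le> (norm (convolution a o\<^sub>L P n))\<^sup>2"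
    using below[of n] \<open>0 < \<epsilon>\<close> by (intro power_mono) auto
  also have "\<dots> \<le> K / real (Suc (2 * n))" by (rule sq)
  also have "\<dots> < \<epsilon>\<^sup>2"
  proof -
    have "K < \<epsilon>\<^sup>2 * real n" using n \<open>0 < \<epsilon>\<close> by (simp add: divide_less_eq mult.commute)
    also have "\<dots> \<le> \<epsilon>\<^sup>2 * real (Suc (2 * n))" by (intro mult_left_mono) auto
    finally show ?thesis by (simp add: divide_less_eq)
  qed
  finally have "norm (P n) < 1"
    using \<open>0 < \<epsilon>\<close> by (simp add: power_mult_distrib power_less_one_iff)
  then show ?thesis using \<open>0 < real n\<close> by (intro norm_P_less_one[of n]) auto
qed

section \<open>Finite exponents: traces of functions of the contraction\<close>

text \<open>The trace of \<open>u(C)\<close>, that is, the integral of \<open>u\<close> against the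
  spectral measure of \<open>C\<close> at \<open>delta 0\<close>.\<close>

abbreviation I :: "(real \<Rightarrow> real) \<Rightarrow> real" where
  "I u \<equiv> Re (cinner (fun_calc u C (delta 0)) (delta 0))"

lemmas I_mono = fun_calc_mono[OF positive_C positive_complement, of _ _ "delta 0"]
lemmas I_nonneg = fun_calc_nonneg[OF positive_C positive_complement, of _ "delta 0"]

lemma I_linear:
  assumes "continuous_on {0..1} u" "continuous_on {0..1} v"
  shows "I (\<lambda>t. \<alpha> * u t + \<beta> * v t) = \<alpha> * I u + \<beta> * I v"
  unfolding fun_calc_linear[OF positive_C positive_complement assms]
  by (simp add: blinfun.add_left blinfun.scaleR_left cinner.add_left cinner.scaleR_left)

lemma I_poly: "I (poly q) = Re (cinner (oper_poly q C (delta 0)) (delta 0))"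
  by (simp add: fun_calc_poly[OF positive_C positive_complement])

text \<open>Raising to the power \<open>r\<close> removes the outer root, so the test inequalities
  become inequalities between integrals over [0, 1].\<close>

lemma Lp_norm_eq_I:
  assumes p: "p \<noteq> \<infinity>" and r: "r = enn2real p" "1 \<le> r"
    and x: "adj x o\<^sub>L x = oper_poly h C"
    and h: "\<And>t. 0 \<le> t \<Longrightarrow> t \<le> 1 \<Longrightarrow> 0 \<le> poly h t"
  shows "Lp_norm p x powr r = I (\<lambda>t. poly h t powr (r / 2))"
proof -
  have "continuous_on {0..1} (poly h)" by (intro continuous_intros)
  then have "compact (poly h ` {0..1})" by (intro compact_continuous_image) auto
  then obtain R where "\<And>y. y \<in> poly h ` {0..1} \<Longrightarrow> \<bar>y\<bar> \<le> R"
    using compact_imp_bounded bounded_real by metis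
  then have R: "0 \<le> poly h t \<and> poly h t \<le> R" if "0 \<le> t" "t \<le> 1" for t
    using h[OF that] that by fastforce
  have cont: "continuous_on {0..} (\<lambda>t::real. t powr (r / 2))"
    using r by (intro continuous_on_powr') (auto intro: continuous_intros)
  have eq: "fun_calc (\<lambda>t. t powr (r / 2)) (oper_poly h C) = fun_calc (\<lambda>t. poly h t powr (r / 2)) C"
    by (rule fun_calc_pcompose[OF positive_C positive_complement R])
      (auto intro: continuous_on_subset[OF cont])
  \<comment> \<open>Undoing the root leaves the exponent 1, and \<open>powr\<close> with exponent 1
    is the identity only on nonnegative reals.\<close>
  have "0 \<le> I (\<lambda>t. poly h t powr (r / 2))"
  proof (rule I_nonneg)
    show "continuous_on {0..1} (\<lambda>t. poly h t powr (r / 2))"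
      by (rule continuous_on_compose2[OF cont]) (use h in \<open>auto intro!: continuous_intros\<close>)
  qed simp
  moreover have "Lp_norm p x = I (\<lambda>t. poly h t powr (r / 2)) powr (1 / r)"
    using p unfolding Lp_norm_def x r(1)[symmetric] eq vn_trace_def by simp
  ultimately show ?thesis using r by (simp add: powr_powr)
qed

lemma contraction_of_bounded_below_finite:
  assumes p: "p \<noteq> \<infinity>" "1 \<le> p" and "0 < \<epsilon>"
    and below: "\<And>n. \<epsilon> * Lp_norm p (P n) \<le> Lp_norm p (convolution a o\<^sub>L P n)"
  shows "norm C < 1"
proof -
  define r where "r = enn2real p"
  have r: "1 \<le> r"
    using enn2real_mono[of 1 p] p by (simp add: r_def top.not_eq_extremum)
  \<comment> \<open>An outer natural power instead of \<open>t powr (r * n)\<close>: at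
    \<open>t = 0\<close> and \<open>n = 0\<close> it gives 1, whereas
    \<open>0 powr 0 = 0\<close>.\<close>
  define w where "w n = (\<lambda>t::real. (t powr r) ^ n)" for n
  have cont: "continuous_on {0..1} (\<lambda>t::real. t powr s)" if "0 < s" for s
    using that by (intro continuous_on_powr') (auto intro: continuous_intros)
  have w_cont: "continuous_on {0..1} (w n)" for n
    unfolding w_def using r by (intro continuous_on_power cont) simp
  have w_eq: "(t ^ n * t ^ n) powr (r / 2) = w n t" if "0 \<le> t" for t n
  proof (cases "t = 0")
    case False
    then have "t ^ n * t ^ n = t powr (2 * real n)"
      using that by (simp add: powr_realpow[symmetric] powr_add[symmetric])
    then show ?thesis
      using False that by (simp add: w_def powr_powr powr_realpow[symmetric] mult.commute)
  qed (use r in \<open>cases n; simp add: w_def\<close>)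
  \<comment> \<open>The lower bound for the test element \<open>C^n\<close>, raised to the power
    \<open>r\<close>. The factor \<open>(K (1 - t))^(r/2)\<close> comes from
    \<open>a* a\<close>.\<close>
  have below_I: "\<epsilon> powr r * I (w n) \<le> I (\<lambda>t. (K * (1 - t)) powr (r / 2) * w n t)" for n
  proof -
    let ?h = "[:0, 1:] ^ n * [:0, 1:] ^ n :: real poly" and ?k = "[:0, 1:] ^ n * [:K, - K:] * [:0, 1:] ^ n :: real poly"
    have k: "poly ?k t = (K * (1 - t)) * (t ^ n * t ^ n)" for t by (simp add: poly_power algebra_simps)
    have "Lp_norm p (P n) powr r = I (\<lambda>t. poly ?h t powr (r / 2))"
      by (rule Lp_norm_eq_I[OF p(1) r_def r]) (auto simp: adj_P oper_poly_mult poly_power)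
    moreover have "I (w n) \<le> I (\<lambda>t. poly ?h t powr (r / 2))"
    proof (rule I_mono[OF w_cont])
      show "continuous_on {0..1} (\<lambda>t. poly ?h t powr (r / 2))"
        by (rule continuous_on_cong[THEN iffD2, OF refl _ w_cont[of n]]) (simp add: poly_power w_eq)
    qed (simp add: poly_power w_eq)
    moreover have "Lp_norm p (convolution a o\<^sub>L P n) powr r = I (\<lambda>t. poly ?k t powr (r / 2))"
    proof (rule Lp_norm_eq_I[OF p(1) r_def r])
      show "adj (convolution a o\<^sub>L P n) o\<^sub>L (convolution a o\<^sub>L P n) = oper_poly ?k C"
        by (simp only: adj_convolution_P square_P)
      show "0 \<le> poly ?k t" if "0 \<le> t" "t \<le> 1" for t
        unfolding k using that K_pos by (intro mult_nonneg_nonneg) auto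
    qed
    moreover have "I (\<lambda>t. poly ?k t powr (r / 2)) \<le> I (\<lambda>t. (K * (1 - t)) powr (r / 2) * w n t)"
    proof -
      have eq: "poly ?k t powr (r / 2) = (K * (1 - t)) powr (r / 2) * w n t" if "t \<in> {0..1}" for t
        unfolding k using that K_pos by (simp add: powr_mult[of "K * (1 - t)"] w_eq)
      have cont': "continuous_on {0..1} (\<lambda>t. (K * (1 - t)) powr (r / 2) * w n t)"
        using r K_pos by (intro continuous_on_mult w_cont continuous_on_powr') (auto intro!: continuous_intros)
      show ?thesis
      proof (rule I_mono[OF _ cont'])
        show "continuous_on {0..1} (\<lambda>t. poly ?k t powr (r / 2))"
          by (rule continuous_on_cong[THEN iffD2, OF refl eq cont'])
        show "poly ?k t powr (r / 2) \<le> (K * (1 - t)) powr (r / 2) * w n t" if "0 \<le> t" "t \<le> 1" for t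
          by (rule eq_refl[OF eq]) (use that in simp)
      qed
    qed
    moreover have "(\<epsilon> * Lp_norm p (P n)) powr r \<le> Lp_norm p (convolution a o\<^sub>L P n) powr r"
      using below[of n] \<open>0 < \<epsilon>\<close> r p(1) by (intro powr_mono2) (auto simp: Lp_norm_def)
    ultimately show ?thesis
      using \<open>0 < \<epsilon>\<close> p(1) by (simp add: powr_mult Lp_norm_def) (smt (verit) mult_left_mono powr_ge_zero)
  qed
  \<comment> \<open>The affine bound spends one half of \<open>\<epsilon> powr r\<close>; the other
    half survives as the gain of \<open>L - \<eta>\<close> over \<open>L\<close>.\<close>
  define \<eta> where "\<eta> = \<epsilon> powr r / 2"
  have \<eta>: "0 < \<eta>" using \<open>0 < \<epsilon>\<close> by (simp add: \<eta>_def)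
  obtain L where L: "\<eta> < L" "\<And>y. 0 \<le> y \<Longrightarrow> y \<le> 1 \<Longrightarrow> (K * y) powr (r / 2) \<le> \<eta> + L * y"
    using powr_le_affine[OF K_pos, of "r / 2" \<eta>] r \<eta> by auto
  have w_nonneg: "0 \<le> w n t" for n t by (simp add: w_def)
  define \<theta> where "\<theta> = 1 - \<eta> / L"
  have \<theta>: "0 < \<theta>" "\<theta> < 1" using \<eta> L(1) by (auto simp: \<theta>_def)
  have step: "I (w (Suc n)) \<le> \<theta> * I (w n)" for n
  proof -
    have "I (\<lambda>t. (K * (1 - t)) powr (r / 2) * w n t) \<le> I (\<lambda>t. (\<eta> + L) * w n t + (- L) * w (Suc n) t)"
    proof (rule I_mono)
      show "continuous_on {0..1} (\<lambda>t. (K * (1 - t)) powr (r / 2) * w n t)"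
        using r K_pos by (intro continuous_on_mult w_cont continuous_on_powr') (auto intro!: continuous_intros)
      show "continuous_on {0..1} (\<lambda>t. (\<eta> + L) * w n t + (- L) * w (Suc n) t)"
        by (intro continuous_intros w_cont)
      fix t :: real assume t: "0 \<le> t" "t \<le> 1"
      \<comment> \<open>As \<open>r \<ge> 1\<close>, the factor \<open>1 - t\<close> may be enlarged
        to \<open>1 - t powr r\<close>, which turns \<open>w n\<close> into
        \<open>w n - w (Suc n)\<close>.\<close>
      have "t powr r \<le> t"
        using t r by (cases "t = 0") (auto intro: order_trans[OF powr_mono'[of 1 r t]])
      have "(K * (1 - t)) powr (r / 2) \<le> \<eta> + L * (1 - t)" using L(2)[of "1 - t"] t by simp
      also have "\<dots> \<le> \<eta> + L * (1 - t powr r)"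
        using \<open>t powr r \<le> t\<close> L(1) \<eta> by (intro add_left_mono mult_left_mono) auto
      finally have "(K * (1 - t)) powr (r / 2) * w n t \<le> (\<eta> + L * (1 - t powr r)) * w n t"
        by (intro mult_right_mono w_nonneg)
      also have "\<dots> = (\<eta> + L) * w n t + (- L) * w (Suc n) t" by (simp add: w_def algebra_simps)
      finally show "(K * (1 - t)) powr (r / 2) * w n t \<le> (\<eta> + L) * w n t + (- L) * w (Suc n) t" .
    qed
    also have "\<dots> = (\<eta> + L) * I (w n) + (- L) * I (w (Suc n))" by (rule I_linear[OF w_cont w_cont])
    finally have "L * I (w (Suc n)) \<le> (L - \<eta>) * I (w n)"
      using below_I[of n] by (simp add: \<eta>_def algebra_simps)
    then show ?thesis using L(1) \<eta> by (simp add: \<theta>_def field_simps)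
  qed
  have "w 0 = poly 1" by (simp add: w_def fun_eq_iff)
  then have "I (w 0) = Re (cinner (delta 0) (delta 0 :: 'g ell2))" by (simp only: I_poly) simp
  also have "\<dots> = 1" by (simp add: cinner_delta_right delta.rep_eq)
  finally have w0: "I (w 0) = 1" .
  have decay: "I (w m) \<le> \<theta> ^ m" for m
  proof (induction m)
    case (Suc m)
    have "I (w (Suc m)) \<le> \<theta> * I (w m)" by (rule step)
    also have "\<dots> \<le> \<theta> * \<theta> ^ m" using Suc \<theta> by (intro mult_left_mono) auto
    finally show ?case by simp
  qed (simp add: w0)
  \<comment> \<open>A natural exponent above \<open>r\<close> gives
    \<open>t^n \<le> t powr r\<close> on [0, 1], so the integral of \<open>t^(2 n m)\<close> is at
    most that of \<open>w m\<close>.\<close>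
  define n where "n = nat \<lceil>r\<rceil>"
  have n: "0 < n" "r \<le> real n" using r by (auto simp: n_def)
  have "norm (P (n * m) (delta (0 :: 'g))) \<le> sqrt \<theta> ^ m" for m
  proof -
    let ?h = "[:0, 1:] ^ (n * m) :: real poly"
    have "cinner (P (n * m) (delta 0)) (P (n * m) (delta 0)) = cinner (oper_poly (?h * ?h) C (delta 0)) (delta 0)"
      by (simp add: oper_poly_mult is_adjD[OF is_adj_oper_poly[OF is_adj_C]])
    then have "complex_of_real ((norm (P (n * m) (delta 0)))\<^sup>2) = cinner (oper_poly (?h * ?h) C (delta 0)) (delta 0)"
      unfolding cinner_self .
    then have "(norm (P (n * m) (delta 0)))\<^sup>2 = I (poly (?h * ?h))"
      unfolding I_poly by (metis Re_complex_of_real)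
    also have "\<dots> \<le> I (w m)"
    proof (rule I_mono[OF _ w_cont])
      fix t :: real assume t: "0 \<le> t" "t \<le> 1"
      have "t ^ n \<le> t powr r"
      proof (cases "t = 0")
        case False
        then show ?thesis using t n powr_mono'[of r "real n" t] by (simp add: powr_realpow)
      qed (use n in \<open>simp add: power_0_left\<close>)
      then have "(t ^ n) ^ m \<le> w m t" unfolding w_def using t by (intro power_mono) auto
      moreover have "t ^ (n * m) * t ^ (n * m) \<le> t ^ (n * m)"
        using t by (simp add: mult_left_le power_le_one)
      ultimately show "poly (?h * ?h) t \<le> w m t" by (simp add: poly_power power_mult)
    qed (intro continuous_intros)
    also have "\<dots> \<le> (sqrt \<theta> ^ m)\<^sup>2"
      using decay[of m] \<theta> by (simp add: power_mult[symmetric] mult.commute[of m 2] power_mult)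
    finally show ?thesis by (rule power2_le_imp_le) (use \<theta> in simp)
  qed
  \<comment> \<open>Right translations are isometric and commute with \<open>C\<close>, so one rate
    serves every basis vector.\<close>
  moreover have "norm (P k (delta g)) = norm (P k (delta (0 :: 'g)))" for k g
    using right_invariant_delta[OF P_in[OF right_invariant_subalgebra], of _ g] by (simp add: norm_right_reg)
  ultimately have "norm (P (n * m) (delta g)) \<le> 1 * sqrt \<theta> ^ m" for m g by (metis mult_1)
  then have "\<exists>c. \<forall>m. norm (P (n * m) (delta g)) \<le> c * sqrt \<theta> ^ m" for g by blast
  then show ?thesis
    by (rule norm_less_one_of_decay[OF C_clinear is_adj_C n(1), rotated 2]) (use \<theta> in simp_all)
qed

lemma right_inverse_of_contraction:
  assumes M: "closed_subalgebra M" "range left_reg \<subseteq> M" and "norm C < 1"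
  obtains d where "d \<in> M" "convolution a o\<^sub>L d = id_blinfun"
proof -
  obtain E where E: "E \<in> M" "(id_blinfun - C) o\<^sub>L E = id_blinfun" "E o\<^sub>L (id_blinfun - C) = id_blinfun"
    using neumann_inverse[OF M(1) id_in[OF M] C_in[OF M] \<open>norm C < 1\<close>] .
  \<comment> \<open>\<open>D\<close> inverts \<open>a* a\<close>, so \<open>D\<close> times the
    adjoint of \<open>a\<close> is a left inverse of \<open>a\<close>.\<close>
  define D where "D = (1 / K) *\<^sub>R E"
  let ?A = "convolution_adj a o\<^sub>L convolution a"
  have DA: "D o\<^sub>L ?A = id_blinfun" and AD: "?A o\<^sub>L D = id_blinfun"
    using E K_pos by (simp_all only: D_def square_eq comp.scaleR_left comp.scaleR_right) simp_all
  have A: "is_adj ?A ?A" "?A \<in> right_invariant"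
    by (intro is_adj_compose is_adj_convolution is_adj_sym[OF is_adj_convolution]
        compose_in convolution_in convolution_adj_in right_invariant_subalgebra)+
  have D: "?A (D f) = f" "D (?A f) = f" for f
    using AD DA by (metis blinfun_apply_blinfun_compose blinfun_apply_id_blinfun)+
  have adjD: "is_adj D D"
    unfolding is_adj_def by (metis D(1) is_adjD[OF A(1)])
  \<comment> \<open>\<open>M\<close> is an arbitrary closed subalgebra; the right invariance that
    the trace argument uses is inherited by \<open>D\<close> as the two-sided inverse of
    \<open>a* a\<close>.\<close>
  have "D (right_reg g f) = right_reg g (D f)" for g f
    using A(2) D unfolding right_invariant_def by (metis (mono_tags, lifting) mem_Collect_eq)
  then have "D \<in> right_invariant"
    using is_adj_clinear[OF adjD] by (simp add: right_invariant_def)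
  then have "convolution a o\<^sub>L (D o\<^sub>L convolution_adj a) = id_blinfun"
    using adjD DA by (intro right_inverse_of_left_inverse) (simp_all add: blinfun_compose_assoc)
  moreover have "D o\<^sub>L convolution_adj a \<in> M"
    unfolding D_def by (intro compose_in[OF M] subalgebra_scaleR[OF M] E convolution_adj_in[OF M])
  ultimately show ?thesis by (rule that[rotated])
qed

end

text \<open>Polynomials in \<open>C\<close> lie in every such \<open>M\<close>, so the same test
  elements serve \<open>Cstar_red\<close> with \<open>p = \<infinity>\<close> and \<open>VN\<close>
  with any \<open>p\<close>.\<close>

theorem right_inverse_of_bounded_below:
  fixes a :: "'g::group_add \<Rightarrow>\<^sub>0 complex"
  assumes M: "closed_subalgebra M" "range left_reg \<subseteq> M" and p: "1 \<le> p" and \<epsilon>: "0 < \<epsilon>"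
    and below: "\<And>x. x \<in> M \<Longrightarrow> \<epsilon> * Lp_norm p x \<le> Lp_norm p (convolution a o\<^sub>L x)"
  obtains d where "d \<in> M" "convolution a o\<^sub>L d = id_blinfun"
proof -
  interpret convolution_square a "norm (convolution_adj a o\<^sub>L convolution a) + 1"
    "id_blinfun - (1 / (norm (convolution_adj a o\<^sub>L convolution a) + 1)) *\<^sub>R (convolution_adj a o\<^sub>L convolution a)"
    by unfold_locales auto
  note below' = below[OF P_in[OF M]]
  have "norm (id_blinfun - (1 / (norm (convolution_adj a o\<^sub>L convolution a) + 1)) *\<^sub>R
      (convolution_adj a o\<^sub>L convolution a)) < 1"
  proof (cases "p = \<infinity>")
    case True
    show ?thesis
      by (rule contraction_of_bounded_below_infinity[OF \<epsilon>]) (use below' True in \<open>simp add: Lp_norm_def\<close>)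
  next
    case False
    show ?thesis
      by (rule contraction_of_bounded_below_finite[OF False p \<epsilon>]) (rule below')
  qed
  then show ?thesis using right_inverse_of_contraction[OF M] that by blast
qed

section \<open>Representations of the group algebra\<close>

lemma continuous_eq_on_closure:
  fixes f g :: "'a::metric_space \<Rightarrow> 'b::t2_space"
  assumes f: "continuous_on (closure D) f" and g: "continuous_on (closure D) g"
    and eq: "\<And>x. x \<in> D \<Longrightarrow> f x = g x" and x: "x \<in> closure D"
  shows "f x = g x"
proof -
  obtain s where s: "\<And>n. s n \<in> D" "s \<longlonglongrightarrow> x" using x closure_sequential by blast
  then have *: "\<forall>\<^sub>F n in sequentially. s n \<in> closure D" using closure_subset[of D] by (simp add: subsetD)
  have "(\<lambda>n. f (s n)) \<longlonglongrightarrow> f x" by (rule continuous_on_tendsto_compose[OF f s(2) x *])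
  moreover have "(\<lambda>n. f (s n)) \<longlonglongrightarrow> g x"
    unfolding eq[OF s(1)] by (rule continuous_on_tendsto_compose[OF g s(2) x *])
  ultimately show ?thesis by (rule LIMSEQ_unique)
qed

lemma bounded_op_scaleC: "T \<in> bounded_ops X \<Longrightarrow> x \<in> X \<Longrightarrow> T (c *\<^sub>C x) = c *\<^sub>C T x"
  by (simp add: bounded_ops_def)

lemma bounded_op_sum:
  fixes X :: "'a::complex_banach set"
  assumes "closed_csubspace X" "T \<in> bounded_ops X" "\<And>i. i \<in> I \<Longrightarrow> f i \<in> X"
  shows "T (\<Sum>i\<in>I. f i) = (\<Sum>i\<in>I. T (f i))"
  using assms(3)
proof (induction I rule: infinite_finite_induct)
  case (insert i I)
  then show ?case
    by (simp add: bounded_op_add[OF assms(1,2)] closed_csubspace_sum[OF assms(1)])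
qed (use bounded_op_scaleR[OF assms(1,2), of 0 0] assms(1) in \<open>simp_all add: closed_csubspace_def\<close>)

text \<open>The bounded inverse theorem: the range is all of \<open>X\<close>, hence closed, so
  \<open>T\<close> is bounded below.\<close>

lemma bounded_ops_inv:
  fixes X :: "'a::complex_banach set"
  assumes X: "closed_csubspace X" and T: "T \<in> bounded_ops X"
    and inj: "inj_on T X" and surj: "T ` X = X"
  shows "(\<lambda>x\<in>X. inv_into X T x) \<in> bounded_ops X"
proof -
  let ?S = "inv_into X T"
  have S: "?S y \<in> X" "T (?S y) = y" if "y \<in> X" for y
    using that surj by (auto simp: inv_into_into f_inv_into_f)
  have Sx: "?S (T x) = x" if "x \<in> X" for x using that inj by simp
  obtain \<epsilon> where \<epsilon>: "0 < \<epsilon>" "\<And>x. x \<in> X \<Longrightarrow> \<epsilon> * norm x \<le> norm (T x)"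
    using bounded_below_of_closed_range[OF X T inj] X surj by (auto simp: closed_csubspace_def)
  have add: "x + y \<in> X" and scale: "c *\<^sub>C x \<in> X" if "x \<in> X" "y \<in> X" for x y c
    using X that by (auto simp: closed_csubspace_def)
  have "?S (x + y) = ?S x + ?S y" if "x \<in> X" "y \<in> X" for x y
    using Sx[of "?S x + ?S y"] that by (simp add: S add bounded_op_add[OF X T])
  moreover have "?S (c *\<^sub>C x) = c *\<^sub>C ?S x" if "x \<in> X" for c x
    using Sx[of "c *\<^sub>C ?S x"] that by (simp add: S scale bounded_op_scaleC[OF T])
  moreover have "norm (?S x) \<le> 1 / \<epsilon> * norm x" if "x \<in> X" for x
    using \<epsilon>(2)[OF S(1)[OF that]] S(2)[OF that] \<epsilon>(1) by (simp add: field_simps)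
  ultimately show ?thesis
    using S(1) add scale by (auto simp: bounded_ops_def intro!: exI[of _ "1 / \<epsilon>"])
qed

lemma scaleC_zero_left: "0 *\<^sub>C \<xi> = (0 :: 'x::complex_normed_vector)"
  using norm_scaleC[of 0 \<xi>] by simp

locale group_action =
  fixes X :: "'x::complex_banach set" and \<pi> :: "'g::group_add \<Rightarrow> 'x \<Rightarrow> 'x"
  assumes X: "closed_csubspace X" and \<pi>: "\<pi> g \<in> bounded_ops X"
    and \<pi>_add: "\<xi> \<in> X \<Longrightarrow> \<pi> g (\<pi> h \<xi>) = \<pi> (g + h) \<xi>"
    and \<pi>_0: "\<xi> \<in> X \<Longrightarrow> \<pi> 0 \<xi> = \<xi>"
begin

abbreviation rep :: "('g \<Rightarrow>\<^sub>0 complex) \<Rightarrow> 'x \<Rightarrow> 'x" where "rep \<equiv> group_algebra_rep X \<pi>"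

lemma \<pi>_in: "\<xi> \<in> X \<Longrightarrow> \<pi> g \<xi> \<in> X"
  by (rule bounded_op_in[OF X \<pi>])

lemma X_scaleC: "\<xi> \<in> X \<Longrightarrow> c *\<^sub>C \<xi> \<in> X"
  using X by (simp add: closed_csubspace_def)

lemma X_add: "\<xi> \<in> X \<Longrightarrow> \<eta> \<in> X \<Longrightarrow> \<xi> + \<eta> \<in> X"
  using X by (simp add: closed_csubspace_def)

lemma rep_eq_sum:
  assumes "finite S" "Poly_Mapping.keys a \<subseteq> S" "\<xi> \<in> X"
  shows "rep a \<xi> = (\<Sum>g\<in>S. Poly_Mapping.lookup a g *\<^sub>C \<pi> g \<xi>)"
proof -
  have "rep a \<xi> = (\<Sum>g\<in>Poly_Mapping.keys a. Poly_Mapping.lookup a g *\<^sub>C \<pi> g \<xi>)"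
    using assms(3) by (simp add: group_algebra_rep_def)
  also have "\<dots> = (\<Sum>g\<in>S. Poly_Mapping.lookup a g *\<^sub>C \<pi> g \<xi>)"
    using assms by (intro sum.mono_neutral_left) (auto simp: scaleC_zero_left in_keys_iff)
  finally show ?thesis .
qed

lemma rep_add: "\<xi> \<in> X \<Longrightarrow> rep (a + b) \<xi> = rep a \<xi> + rep b \<xi>"
  using rep_eq_sum[of "Poly_Mapping.keys a \<union> Poly_Mapping.keys b"] Poly_Mapping.keys_add[of a b]
  by (simp add: lookup_add scaleC_add_left sum.distrib)

lemma rep_single: "\<xi> \<in> X \<Longrightarrow> rep (Poly_Mapping.single g c) \<xi> = c *\<^sub>C \<pi> g \<xi>"
  using rep_eq_sum[of "{g}" "Poly_Mapping.single g c" \<xi>] by simp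

lemma rep_sum_single:
  "\<xi> \<in> X \<Longrightarrow> rep (\<Sum>i\<in>I. Poly_Mapping.single (\<gamma> i) (\<beta> i)) \<xi> = (\<Sum>i\<in>I. \<beta> i *\<^sub>C \<pi> (\<gamma> i) \<xi>)"
proof (induction I rule: infinite_finite_induct)
  case (insert i I)
  then show ?case by (simp add: rep_add rep_single)
qed (simp_all add: group_algebra_rep_def)

lemma rep_in: "\<xi> \<in> X \<Longrightarrow> rep a \<xi> \<in> X"
  by (simp add: group_algebra_rep_def closed_csubspace_sum[OF X] X_scaleC \<pi>_in)

lemma rep_bounded: "rep a \<in> bounded_ops X"
proof -
  have "\<exists>K. \<forall>\<xi>\<in>X. norm (\<pi> g \<xi>) \<le> K * norm \<xi>" for g
    using \<pi>[of g] by (simp add: bounded_ops_def)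
  then obtain K where K: "\<And>g \<xi>. \<xi> \<in> X \<Longrightarrow> norm (\<pi> g \<xi>) \<le> K g * norm \<xi>" by metis
  have "norm (rep a \<xi>) \<le> (\<Sum>g\<in>Poly_Mapping.keys a. cmod (Poly_Mapping.lookup a g) * K g) * norm \<xi>" if "\<xi> \<in> X" for \<xi>
  proof -
    have "norm (rep a \<xi>) \<le> (\<Sum>g\<in>Poly_Mapping.keys a. cmod (Poly_Mapping.lookup a g) * (K g * norm \<xi>))"
      using that by (simp add: group_algebra_rep_def)
        (intro sum_norm_le, simp add: norm_scaleC mult_left_mono K)
    then show ?thesis by (simp add: sum_distrib_right mult.assoc)
  qed
  moreover have "rep a \<in> X \<rightarrow>\<^sub>E X"
    using rep_in by (auto simp: group_algebra_rep_def)
  moreover have "rep a (\<xi> + \<eta>) = rep a \<xi> + rep a \<eta>" if "\<xi> \<in> X" "\<eta> \<in> X" for \<xi> \<eta>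
    using that by (simp add: group_algebra_rep_def X_add bounded_op_add[OF X \<pi>] scaleC_add_right sum.distrib)
  moreover have "rep a (c *\<^sub>C \<xi>) = c *\<^sub>C rep a \<xi>" if "\<xi> \<in> X" for c \<xi>
  proof -
    have "c *\<^sub>C (\<Sum>i\<in>I. f i) = (\<Sum>i\<in>I. c *\<^sub>C f i)" for f :: "'g \<Rightarrow> 'x" and I
      by (rule linear_sum[OF bounded_linear.linear[OF bounded_linear_scaleC]])
    then show ?thesis
      using that by (simp add: group_algebra_rep_def X_scaleC bounded_op_scaleC[OF \<pi>] scaleC_scaleC mult.commute)
  qed
  ultimately show ?thesis unfolding bounded_ops_def by blast
qed

lemma op_subalgebra_rep: "op_subalgebra (range rep) X"
proof -
  \<comment> \<open>Operators are extensional, so agreement on \<open>X\<close> identifies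
    them.\<close>
  have ext: "f \<in> range rep" if "f \<in> extensional X" "\<And>\<xi>. \<xi> \<in> X \<Longrightarrow> f \<xi> = rep a \<xi>" for f a
  proof -
    have "rep a \<in> extensional X" unfolding group_algebra_rep_def by (rule restrict_extensional)
    then have "f = rep a" using that by (intro extensionalityI)
    then show ?thesis by simp
  qed
  have "(\<lambda>\<xi>\<in>X. 0) \<in> range rep"
    by (rule ext[of _ 0]) (simp_all add: group_algebra_rep_def)
  moreover have "(\<lambda>\<xi>\<in>X. rep a \<xi> + rep b \<xi>) \<in> range rep" for a b
    by (rule ext[of _ "a + b"]) (simp_all add: rep_add)
  moreover have "(\<lambda>\<xi>\<in>X. c *\<^sub>C rep a \<xi>) \<in> range rep" for c a
  proof (rule ext[of _ "\<Sum>g\<in>Poly_Mapping.keys a. Poly_Mapping.single g (c * Poly_Mapping.lookup a g)"])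
    fix \<xi> assume "\<xi> \<in> X"
    then show "(\<lambda>\<xi>\<in>X. c *\<^sub>C rep a \<xi>) \<xi>
        = rep (\<Sum>g\<in>Poly_Mapping.keys a. Poly_Mapping.single g (c * Poly_Mapping.lookup a g)) \<xi>"
      unfolding rep_sum_single[OF \<open>\<xi> \<in> X\<close>]
      by (simp add: group_algebra_rep_def scaleC_scaleC[symmetric]
          linear_sum[OF bounded_linear.linear[OF bounded_linear_scaleC]])
  qed simp
  \<comment> \<open>The witness is the convolution product of \<open>a\<close> and \<open>b\<close>,
    expanded into point masses.\<close>
  moreover have "(\<lambda>\<xi>\<in>X. rep a (rep b \<xi>)) \<in> range rep" for a b
  proof (rule ext[of _ "\<Sum>(g, h)\<in>Poly_Mapping.keys a \<times> Poly_Mapping.keys b.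
        Poly_Mapping.single (g + h) (Poly_Mapping.lookup a g * Poly_Mapping.lookup b h)"])
    fix \<xi> assume \<xi>: "\<xi> \<in> X"
    have "\<pi> g (rep b \<xi>) = (\<Sum>h\<in>Poly_Mapping.keys b. Poly_Mapping.lookup b h *\<^sub>C \<pi> (g + h) \<xi>)" for g
      using \<xi> by (simp add: group_algebra_rep_def bounded_op_sum[OF X \<pi>] bounded_op_scaleC[OF \<pi>] X_scaleC \<pi>_in \<pi>_add)
    then have "rep a (rep b \<xi>) = (\<Sum>g\<in>Poly_Mapping.keys a. \<Sum>h\<in>Poly_Mapping.keys b.
        (Poly_Mapping.lookup a g * Poly_Mapping.lookup b h) *\<^sub>C \<pi> (g + h) \<xi>)"
      using rep_eq_sum[of "Poly_Mapping.keys a" a "rep b \<xi>"] rep_in[OF \<xi>]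
      by (simp add: linear_sum[OF bounded_linear.linear[OF bounded_linear_scaleC]] scaleC_scaleC)
    then show "(\<lambda>\<xi>\<in>X. rep a (rep b \<xi>)) \<xi> = rep (\<Sum>(g, h)\<in>Poly_Mapping.keys a \<times> Poly_Mapping.keys b.
        Poly_Mapping.single (g + h) (Poly_Mapping.lookup a g * Poly_Mapping.lookup b h)) \<xi>"
      using \<xi> rep_sum_single[OF \<xi>, of "\<lambda>(g, h). g + h" "\<lambda>(g, h). Poly_Mapping.lookup a g * Poly_Mapping.lookup b h"
          "Poly_Mapping.keys a \<times> Poly_Mapping.keys b"]
      by (simp add: sum.cartesian_product case_prod_unfold)
  qed simp
  ultimately show ?thesis
    unfolding op_subalgebra_def using rep_bounded by blast
qed

text \<open>Subtracting \<open>c\<close> means subtracting \<open>c\<close> times the neutral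
  element, so \<open>rep a - c\<close> is again some \<open>rep b\<close>, and the spectral
  parameter 0 is the general case.\<close>

lemma surjunctive_pair_rep:
  assumes surj: "\<And>b. inj_on (rep b) X \<Longrightarrow> closed (rep b ` X) \<Longrightarrow> rep b ` X = X"
  shows "surjunctive_pair (range rep) X"
proof -
  have "residual_spectrum X (rep a) = {}" for a
  proof -
    have False if c: "c \<in> residual_spectrum X (rep a)" for c
    proof -
      define b where "b = a + Poly_Mapping.single 0 (- c)"
      have b: "rep a \<xi> - c *\<^sub>C \<xi> = rep b \<xi>" if "\<xi> \<in> X" for \<xi>
      proof -
        have "c *\<^sub>C \<xi> + (- c) *\<^sub>C \<xi> = 0" by (simp add: scaleC_add_left[symmetric] scaleC_zero_left)
        then have "(- c) *\<^sub>C \<xi> = - (c *\<^sub>C \<xi>)" by (simp add: add_eq_0_iff)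
        then show ?thesis using that by (simp add: b_def rep_add rep_single \<pi>_0)
      qed
      have inj: "inj_on (rep b) X"
        using c b unfolding residual_spectrum_def by (metis (mono_tags, lifting) inj_on_cong mem_Collect_eq)
      have "(\<lambda>\<xi>. rep a \<xi> - c *\<^sub>C \<xi>) ` X = rep b ` X" using b by (intro image_cong) auto
      then have "closedin (top_of_set X) (rep b ` X)" using c by (simp add: residual_spectrum_def)
      then have "closed (rep b ` X)" using X closedin_closed_trans by (auto simp: closed_csubspace_def)
      then have S: "rep b ` X = X" using surj inj by blast
      let ?S = "\<lambda>\<xi>\<in>X. inv_into X (rep b) \<xi>"
      have "?S (rep a \<xi> - c *\<^sub>C \<xi>) = \<xi> \<and> rep a (?S \<xi>) - c *\<^sub>C ?S \<xi> = \<xi>" if "\<xi> \<in> X" for \<xi>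
      proof
        show "?S (rep a \<xi> - c *\<^sub>C \<xi>) = \<xi>" unfolding b[OF that] using that inj rep_in by simp
        have "inv_into X (rep b) \<xi> \<in> X" using that S by (metis inv_into_into)
        then show "rep a (?S \<xi>) - c *\<^sub>C ?S \<xi> = \<xi>"
          using that S by (simp add: b f_inv_into_f)
      qed
      then have "c \<notin> spectrum X (rep a)"
        unfolding spectrum_def using bounded_ops_inv[OF X rep_bounded inj S] by blast
      then show False using c by (simp add: residual_spectrum_def)
    qed
    then show ?thesis by blast
  qed
  then show ?thesis unfolding surjunctive_pair_def using X op_subalgebra_rep by blast
qed

end

text \<open>A common frame: \<open>j\<close> is the identity of \<open>Cstar_red\<close> with
  \<open>p = \<infinity>\<close>, or the canonical map from \<open>VN\<close> into its
  completion.\<close>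

locale left_translation =
  fixes M :: "'g::group_add oper set" and X :: "'x::complex_banach set"
    and j :: "'g oper \<Rightarrow> 'x" and p :: ennreal and \<pi> :: "'g \<Rightarrow> 'x \<Rightarrow> 'x"
  assumes M: "closed_subalgebra M" "range left_reg \<subseteq> M"
    and X: "closed_csubspace X" and p: "1 \<le> p"
    and j_add: "x \<in> M \<Longrightarrow> y \<in> M \<Longrightarrow> j (x + y) = j x + j y"
    and j_scaleC: "x \<in> M \<Longrightarrow> j (c *\<^sub>C x) = c *\<^sub>C j x"
    and norm_j: "x \<in> M \<Longrightarrow> norm (j x) = Lp_norm p x"
    and dense: "closure (j ` M) = X"
    and \<pi>: "\<pi> g \<in> bounded_ops X"
    and \<pi>_j: "x \<in> M \<Longrightarrow> \<pi> g (j x) = j (left_reg g o\<^sub>L x)"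
begin

lemma j_in: "x \<in> M \<Longrightarrow> j x \<in> X"
  using subsetD[OF closure_subset[of "j ` M"]] unfolding dense by simp

lemma eq_on_X:
  fixes f f' :: "'x \<Rightarrow> 'y::t2_space"
  assumes "continuous_on X f" "continuous_on X f'" "\<And>x. x \<in> M \<Longrightarrow> f (j x) = f' (j x)" "\<xi> \<in> X"
  shows "f \<xi> = f' \<xi>"
proof (rule continuous_eq_on_closure[of "j ` M" f f'])
  show "f y = f' y" if "y \<in> j ` M" for y using that assms(3) by blast
qed (simp_all add: dense assms)

sublocale group_action X \<pi>
proof
  note cont = bounded_op_continuous[OF X \<pi>]
  fix \<xi> g h assume \<xi>: "\<xi> \<in> X"
  show "\<pi> g (\<pi> h \<xi>) = \<pi> (g + h) \<xi>"
  proof (rule eq_on_X[OF continuous_on_compose2[OF cont cont] cont _ \<xi>])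
    show "\<pi> h ` X \<subseteq> X" using bounded_op_in[OF X \<pi>] by blast
    show "\<pi> g (\<pi> h (j x)) = \<pi> (g + h) (j x)" if "x \<in> M" for x
      using that by (simp add: \<pi>_j compose_in[OF M] left_reg_in[OF M] left_reg_add blinfun_compose_assoc)
  qed
  show "\<pi> 0 \<xi> = \<xi>"
    by (rule eq_on_X[OF cont continuous_on_id _ \<xi>]) (simp add: \<pi>_j left_reg_0)
qed (rule X \<pi>)+

lemma j_sum:
  assumes "\<And>i. i \<in> I \<Longrightarrow> f i \<in> M"
  shows "j (\<Sum>i\<in>I. f i) = (\<Sum>i\<in>I. j (f i))"
  using assms
proof (induction I rule: infinite_finite_induct)
  case (insert i I)
  then show ?case by (simp add: j_add subalgebra_sum[OF M])
qed (use j_scaleC[OF left_reg_in[OF M], of 0 0] left_reg_in[OF M, of 0] in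
  \<open>simp_all add: scaleC_zero_left\<close>)

lemma rep_j:
  assumes "x \<in> M"
  shows "rep a (j x) = j (convolution a o\<^sub>L x)"
proof -
  have in_M: "left_reg g o\<^sub>L x \<in> M" for g
    by (intro compose_in[OF M] left_reg_in[OF M] assms)
  have "convolution a o\<^sub>L x = (\<Sum>g\<in>Poly_Mapping.keys a. Poly_Mapping.lookup a g *\<^sub>C (left_reg g o\<^sub>L x))"
    unfolding convolution_def comp.sum_left by (intro sum.cong refl blinfun_eqI) (simp add: scaleC_blinfun.rep_eq)
  then show ?thesis
    using assms in_M by (simp add: group_algebra_rep_def j_in j_sum subalgebra_scaleC[OF M] j_scaleC \<pi>_j)
qed

theorem surjunctive_pair_translation: "surjunctive_pair (range (group_algebra_rep X \<pi>)) X"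
proof (rule surjunctive_pair_rep)
  fix b assume inj: "inj_on (rep b) X" and cl: "closed (rep b ` X)"
  obtain \<epsilon> where \<epsilon>: "0 < \<epsilon>" "\<And>\<xi>. \<xi> \<in> X \<Longrightarrow> \<epsilon> * norm \<xi> \<le> norm (rep b \<xi>)"
    using bounded_below_of_closed_range[OF X rep_bounded inj cl] by blast
  have "\<epsilon> * Lp_norm p x \<le> Lp_norm p (convolution b o\<^sub>L x)" if "x \<in> M" for x
    using \<epsilon>(2)[OF j_in[OF that]] compose_in[OF M convolution_in[OF M] that]
    by (simp add: rep_j that norm_j)
  then obtain d where d: "d \<in> M" "convolution b o\<^sub>L d = id_blinfun"
    using right_inverse_of_bounded_below[OF M p \<epsilon>(1)] by blast
  have "j x \<in> rep b ` X" if "x \<in> M" for x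
  proof
    show "j (d o\<^sub>L x) \<in> X" by (intro j_in compose_in[OF M] d that)
    show "j x = rep b (j (d o\<^sub>L x))"
      by (simp add: rep_j compose_in[OF M] d that blinfun_compose_assoc[symmetric])
  qed
  then have "closure (j ` M) \<subseteq> rep b ` X" by (intro closure_minimal cl) auto
  then show "rep b ` X = X" using dense rep_in by auto
qed

end

section \<open>The algebras of the group\<close>

lemma closed_subalgebra_clinear_opers: "closed_subalgebra (clinear_opers :: 'g oper set)"
proof -
  have "(clinear_opers :: 'g oper set) = commutant {}" by (simp add: commutant_def)
  then have "closed_csubspace (clinear_opers :: 'g oper set)"
    using closed_csubspace_commutant[of "{} :: 'g oper set"] by simp
  then show ?thesis by (simp add: closed_subalgebra_def) (simp add: clinear_opers_def)
qed

lemma closed_subalgebra_Cstar_red: "closed_subalgebra (Cstar_red :: 'g::group_add oper set)"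
proof -
  let ?\<M> = "{M. closed_subalgebra M \<and> range left_reg \<subseteq> (M :: 'g oper set)}"
  have C: "Cstar_red = \<Inter>?\<M>" by (simp add: Cstar_red_def hull_def)
  \<comment> \<open>A member must be exhibited: the intersection of an empty family would contain
    all real-linear operators.\<close>
  have "clinear_opers \<in> ?\<M>" using closed_subalgebra_clinear_opers left_reg_clinear by blast
  then have "Cstar_red \<subseteq> (clinear_opers :: 'g oper set)" unfolding C by blast
  moreover have "closed_csubspace (Cstar_red :: 'g oper set)"
    unfolding C by (rule closed_csubspace_Inter) (simp add: closed_subalgebra_def)
  moreover have "\<forall>S\<in>Cstar_red. \<forall>T\<in>Cstar_red. S o\<^sub>L T \<in> (Cstar_red :: 'g oper set)"
    unfolding C closed_subalgebra_def by blast
  ultimately show ?thesis by (simp add: closed_subalgebra_def)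
qed

lemma left_reg_Cstar_red: "range left_reg \<subseteq> Cstar_red"
  unfolding Cstar_red_def by (rule hull_subset)

text \<open>Makes the family that defines \<open>VN\<close> nonempty. The double commutant is
  immediate: every operator commutes with whatever commutes with all operators.\<close>

lemma von_neumann_algebra_clinear_opers: "von_neumann_algebra (clinear_opers :: 'g oper set)"
proof -
  have "adj T \<in> clinear_opers" if "T \<in> clinear_opers" for T :: "'g oper"
    using is_adj_clinear[OF is_adj_adj[OF that]] .
  moreover have "commutant (commutant clinear_opers) = (clinear_opers :: 'g oper set)"
    by (auto simp: commutant_def)
  ultimately show ?thesis by (simp add: von_neumann_algebra_def)
qed

lemma commutant_compose: "S \<in> commutant M \<Longrightarrow> T \<in> commutant M \<Longrightarrow> S o\<^sub>L T \<in> commutant M"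
  unfolding commutant_def clinear_opers_def by (simp add: blinfun_eq_iff)

lemma left_reg_VN: "range left_reg \<subseteq> VN"
  unfolding VN_def by (rule hull_subset)

lemma closed_subalgebra_VN: "closed_subalgebra (VN :: 'g::group_add oper set)"
proof -
  let ?\<M> = "{M. von_neumann_algebra M \<and> range left_reg \<subseteq> (M :: 'g oper set)}"
  have VN: "VN = \<Inter>?\<M>" by (simp add: VN_def hull_def)
  have "clinear_opers \<in> ?\<M>" using von_neumann_algebra_clinear_opers left_reg_clinear by blast
  then have "VN \<subseteq> (clinear_opers :: 'g oper set)" unfolding VN by blast
  moreover have "closed_csubspace (VN :: 'g oper set)"
    using is_Lp_space_infinity[where 'a = 'g] by (simp add: is_Lp_space_def)
  moreover have "S o\<^sub>L T \<in> M" if "M \<in> ?\<M>" "S \<in> M" "T \<in> M" for S T M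
    using that commutant_compose[of S "commutant M" T] by (simp add: von_neumann_algebra_def)
  then have "\<forall>S\<in>VN. \<forall>T\<in>VN. S o\<^sub>L T \<in> (VN :: 'g oper set)" unfolding VN by blast
  ultimately show ?thesis by (simp add: closed_subalgebra_def)
qed

lemma norm_left_reg_apply: "norm (left_reg g f) = norm f"
proof -
  have "left_reg (- g) (left_reg g f) = f"
    using left_reg_add[of "- g" g] by (simp add: left_reg_0 blinfun_eq_iff)
  then have "cinner (left_reg g f) (left_reg g f) = cinner f f"
    by (simp add: is_adjD[OF is_adj_left_reg])
  then have "(norm (left_reg g f))\<^sup>2 = (norm f)\<^sup>2"
    unfolding cinner_self of_real_eq_iff .
  then show ?thesis by simp
qed

text \<open>\<open>left_reg g\<close> is unitary, so \<open>x* x\<close> does not change.\<close>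

lemma Lp_norm_left_reg:
  assumes "x \<in> clinear_opers"
  shows "Lp_norm p (left_reg g o\<^sub>L x) = Lp_norm p x"
proof -
  have "adj (left_reg g o\<^sub>L x) = adj x o\<^sub>L left_reg (- g)"
    by (intro adj_eqI is_adj_compose is_adj_left_reg is_adj_adj assms)
  moreover have "left_reg (- g) o\<^sub>L left_reg g = id_blinfun"
    by (simp add: left_reg_add[symmetric] left_reg_0)
  then have "(adj x o\<^sub>L left_reg (- g)) o\<^sub>L (left_reg g o\<^sub>L x) = adj x o\<^sub>L x"
    by (metis blinfun_compose_assoc blinfun_compose_id(1))
  moreover have "norm (left_reg g o\<^sub>L x) = norm x"
    by (simp add: norm_blinfun.rep_eq onorm_def norm_left_reg_apply)
  ultimately show ?thesis by (simp add: Lp_norm_def)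
qed

text \<open>Left translation is isometric on the dense image of \<open>VN\<close>, so it extends by
  uniform continuity; linearity and the norm pass to limits of sequences from
  \<open>VN\<close>.\<close>

lemma Lp_translation_exists:
  fixes j :: "'g::group_add oper \<Rightarrow> 'x::complex_banach"
  assumes "is_Lp_space p X j"
  obtains T where "T \<in> bounded_ops X" "\<And>x. x \<in> VN \<Longrightarrow> T (j x) = j (left_reg g o\<^sub>L x)"
proof -
  have X: "closed_csubspace X" and dense: "closure (j ` VN) = X"
    and j_add: "\<And>x y. x \<in> VN \<Longrightarrow> y \<in> VN \<Longrightarrow> j (x + y) = j x + j y"
    and j_scale: "\<And>c x. x \<in> VN \<Longrightarrow> j (c *\<^sub>C x) = c *\<^sub>C j x"
    and norm_j: "\<And>x. x \<in> VN \<Longrightarrow> norm (j x) = Lp_norm p x"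
    using assms by (auto simp: is_Lp_space_def)
  note VN = closed_subalgebra_VN[where 'g = 'g] left_reg_VN[where 'a = 'g]
  note in_VN = compose_in[OF VN left_reg_in[OF VN]]
  have VN_add: "x + y \<in> VN" if "x \<in> VN" "y \<in> VN" for x y :: "'g oper"
    using closed_subalgebra_VN[where 'g = 'g] that by (simp add: closed_subalgebra_def closed_csubspace_def)
  have j_diff: "j (x - y) = j x - j y" if "x \<in> VN" "y \<in> VN" for x y
    using j_add[of "x - y" y] subalgebra_diff[OF VN that] that by (simp add: algebra_simps)
  have comp_scaleC: "left_reg g o\<^sub>L (c *\<^sub>C x) = c *\<^sub>C (left_reg g o\<^sub>L x)" for c and x :: "'g oper"
    by (rule blinfun_eqI) (simp add: scaleC_blinfun.rep_eq clinear_opersD[OF left_reg_clinear])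
  have iso: "dist (j (left_reg g o\<^sub>L x)) (j (left_reg g o\<^sub>L y)) = dist (j x) (j y)"
    if "x \<in> VN" "y \<in> VN" for x y
  proof -
    have "x - y \<in> VN" using subalgebra_diff[OF VN that] .
    moreover have "x - y \<in> clinear_opers"
      using \<open>x - y \<in> VN\<close> closed_subalgebra_VN[where 'g = 'g] by (auto simp: closed_subalgebra_def)
    ultimately show ?thesis
      using that by (simp add: dist_norm j_diff[symmetric] in_VN comp.diff_right[symmetric] norm_j Lp_norm_left_reg)
  qed
  \<comment> \<open>A preimage is chosen for each vector of the image; by \<open>iso\<close>,
    preimages of the same vector have translates with the same image, so the choice is
    harmless.\<close>
  define T0 where "T0 \<xi> = j (left_reg g o\<^sub>L (SOME x. x \<in> VN \<and> j x = \<xi>))" for \<xi>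
  have T0: "T0 (j x) = j (left_reg g o\<^sub>L x)" if "x \<in> VN" for x
  proof -
    have "(SOME y. y \<in> VN \<and> j y = j x) \<in> VN \<and> j (SOME y. y \<in> VN \<and> j y = j x) = j x"
      by (rule someI[of _ x]) (use that in simp)
    then show ?thesis using iso[of "SOME y. y \<in> VN \<and> j y = j x" x] that by (simp add: T0_def)
  qed
  have "1-lipschitz_on (j ` VN) T0"
    by (intro lipschitz_onI) (auto simp: T0 iso)
  then have "uniformly_continuous_on (j ` VN) T0" by (rule lipschitz_on_uniformly_continuous)
  then obtain G where "uniformly_continuous_on (closure (j ` VN)) G" "\<And>\<xi>. \<xi> \<in> j ` VN \<Longrightarrow> T0 \<xi> = G \<xi>"
    by (rule uniformly_continuous_on_extension_on_closure) blast
  then have G: "continuous_on X G" "\<And>x. x \<in> VN \<Longrightarrow> G (j x) = j (left_reg g o\<^sub>L x)"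
    unfolding dense by (auto simp: uniformly_continuous_imp_continuous T0[symmetric])
  have closed: "closed X" using X by (simp add: closed_csubspace_def)
  have seq: "\<exists>s. (\<forall>n. s n \<in> VN) \<and> (\<lambda>n. j (s n)) \<longlonglongrightarrow> \<xi>" if \<xi>: "\<xi> \<in> X" for \<xi>
  proof -
    have "\<xi> \<in> closure (j ` VN)" using \<xi> by (simp add: dense)
    then obtain t where t: "\<And>n. t n \<in> j ` VN" "t \<longlonglongrightarrow> \<xi>"
      unfolding closure_sequential by blast
    define s where "s n = (SOME x. x \<in> VN \<and> t n = j x)" for n
    have s: "s n \<in> VN \<and> t n = j (s n)" for n
    proof -
      have "\<exists>x. x \<in> VN \<and> t n = j x" using t(1)[of n] by (simp add: image_iff Bex_def)
      then show ?thesis unfolding s_def by (rule someI_ex)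
    qed
    then have "t = (\<lambda>n. j (s n))" by auto
    then show ?thesis using t(2) s by blast
  qed
  have j_X: "j x \<in> X" if "x \<in> VN" for x
    using that subsetD[OF closure_subset[of "j ` VN"]] unfolding dense by simp
  have lim: "(\<lambda>n. j (left_reg g o\<^sub>L s n)) \<longlonglongrightarrow> G \<xi>"
    if "\<xi> \<in> X" "\<And>n. s n \<in> VN" "(\<lambda>n. j (s n)) \<longlonglongrightarrow> \<xi>" for s \<xi>
    using continuous_on_tendsto_compose[OF G(1) that(3,1)] that(2) by (simp add: G(2) j_X)
  have G_in: "G \<xi> \<in> X" if \<xi>: "\<xi> \<in> X" for \<xi>
  proof -
    obtain s where s: "\<And>n. s n \<in> VN" "(\<lambda>n. j (s n)) \<longlonglongrightarrow> \<xi>" using seq[OF \<xi>] by blast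
    show ?thesis by (rule closed_sequentially[OF closed _ lim[OF \<xi> s]]) (intro j_X in_VN s)
  qed
  have G_add: "G (\<xi> + \<eta>) = G \<xi> + G \<eta>" if \<xi>: "\<xi> \<in> X" and \<eta>: "\<eta> \<in> X" for \<xi> \<eta>
  proof -
    obtain s where s: "\<And>n. s n \<in> VN" "(\<lambda>n. j (s n)) \<longlonglongrightarrow> \<xi>" using seq[OF \<xi>] by blast
    obtain t where t: "\<And>n. t n \<in> VN" "(\<lambda>n. j (t n)) \<longlonglongrightarrow> \<eta>" using seq[OF \<eta>] by blast
    have "(\<lambda>n. j (s n + t n)) \<longlonglongrightarrow> \<xi> + \<eta>" using tendsto_add[OF s(2) t(2)] by (simp add: j_add s t)
    then have "(\<lambda>n. j (left_reg g o\<^sub>L (s n + t n))) \<longlonglongrightarrow> G (\<xi> + \<eta>)"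
      using X \<xi> \<eta> by (intro lim) (auto simp: s t VN_add closed_csubspace_def)
    moreover have "(\<lambda>n. j (left_reg g o\<^sub>L (s n + t n))) \<longlonglongrightarrow> G \<xi> + G \<eta>"
      using tendsto_add[OF lim[OF \<xi> s] lim[OF \<eta> t]]
      by (simp add: comp.add_right j_add in_VN s t)
    ultimately show ?thesis by (rule LIMSEQ_unique)
  qed
  have G_scale: "G (c *\<^sub>C \<xi>) = c *\<^sub>C G \<xi>" if \<xi>: "\<xi> \<in> X" for c \<xi>
  proof -
    obtain s where s: "\<And>n. s n \<in> VN" "(\<lambda>n. j (s n)) \<longlonglongrightarrow> \<xi>" using seq[OF \<xi>] by blast
    note sc = bounded_linear.tendsto[OF bounded_linear_scaleC[of c]]
    have "(\<lambda>n. j (c *\<^sub>C s n)) \<longlonglongrightarrow> c *\<^sub>C \<xi>" using sc[OF s(2)] by (simp add: j_scale s)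
    then have "(\<lambda>n. j (left_reg g o\<^sub>L (c *\<^sub>C s n))) \<longlonglongrightarrow> G (c *\<^sub>C \<xi>)"
      using X \<xi> by (intro lim) (auto simp: s subalgebra_scaleC[OF VN] closed_csubspace_def)
    moreover have "(\<lambda>n. j (left_reg g o\<^sub>L (c *\<^sub>C s n))) \<longlonglongrightarrow> c *\<^sub>C G \<xi>"
      using sc[OF lim[OF \<xi> s]] by (simp add: comp_scaleC j_scale in_VN s)
    ultimately show ?thesis by (rule LIMSEQ_unique)
  qed
  have G_norm: "norm (G \<xi>) = norm \<xi>" if \<xi>: "\<xi> \<in> X" for \<xi>
  proof -
    obtain s where s: "\<And>n. s n \<in> VN" "(\<lambda>n. j (s n)) \<longlonglongrightarrow> \<xi>" using seq[OF \<xi>] by blast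
    have "s n \<in> clinear_opers" for n using s(1) closed_subalgebra_VN[where 'g = 'g] by (auto simp: closed_subalgebra_def)
    then have "norm (j (left_reg g o\<^sub>L s n)) = norm (j (s n))" for n
      by (simp add: norm_j in_VN s Lp_norm_left_reg)
    then show ?thesis
      using tendsto_norm[OF lim[OF \<xi> s]] tendsto_norm[OF s(2)] LIMSEQ_unique by simp blast
  qed
  show ?thesis
  proof (rule that[of "\<lambda>\<xi>\<in>X. G \<xi>"])
    show "(\<lambda>\<xi>\<in>X. G \<xi>) \<in> bounded_ops X"
      using X by (auto simp: bounded_ops_def G_in G_add G_scale G_norm closed_csubspace_def intro!: exI[of _ 1])
  qed (simp add: G j_X)
qed

text \<open>The description is proper: two candidates agree on a dense set, hence on
  \<open>X\<close> by continuity, and outside \<open>X\<close> both are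
  \<open>undefined\<close>.\<close>

lemma Lp_translation:
  fixes j :: "'g::group_add oper \<Rightarrow> 'x::complex_banach"
  assumes Lp: "is_Lp_space p X j"
  shows "Lp_translation X j g \<in> bounded_ops X"
    and "x \<in> VN \<Longrightarrow> Lp_translation X j g (j x) = j (left_reg g o\<^sub>L x)"
proof -
  have X: "closed_csubspace X" and dense: "closure (j ` VN) = X"
    using assms by (auto simp: is_Lp_space_def)
  have "\<exists>!T. T \<in> bounded_ops X \<and> (\<forall>x\<in>VN. T (j x) = j (left_reg g o\<^sub>L x))"
  proof (rule ex_ex1I)
    show "\<exists>T. T \<in> bounded_ops X \<and> (\<forall>x\<in>VN. T (j x) = j (left_reg g o\<^sub>L x))"
      using Lp_translation_exists[OF Lp] by metis
    fix S T
    assume S: "S \<in> bounded_ops X \<and> (\<forall>x\<in>VN. S (j x) = j (left_reg g o\<^sub>L x))"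
      and T: "T \<in> bounded_ops X \<and> (\<forall>x\<in>VN. T (j x) = j (left_reg g o\<^sub>L x))"
    have "S \<xi> = T \<xi>" if "\<xi> \<in> X" for \<xi>
    proof (rule continuous_eq_on_closure[of "j ` VN" S T])
      show "S y = T y" if "y \<in> j ` VN" for y using that S T by auto
    qed (use S T that bounded_op_continuous[OF X] in \<open>simp_all add: dense\<close>)
    moreover have "S \<in> extensional X" "T \<in> extensional X"
      using S T by (auto simp: bounded_ops_def PiE_def)
    ultimately show "S = T" by (intro extensionalityI)
  qed
  then have "Lp_translation X j g \<in> bounded_ops X \<and> (\<forall>x\<in>VN. Lp_translation X j g (j x) = j (left_reg g o\<^sub>L x))"
    unfolding Lp_translation_def by (rule theI')
  then show "Lp_translation X j g \<in> bounded_ops X"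
    and "x \<in> VN \<Longrightarrow> Lp_translation X j g (j x) = j (left_reg g o\<^sub>L x)" by auto
qed

theorem theorem2:
  shows "surjunctive_pair
           (range (group_algebra_rep Cstar_red (Cstar_translation :: 'g::group_add \<Rightarrow> _)))
           (Cstar_red :: 'g oper set)
       \<and> (\<forall>p::ennreal. 1 \<le> p \<longrightarrow>
           (\<forall>(X :: 'x::complex_banach set) (j :: 'g oper \<Rightarrow> 'x). is_Lp_space p X j \<longrightarrow>
              surjunctive_pair (range (group_algebra_rep X (Lp_translation X j))) X))"
proof (intro conjI allI impI)
  note C = closed_subalgebra_Cstar_red[where 'g = 'g] left_reg_Cstar_red[where 'a = 'g]
  \<comment> \<open>\<open>Lp_norm \<infinity>\<close> is the operator norm, and
    \<open>Cstar_red\<close> is closed, so it is its own completion.\<close>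
  interpret C: left_translation "Cstar_red :: 'g oper set" "Cstar_red :: 'g oper set" "\<lambda>x. x" \<infinity> Cstar_translation
  proof
    show X: "closed_csubspace (Cstar_red :: 'g oper set)" using C(1) by (simp add: closed_subalgebra_def)
    show "closure ((\<lambda>x. x) ` Cstar_red) = (Cstar_red :: 'g oper set)"
      using X by (simp add: closed_csubspace_def)
    fix g :: 'g
    have "left_reg g o\<^sub>L x \<in> Cstar_red" if "x \<in> Cstar_red" for x
      using that by (intro compose_in[OF C] left_reg_in[OF C])
    moreover have "left_reg g o\<^sub>L (c *\<^sub>C x) = c *\<^sub>C (left_reg g o\<^sub>L x)" for c and x :: "'g oper"
      by (rule blinfun_eqI) (simp add: scaleC_blinfun.rep_eq clinear_opersD[OF left_reg_clinear])
    ultimately show "Cstar_translation g \<in> bounded_ops Cstar_red"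
      using X unfolding bounded_ops_def Cstar_translation_def
      by (auto simp: closed_csubspace_def comp.add_right intro!: exI[of _ "norm (left_reg g)"] norm_blinfun_compose)
  qed (use C in \<open>auto simp: Lp_norm_def Cstar_translation_def\<close>)
  show "surjunctive_pair (range (group_algebra_rep Cstar_red (Cstar_translation :: 'g \<Rightarrow> _))) (Cstar_red :: 'g oper set)"
    by (rule C.surjunctive_pair_translation)
next
  fix p :: ennreal and X :: "'x set" and j :: "'g oper \<Rightarrow> 'x"
  assume p: "1 \<le> p" and Lp: "is_Lp_space p X j"
  interpret left_translation VN X j p "Lp_translation X j"
    using p Lp closed_subalgebra_VN[where 'g = 'g] left_reg_VN Lp_translation[OF Lp]
    by unfold_locales (auto simp: is_Lp_space_def)
  show "surjunctive_pair (range (group_algebra_rep X (Lp_translation X j))) X"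
    by (rule surjunctive_pair_translation)
qed

end
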